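(* $\mathrm{Mat}(\mathbb{Z})$ is the PROP for bicommutative Hopf monoids. That is, for every symmetric monoidal category $\mathcal{C}$, the category of algebras of $\mathrm{Mat}(\mathbb{Z})$ over $\mathcal{C}$ is equivalent to the category of bicommutative Hopf monoids in $\mathcal{C}$.
   Context: A PROP is a (strict) symmetric monoidal category whose objects are the natural numbers and whose tensor product on objects is addition. An algebra of a PROP $\mathcal{T}$ over a symmetric monoidal category $\mathcal{C}$ is a (strong) symmetric monoidal functor $\mathcal{T}\to\mathcal{C}$; morphisms of algebras are monoidal natural transformations. $\mathcal{T}$ is called the PROP for a kind of structure if, for each $\mathcal{C}$, the category of algebras of $\mathcal{T}$ over $\mathcal{C}$ is equivalent to the category of such structures in $\mathcal{C}$. $\mathrm{Mat}(\mathbb{Z})$ is the PROP in which morphisms $m\to n$ are $n\times m$ integer matrices, composition is matrix multiplication, the tensor product of $f$ and $g$ is the block diagonal matrix $\begin{pmatrix} f & 0\\ 0& g\end{pmatrix}$, and the symmetry $m+n\to n+m$ is the block matrix $\begin{pmatrix}0&I_n\\ I_m&0\end{pmatrix}$. Let $\mathcal{C}$ be a symmetric monoidal category with unit $I$ and symmetry $\tau$ (associators and unitors are suppressed). A commutative monoid in $\mathcal{C}$ is an object $A$ with morphisms $\mu_A: A\otimes A\to A$, $\eta_A: I\to A$ satisfying associativity, the unit laws and commutativity. A cocommutative comonoid is an object $A$ with $\Delta_A: A\to A\otimes A$, $\epsilon_A: A\to I$ satisfying the dual axioms. A bicommutative bimonoid is an object that is both a commutative monoid and a cocommutative comonoid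 such that $\Delta_A\mu_A=(\mu_A\otimes\mu_A)(1_A\otimes\tau_{AA}\otimes 1_A)(\Delta_A\otimes\Delta_A)$, $\Delta_A\eta_A=\eta_A\otimes\eta_A$, $\epsilon_A\mu_A=\epsilon_A\otimes\epsilon_A$, $\epsilon_A\eta_A=1_I$. A bimonoid homomorphism $f:A\to B$ is a morphism of $\mathcal{C}$ that is both a monoid homomorphism ($\mu_B(f\otimes f)=f\mu_A$, $f\eta_A=\eta_B$) and a comonoid homomorphism ($\Delta_B f=(f\otimes f)\Delta_A$, $\epsilon_B f=\epsilon_A$). A bicommutative Hopf monoid is a bicommutative bimonoid $A$ equipped with a morphism $S_A:A\to A$ in $\mathcal{C}$ (the antipode) satisfying $\mu_A(S_A\otimes 1_A)\Delta_A=\eta_A\epsilon_A=\mu_A(1_A\otimes S_A)\Delta_A$. A morphism of bicommutative Hopf monoids $A\to B$ is a bimonoid homomorphism $f$ with $fS_A=S_Bf$. *)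

theory Defs
  imports "Jordan_Normal_Form.Matrix" "HOL-Library.FuncSet"
begin

section \<open>Categories\<close>

record ('o, 'a) cat =
  Obj :: "'o set"
  Arr :: "'a set"
  Dom :: "'a \<Rightarrow> 'o"
  Cod :: "'a \<Rightarrow> 'o"
  ide :: "'o \<Rightarrow> 'a"
  arr_comp :: "'a \<Rightarrow> 'a \<Rightarrow> 'a"  (infixr \<open>\<cdot>\<index>\<close> 55)

definition homset :: "('o, 'a, 'x) cat_scheme \<Rightarrow> 'o \<Rightarrow> 'o \<Rightarrow> 'a set" where
  "homset C a b = {f \<in> Arr C. Dom C f = a \<and> Cod C f = b}"

text \<open>Composition is written in applicative order: \<open>g \<cdot> f\<close> is \<open>f\<close> followed by \<open>g\<close>.
  Its value on non-composable pairs is irrelevant.\<close>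

locale category =
  fixes C :: "('o, 'a, 'x) cat_scheme" (structure)
  assumes dom_obj: "f \<in> Arr C \<Longrightarrow> Dom C f \<in> Obj C"
    and cod_obj: "f \<in> Arr C \<Longrightarrow> Cod C f \<in> Obj C"
    and ide_in_hom: "a \<in> Obj C \<Longrightarrow> ide C a \<in> homset C a a"
    and comp_in_hom: "f \<in> homset C a b \<Longrightarrow> g \<in> homset C b c \<Longrightarrow> g \<cdot> f \<in> homset C a c"
    and comp_ide_left: "f \<in> homset C a b \<Longrightarrow> ide C b \<cdot> f = f"
    and comp_ide_right: "f \<in> homset C a b \<Longrightarrow> f \<cdot> ide C a = f"
    and comp_assoc:
      "f \<in> homset C a b \<Longrightarrow> g \<in> homset C b c \<Longrightarrow> h \<in> homset C c d \<Longrightarrow>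
        (h \<cdot> g) \<cdot> f = h \<cdot> (g \<cdot> f)"

definition inverse_arrows :: "('o, 'a, 'x) cat_scheme \<Rightarrow> 'a \<Rightarrow> 'a \<Rightarrow> bool" where
  "inverse_arrows C f g \<longleftrightarrow>
     f \<in> Arr C \<and> g \<in> homset C (Cod C f) (Dom C f) \<and>
     g \<cdot>\<^bsub>C\<^esub> f = ide C (Dom C f) \<and> f \<cdot>\<^bsub>C\<^esub> g = ide C (Cod C f)"

definition iso_arr :: "('o, 'a, 'x) cat_scheme \<Rightarrow> 'a \<Rightarrow> bool" where
  "iso_arr C f \<longleftrightarrow> (\<exists>g. inverse_arrows C f g)"

definition inv_arr :: "('o, 'a, 'x) cat_scheme \<Rightarrow> 'a \<Rightarrow> 'a" where
  "inv_arr C f = (THE g. inverse_arrows C f g)"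


section \<open>Functors, natural transformations, equivalence of categories\<close>

record ('o, 'a, 'p, 'b) ftr =
  on_obj :: "'o \<Rightarrow> 'p"
  on_arr :: "'a \<Rightarrow> 'b"

definition is_functor ::
  "('o, 'a, 'x) cat_scheme \<Rightarrow> ('p, 'b, 'y) cat_scheme \<Rightarrow> ('o, 'a, 'p, 'b, 'z) ftr_scheme \<Rightarrow> bool" where
  "is_functor A B F \<longleftrightarrow>
     category A \<and> category B \<and>
     (\<forall>a \<in> Obj A. on_obj F a \<in> Obj B) \<and>
     (\<forall>f \<in> Arr A. on_arr F f \<in> homset B (on_obj F (Dom A f)) (on_obj F (Cod A f))) \<and>
     (\<forall>a \<in> Obj A. on_arr F (ide A a) = ide B (on_obj F a)) \<and>
     (\<forall>f \<in> Arr A. \<forall>g \<in> Arr A. Cod A f = Dom A g \<longrightarrow>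
        on_arr F (g \<cdot>\<^bsub>A\<^esub> f) = on_arr F g \<cdot>\<^bsub>B\<^esub> on_arr F f)"

definition id_ftr :: "('o, 'a, 'o, 'a) ftr" where
  "id_ftr = \<lparr>on_obj = (\<lambda>a. a), on_arr = (\<lambda>f. f)\<rparr>"

definition comp_ftr ::
  "('p, 'b, 'q, 'c) ftr \<Rightarrow> ('o, 'a, 'p, 'b) ftr \<Rightarrow> ('o, 'a, 'q, 'c) ftr" where
  "comp_ftr G F =
     \<lparr>on_obj = (\<lambda>a. on_obj G (on_obj F a)), on_arr = (\<lambda>f. on_arr G (on_arr F f))\<rparr>"

definition nat_trans ::
  "('o, 'a, 'x) cat_scheme \<Rightarrow> ('p, 'b, 'y) cat_scheme \<Rightarrow> ('o, 'a, 'p, 'b, 'z) ftr_scheme \<Rightarrow>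
   ('o, 'a, 'p, 'b, 'w) ftr_scheme \<Rightarrow> ('o \<Rightarrow> 'b) \<Rightarrow> bool" where
  "nat_trans A B F G t \<longleftrightarrow>
     is_functor A B F \<and> is_functor A B G \<and>
     (\<forall>a \<in> Obj A. t a \<in> homset B (on_obj F a) (on_obj G a)) \<and>
     (\<forall>f \<in> Arr A. t (Cod A f) \<cdot>\<^bsub>B\<^esub> on_arr F f = on_arr G f \<cdot>\<^bsub>B\<^esub> t (Dom A f))"

definition nat_iso ::
  "('o, 'a, 'x) cat_scheme \<Rightarrow> ('p, 'b, 'y) cat_scheme \<Rightarrow> ('o, 'a, 'p, 'b, 'z) ftr_scheme \<Rightarrow>
   ('o, 'a, 'p, 'b, 'w) ftr_scheme \<Rightarrow> ('o \<Rightarrow> 'b) \<Rightarrow> bool" where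
  "nat_iso A B F G t \<longleftrightarrow> nat_trans A B F G t \<and> (\<forall>a \<in> Obj A. iso_arr B (t a))"

definition equivalent_categories ::
  "('o, 'a, 'x) cat_scheme \<Rightarrow> ('p, 'b, 'y) cat_scheme \<Rightarrow> bool" where
  "equivalent_categories A B \<longleftrightarrow>
     (\<exists>(F :: ('o, 'a, 'p, 'b) ftr) (G :: ('p, 'b, 'o, 'a) ftr) s t.
        is_functor A B F \<and> is_functor B A G \<and>
        nat_iso A A id_ftr (comp_ftr G F) s \<and>
        nat_iso B B (comp_ftr F G) id_ftr t)"


section \<open>Symmetric monoidal categories\<close>

record ('o, 'a) smc = "('o, 'a) cat" +
  tensor_obj :: "'o \<Rightarrow> 'o \<Rightarrow> 'o"  (infixr \<open>\<otimes>\<^sub>o\<index>\<close> 70)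
  tensor_arr :: "'a \<Rightarrow> 'a \<Rightarrow> 'a"  (infixr \<open>\<otimes>\<^sub>a\<index>\<close> 70)
  unit_obj :: "'o"
  associator :: "'o \<Rightarrow> 'o \<Rightarrow> 'o \<Rightarrow> 'a"
  left_unitor :: "'o \<Rightarrow> 'a"
  right_unitor :: "'o \<Rightarrow> 'a"
  symmetry :: "'o \<Rightarrow> 'o \<Rightarrow> 'a"

text \<open>The associator goes from \<open>(a \<otimes> b) \<otimes> c\<close> to \<open>a \<otimes> (b \<otimes> c)\<close>. The remaining customary
  coherence conditions (such as compatibility of the symmetry with the unitors) follow from
  the pentagon, the triangle, the hexagon and involutivity of the symmetry.\<close>

locale symmetric_monoidal_category = category C
  for C :: "('o, 'a, 'x) smc_scheme" (structure) +
  assumes tensor_obj_closed: "a \<in> Obj C \<Longrightarrow> b \<in> Obj C \<Longrightarrow> a \<otimes>\<^sub>o b \<in> Obj C"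
    and unit_obj_closed: "unit_obj C \<in> Obj C"
    and tensor_arr_in_hom:
      "f \<in> homset C a b \<Longrightarrow> g \<in> homset C c d \<Longrightarrow> f \<otimes>\<^sub>a g \<in> homset C (a \<otimes>\<^sub>o c) (b \<otimes>\<^sub>o d)"
    and tensor_ide: "a \<in> Obj C \<Longrightarrow> b \<in> Obj C \<Longrightarrow> ide C a \<otimes>\<^sub>a ide C b = ide C (a \<otimes>\<^sub>o b)"
    and tensor_comp:
      "f \<in> homset C a b \<Longrightarrow> g \<in> homset C b c \<Longrightarrow> f' \<in> homset C a' b' \<Longrightarrow> g' \<in> homset C b' c' \<Longrightarrow>
        (g \<cdot> f) \<otimes>\<^sub>a (g' \<cdot> f') = (g \<otimes>\<^sub>a g') \<cdot> (f \<otimes>\<^sub>a f')"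
    and associator_in_hom:
      "a \<in> Obj C \<Longrightarrow> b \<in> Obj C \<Longrightarrow> c \<in> Obj C \<Longrightarrow>
        associator C a b c \<in> homset C ((a \<otimes>\<^sub>o b) \<otimes>\<^sub>o c) (a \<otimes>\<^sub>o (b \<otimes>\<^sub>o c))"
    and associator_iso:
      "a \<in> Obj C \<Longrightarrow> b \<in> Obj C \<Longrightarrow> c \<in> Obj C \<Longrightarrow> iso_arr C (associator C a b c)"
    and associator_natural:
      "f \<in> homset C a a' \<Longrightarrow> g \<in> homset C b b' \<Longrightarrow> h \<in> homset C c c' \<Longrightarrow>
        associator C a' b' c' \<cdot> ((f \<otimes>\<^sub>a g) \<otimes>\<^sub>a h) = (f \<otimes>\<^sub>a (g \<otimes>\<^sub>a h)) \<cdot> associator C a b c"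
    and left_unitor_in_hom:
      "a \<in> Obj C \<Longrightarrow> left_unitor C a \<in> homset C (unit_obj C \<otimes>\<^sub>o a) a"
    and left_unitor_iso: "a \<in> Obj C \<Longrightarrow> iso_arr C (left_unitor C a)"
    and left_unitor_natural:
      "f \<in> homset C a b \<Longrightarrow>
        left_unitor C b \<cdot> (ide C (unit_obj C) \<otimes>\<^sub>a f) = f \<cdot> left_unitor C a"
    and right_unitor_in_hom:
      "a \<in> Obj C \<Longrightarrow> right_unitor C a \<in> homset C (a \<otimes>\<^sub>o unit_obj C) a"
    and right_unitor_iso: "a \<in> Obj C \<Longrightarrow> iso_arr C (right_unitor C a)"
    and right_unitor_natural:
      "f \<in> homset C a b \<Longrightarrow>
        right_unitor C b \<cdot> (f \<otimes>\<^sub>a ide C (unit_obj C)) = f \<cdot> right_unitor C a"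
    and symmetry_in_hom:
      "a \<in> Obj C \<Longrightarrow> b \<in> Obj C \<Longrightarrow> symmetry C a b \<in> homset C (a \<otimes>\<^sub>o b) (b \<otimes>\<^sub>o a)"
    and symmetry_natural:
      "f \<in> homset C a a' \<Longrightarrow> g \<in> homset C b b' \<Longrightarrow>
        symmetry C a' b' \<cdot> (f \<otimes>\<^sub>a g) = (g \<otimes>\<^sub>a f) \<cdot> symmetry C a b"
    and symmetry_involutive:
      "a \<in> Obj C \<Longrightarrow> b \<in> Obj C \<Longrightarrow> symmetry C b a \<cdot> symmetry C a b = ide C (a \<otimes>\<^sub>o b)"
    and pentagon:
      "a \<in> Obj C \<Longrightarrow> b \<in> Obj C \<Longrightarrow> c \<in> Obj C \<Longrightarrow> d \<in> Obj C \<Longrightarrow>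
        associator C a b (c \<otimes>\<^sub>o d) \<cdot> associator C (a \<otimes>\<^sub>o b) c d =
        (ide C a \<otimes>\<^sub>a associator C b c d) \<cdot> associator C a (b \<otimes>\<^sub>o c) d \<cdot>
          (associator C a b c \<otimes>\<^sub>a ide C d)"
    and triangle:
      "a \<in> Obj C \<Longrightarrow> b \<in> Obj C \<Longrightarrow>
        (ide C a \<otimes>\<^sub>a left_unitor C b) \<cdot> associator C a (unit_obj C) b =
        right_unitor C a \<otimes>\<^sub>a ide C b"
    and hexagon:
      "a \<in> Obj C \<Longrightarrow> b \<in> Obj C \<Longrightarrow> c \<in> Obj C \<Longrightarrow>
        associator C b c a \<cdot> symmetry C a (b \<otimes>\<^sub>o c) \<cdot> associator C a b c =
        (ide C b \<otimes>\<^sub>a symmetry C a c) \<cdot> associator C b a c \<cdot> (symmetry C a b \<otimes>\<^sub>a ide C c)"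
begin

text \<open>The map written \<open>1 \<otimes> \<tau> \<otimes> 1\<close> on \<open>a \<otimes> a \<otimes> a \<otimes> a\<close> when associators are suppressed,
  as an endomorphism of \<open>(a \<otimes> a) \<otimes> (a \<otimes> a)\<close>.\<close>

definition middle_swap :: "'o \<Rightarrow> 'a" where
  "middle_swap a =
     inv_arr C (associator C a a (a \<otimes>\<^sub>o a)) \<cdot>
     (ide C a \<otimes>\<^sub>a
        (associator C a a a \<cdot> (symmetry C a a \<otimes>\<^sub>a ide C a) \<cdot> inv_arr C (associator C a a a))) \<cdot>
     associator C a a (a \<otimes>\<^sub>o a)"

end


section \<open>The category of algebras\<close>

text \<open>The structure isomorphisms of a strong monoidal functor \<open>F\<close> are
  \<open>ftr_mult F (a, b) : F a \<otimes> F b \<rightarrow> F (a \<otimes> b)\<close> and \<open>ftr_unit F : I \<rightarrow> F I\<close>.\<close>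

record ('o, 'a, 'p, 'b) smf = "('o, 'a, 'p, 'b) ftr" +
  ftr_mult :: "'o \<times> 'o \<Rightarrow> 'b"
  ftr_unit :: "'b"

text \<open>The extensionality conditions fix the (meaningless) values off the objects and arrows of
  \<open>T\<close>, so that two such functors are equal as soon as they agree where they are defined.\<close>

locale strong_symmetric_monoidal_functor =
  T: symmetric_monoidal_category T + C: symmetric_monoidal_category C
  for T :: "('o, 'a, 'x) smc_scheme" and C :: "('p, 'b, 'y) smc_scheme" +
  fixes F :: "('o, 'a, 'p, 'b) smf"
  assumes is_functor: "is_functor T C F"
    and mult_in_hom:
      "a \<in> Obj T \<Longrightarrow> b \<in> Obj T \<Longrightarrow>
        ftr_mult F (a, b) \<in> homset C (on_obj F a \<otimes>\<^sub>o\<^bsub>C\<^esub> on_obj F b) (on_obj F (a \<otimes>\<^sub>o\<^bsub>T\<^esub> b))"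
    and mult_iso: "a \<in> Obj T \<Longrightarrow> b \<in> Obj T \<Longrightarrow> iso_arr C (ftr_mult F (a, b))"
    and mult_natural:
      "f \<in> homset T a a' \<Longrightarrow> g \<in> homset T b b' \<Longrightarrow>
        ftr_mult F (a', b') \<cdot>\<^bsub>C\<^esub> (on_arr F f \<otimes>\<^sub>a\<^bsub>C\<^esub> on_arr F g) =
        on_arr F (f \<otimes>\<^sub>a\<^bsub>T\<^esub> g) \<cdot>\<^bsub>C\<^esub> ftr_mult F (a, b)"
    and unit_in_hom: "ftr_unit F \<in> homset C (unit_obj C) (on_obj F (unit_obj T))"
    and unit_iso: "iso_arr C (ftr_unit F)"
    and preserves_associator:
      "a \<in> Obj T \<Longrightarrow> b \<in> Obj T \<Longrightarrow> c \<in> Obj T \<Longrightarrow>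
        on_arr F (associator T a b c) \<cdot>\<^bsub>C\<^esub> ftr_mult F (a \<otimes>\<^sub>o\<^bsub>T\<^esub> b, c) \<cdot>\<^bsub>C\<^esub>
          (ftr_mult F (a, b) \<otimes>\<^sub>a\<^bsub>C\<^esub> ide C (on_obj F c)) =
        ftr_mult F (a, b \<otimes>\<^sub>o\<^bsub>T\<^esub> c) \<cdot>\<^bsub>C\<^esub>
          (ide C (on_obj F a) \<otimes>\<^sub>a\<^bsub>C\<^esub> ftr_mult F (b, c)) \<cdot>\<^bsub>C\<^esub>
          associator C (on_obj F a) (on_obj F b) (on_obj F c)"
    and preserves_left_unitor:
      "a \<in> Obj T \<Longrightarrow>
        on_arr F (left_unitor T a) \<cdot>\<^bsub>C\<^esub> ftr_mult F (unit_obj T, a) \<cdot>\<^bsub>C\<^esub>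
          (ftr_unit F \<otimes>\<^sub>a\<^bsub>C\<^esub> ide C (on_obj F a)) =
        left_unitor C (on_obj F a)"
    and preserves_right_unitor:
      "a \<in> Obj T \<Longrightarrow>
        on_arr F (right_unitor T a) \<cdot>\<^bsub>C\<^esub> ftr_mult F (a, unit_obj T) \<cdot>\<^bsub>C\<^esub>
          (ide C (on_obj F a) \<otimes>\<^sub>a\<^bsub>C\<^esub> ftr_unit F) =
        right_unitor C (on_obj F a)"
    and preserves_symmetry:
      "a \<in> Obj T \<Longrightarrow> b \<in> Obj T \<Longrightarrow>
        on_arr F (symmetry T a b) \<cdot>\<^bsub>C\<^esub> ftr_mult F (a, b) =
        ftr_mult F (b, a) \<cdot>\<^bsub>C\<^esub> symmetry C (on_obj F a) (on_obj F b)"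
    and on_obj_extensional: "on_obj F \<in> extensional (Obj T)"
    and on_arr_extensional: "on_arr F \<in> extensional (Arr T)"
    and mult_extensional: "ftr_mult F \<in> extensional (Obj T \<times> Obj T)"

locale monoidal_nat_trans =
  F: strong_symmetric_monoidal_functor T C F + G: strong_symmetric_monoidal_functor T C G
  for T :: "('o, 'a, 'x) smc_scheme" and C :: "('p, 'b, 'y) smc_scheme" and F G +
  fixes t :: "'o \<Rightarrow> 'b"
  assumes nat_trans: "nat_trans T C F G t"
    and preserves_mult:
      "a \<in> Obj T \<Longrightarrow> b \<in> Obj T \<Longrightarrow>
        t (a \<otimes>\<^sub>o\<^bsub>T\<^esub> b) \<cdot>\<^bsub>C\<^esub> ftr_mult F (a, b) = ftr_mult G (a, b) \<cdot>\<^bsub>C\<^esub> (t a \<otimes>\<^sub>a\<^bsub>C\<^esub> t b)"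
    and preserves_unit: "t (unit_obj T) \<cdot>\<^bsub>C\<^esub> ftr_unit F = ftr_unit G"
    and extensional: "t \<in> extensional (Obj T)"

text \<open>An arrow \<open>(F, G, t)\<close> carries its source and target, which \<open>t\<close> alone does not determine.\<close>

definition algebra_category ::
  "('o, 'a, 'x) smc_scheme \<Rightarrow> ('p, 'b, 'y) smc_scheme \<Rightarrow>
   (('o, 'a, 'p, 'b) smf, ('o, 'a, 'p, 'b) smf \<times> ('o, 'a, 'p, 'b) smf \<times> ('o \<Rightarrow> 'b)) cat" where
  "algebra_category T C =
     \<lparr>Obj = {F. strong_symmetric_monoidal_functor T C F},
      Arr = {(F, G, t). monoidal_nat_trans T C F G t},
      Dom = (\<lambda>(F, G, t). F),
      Cod = (\<lambda>(F, G, t). G),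
      ide = (\<lambda>F. (F, F, \<lambda>a \<in> Obj T. ide C (on_obj F a))),
      arr_comp = (\<lambda>(G', H, u) (F, G, t). (F, H, \<lambda>a \<in> Obj T. u a \<cdot>\<^bsub>C\<^esub> t a))\<rparr>"


section \<open>Bicommutative Hopf monoids\<close>

locale commutative_monoid = symmetric_monoidal_category C
  for C :: "('o, 'a, 'x) smc_scheme" (structure) +
  fixes A :: 'o and \<mu> \<eta> :: 'a
  assumes carrier_obj: "A \<in> Obj C"
    and mult_in_hom: "\<mu> \<in> homset C (A \<otimes>\<^sub>o A) A"
    and unit_in_hom: "\<eta> \<in> homset C (unit_obj C) A"
    and mult_assoc:
      "\<mu> \<cdot> (\<mu> \<otimes>\<^sub>a ide C A) = \<mu> \<cdot> (ide C A \<otimes>\<^sub>a \<mu>) \<cdot> associator C A A A"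
    and mult_unit_left: "\<mu> \<cdot> (\<eta> \<otimes>\<^sub>a ide C A) = left_unitor C A"
    and mult_unit_right: "\<mu> \<cdot> (ide C A \<otimes>\<^sub>a \<eta>) = right_unitor C A"
    and mult_commutative: "\<mu> \<cdot> symmetry C A A = \<mu>"

locale cocommutative_comonoid = symmetric_monoidal_category C
  for C :: "('o, 'a, 'x) smc_scheme" (structure) +
  fixes A :: 'o and \<Delta> \<epsilon> :: 'a
  assumes carrier_obj: "A \<in> Obj C"
    and comult_in_hom: "\<Delta> \<in> homset C A (A \<otimes>\<^sub>o A)"
    and counit_in_hom: "\<epsilon> \<in> homset C A (unit_obj C)"
    and comult_coassoc:
      "associator C A A A \<cdot> (\<Delta> \<otimes>\<^sub>a ide C A) \<cdot> \<Delta> = (ide C A \<otimes>\<^sub>a \<Delta>) \<cdot> \<Delta>"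
    and comult_counit_left: "left_unitor C A \<cdot> (\<epsilon> \<otimes>\<^sub>a ide C A) \<cdot> \<Delta> = ide C A"
    and comult_counit_right: "right_unitor C A \<cdot> (ide C A \<otimes>\<^sub>a \<epsilon>) \<cdot> \<Delta> = ide C A"
    and comult_cocommutative: "symmetry C A A \<cdot> \<Delta> = \<Delta>"

locale bicommutative_bimonoid =
  commutative_monoid C A \<mu> \<eta> + cocommutative_comonoid C A \<Delta> \<epsilon>
  for C :: "('o, 'a, 'x) smc_scheme" (structure) and A \<mu> \<eta> \<Delta> \<epsilon> +
  assumes comult_mult: "\<Delta> \<cdot> \<mu> = (\<mu> \<otimes>\<^sub>a \<mu>) \<cdot> middle_swap A \<cdot> (\<Delta> \<otimes>\<^sub>a \<Delta>)"
    and comult_unit: "\<Delta> \<cdot> \<eta> = (\<eta> \<otimes>\<^sub>a \<eta>) \<cdot> inv_arr C (left_unitor C (unit_obj C))"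
    and counit_mult: "\<epsilon> \<cdot> \<mu> = left_unitor C (unit_obj C) \<cdot> (\<epsilon> \<otimes>\<^sub>a \<epsilon>)"
    and counit_unit: "\<epsilon> \<cdot> \<eta> = ide C (unit_obj C)"

record ('o, 'a) hopf_data =
  hopf_obj :: 'o
  hopf_mult :: 'a
  hopf_unit :: 'a
  hopf_comult :: 'a
  hopf_counit :: 'a
  hopf_antipode :: 'a

definition bicommutative_hopf_monoid ::
  "('o, 'a, 'x) smc_scheme \<Rightarrow> ('o, 'a) hopf_data \<Rightarrow> bool" where
  "bicommutative_hopf_monoid C H \<longleftrightarrow>
     (let A = hopf_obj H; \<mu> = hopf_mult H; \<eta> = hopf_unit H; \<Delta> = hopf_comult H;
          \<epsilon> = hopf_counit H; S = hopf_antipode H in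
      bicommutative_bimonoid C A \<mu> \<eta> \<Delta> \<epsilon> \<and>
      S \<in> homset C A A \<and>
      \<mu> \<cdot>\<^bsub>C\<^esub> (S \<otimes>\<^sub>a\<^bsub>C\<^esub> ide C A) \<cdot>\<^bsub>C\<^esub> \<Delta> = \<eta> \<cdot>\<^bsub>C\<^esub> \<epsilon> \<and>
      \<mu> \<cdot>\<^bsub>C\<^esub> (ide C A \<otimes>\<^sub>a\<^bsub>C\<^esub> S) \<cdot>\<^bsub>C\<^esub> \<Delta> = \<eta> \<cdot>\<^bsub>C\<^esub> \<epsilon>)"

definition hopf_monoid_hom ::
  "('o, 'a, 'x) smc_scheme \<Rightarrow> ('o, 'a) hopf_data \<Rightarrow> ('o, 'a) hopf_data \<Rightarrow> 'a \<Rightarrow> bool" where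
  "hopf_monoid_hom C H K f \<longleftrightarrow>
     bicommutative_hopf_monoid C H \<and> bicommutative_hopf_monoid C K \<and>
     f \<in> homset C (hopf_obj H) (hopf_obj K) \<and>
     hopf_mult K \<cdot>\<^bsub>C\<^esub> (f \<otimes>\<^sub>a\<^bsub>C\<^esub> f) = f \<cdot>\<^bsub>C\<^esub> hopf_mult H \<and>
     f \<cdot>\<^bsub>C\<^esub> hopf_unit H = hopf_unit K \<and>
     hopf_comult K \<cdot>\<^bsub>C\<^esub> f = (f \<otimes>\<^sub>a\<^bsub>C\<^esub> f) \<cdot>\<^bsub>C\<^esub> hopf_comult H \<and>
     hopf_counit K \<cdot>\<^bsub>C\<^esub> f = hopf_counit H \<and>
     f \<cdot>\<^bsub>C\<^esub> hopf_antipode H = hopf_antipode K \<cdot>\<^bsub>C\<^esub> f"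

definition hopf_category ::
  "('o, 'a, 'x) smc_scheme \<Rightarrow>
   (('o, 'a) hopf_data, ('o, 'a) hopf_data \<times> ('o, 'a) hopf_data \<times> 'a) cat" where
  "hopf_category C =
     \<lparr>Obj = {H. bicommutative_hopf_monoid C H},
      Arr = {(H, K, f). hopf_monoid_hom C H K f},
      Dom = (\<lambda>(H, K, f). H),
      Cod = (\<lambda>(H, K, f). K),
      ide = (\<lambda>H. (H, H, ide C (hopf_obj H))),
      arr_comp = (\<lambda>(K', L, g) (H, K, f). (H, L, g \<cdot>\<^bsub>C\<^esub> f))\<rparr>"


section \<open>PROPs and integer matrices\<close>

text \<open>Strictness of the tensor product on arrows follows from naturality, as the associator
  and the unitors are identities.\<close>

locale prop_category = symmetric_monoidal_category T
  for T :: "(nat, 'a, 'x) smc_scheme" (structure) +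
  assumes Obj_eq: "Obj T = UNIV"
    and tensor_obj_eq: "m \<otimes>\<^sub>o n = m + n"
    and unit_obj_eq: "unit_obj T = 0"
    and associator_eq: "associator T l m n = ide T (l + m + n)"
    and left_unitor_eq: "left_unitor T n = ide T n"
    and right_unitor_eq: "right_unitor T n = ide T n"

text \<open>A matrix with \<open>n\<close> rows and \<open>m\<close> columns is an arrow from \<open>m\<close> to \<open>n\<close>; a value of type
  \<open>int mat\<close> determines both numbers, also when one of them is \<open>0\<close>.\<close>

definition MatZ :: "(nat, int mat) smc" where
  "MatZ =
     \<lparr>Obj = UNIV,
      Arr = UNIV,
      Dom = dim_col,
      Cod = dim_row,
      ide = (\<lambda>n. 1\<^sub>m n),
      arr_comp = (\<lambda>g f. g * f),
      tensor_obj = (\<lambda>m n. m + n),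
      tensor_arr = (\<lambda>f g. four_block_mat
                           f (0\<^sub>m (dim_row f) (dim_col g))
                           (0\<^sub>m (dim_row g) (dim_col f)) g),
      unit_obj = 0,
      associator = (\<lambda>l m n. 1\<^sub>m (l + m + n)),
      left_unitor = (\<lambda>n. 1\<^sub>m n),
      right_unitor = (\<lambda>n. 1\<^sub>m n),
      symmetry = (\<lambda>m n. four_block_mat
                         (0\<^sub>m n m) (1\<^sub>m n)
                         (1\<^sub>m m) (0\<^sub>m m n))\<rparr>"

end

theory Submission
  imports Defs
begin

text \<open>
  The tensor product makes the cocommutative comonoids of \<open>C\<close> into a category with finite products, and
  a bicommutative Hopf monoid \<open>A\<close> is an abelian group object in it. So the comonoid homomorphisms
  \<open>X \<rightarrow> A\<close> form an abelian group under convolution, and a matrix \<open>M\<close> acts as the unique comonoid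
  homomorphism \<open>A\<^sup>n \<rightarrow> A\<^sup>m\<close> with components \<open>\<Sum>\<^sub>j M\<^sub>i\<^sub>j p\<^sub>j\<close>. Functoriality and the coherence
  conditions of a strong monoidal functor are then checked on components.

  Conversely, an algebra sends the Hopf monoid \<open>1\<close> of \<open>MatZ\<close> to a Hopf monoid of \<open>C\<close>. A Hopf monoid
  homomorphism extends uniquely to a monoidal transformation on the tensor powers. It is natural,
  because every integer matrix is a composite of block sums of identities, swaps and the five
  structure matrices of \<open>1\<close>.
\<close>


section \<open>Symmetric monoidal categories\<close>

text \<open>Tensor products in \<open>C\<close> are bracketed, and the associators stay explicit.
  Coherence of the middle swap is computed directly; the algebra built from a Hopf monoid is then
  checked on projections of finite products, where an associator is just a tuple of projections.

  Defining a functor out of \<open>MatZ\<close> by its values on generators would require a complete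
  set of relations between them. Letting matrices act by integer combinations avoids this:
  functoriality becomes the formula for a matrix product in an abelian group. Generators serve only
  to prove naturality, where generation without relations is enough.

  The antipode is not assumed to be a comonoid homomorphism, yet the comonoid homomorphisms into
  \<open>A\<close> are closed under inverses only because it is one. This is extracted from an
  invertible shear map.

  Powers are nested to the right and end in the unit, so the first power is
  \<open>A \<otimes> I\<close> and not \<open>A\<close>. Evaluating the algebra of a Hopf monoid at
  1 therefore gives that Hopf monoid back only up to the right unitor.\<close>

lemma homset_iff [simp]:
  "f \<in> homset C a b \<longleftrightarrow> f \<in> Arr C \<and> Dom C f = a \<and> Cod C f = b"
  by (auto simp: homset_def)

section \<open>Typing, inverses and cancellation in a category\<close>

context category
begin

text \<open>Typing is carried by simp rules for \<open>Arr\<close>, \<open>Dom\<close> and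
  \<open>Cod\<close>. Since \<open>homset_iff\<close> reduces hom-set conditions to these,
  composability is discharged by rewriting.\<close>

lemma dom_cod_simps [simp]:
  "f \<in> Arr C \<Longrightarrow> Dom C f \<in> Obj C"
  "f \<in> Arr C \<Longrightarrow> Cod C f \<in> Obj C"
  "a \<in> Obj C \<Longrightarrow> ide C a \<in> Arr C"
  "a \<in> Obj C \<Longrightarrow> Dom C (ide C a) = a"
  "a \<in> Obj C \<Longrightarrow> Cod C (ide C a) = a"
  using dom_obj cod_obj ide_in_hom by auto

lemma comp_simps [simp]:
  assumes "f \<in> Arr C" "g \<in> Arr C" "Dom C g = Cod C f"
  shows "g \<cdot> f \<in> Arr C" "Dom C (g \<cdot> f) = Dom C f" "Cod C (g \<cdot> f) = Cod C g"
  using comp_in_hom[of f "Dom C f" "Cod C f" g "Cod C g"] assms by auto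

lemma ide_comp [simp]: "f \<in> Arr C \<Longrightarrow> Cod C f = b \<Longrightarrow> ide C b \<cdot> f = f"
  using comp_ide_left by auto

lemma comp_ide [simp]: "f \<in> Arr C \<Longrightarrow> Dom C f = a \<Longrightarrow> f \<cdot> ide C a = f"
  using comp_ide_right by auto

lemma assoc:
  assumes "f \<in> Arr C" "g \<in> Arr C" "h \<in> Arr C" "Dom C g = Cod C f" "Dom C h = Cod C g"
  shows "(h \<cdot> g) \<cdot> f = h \<cdot> g \<cdot> f"
  using comp_assoc[of f "Dom C f" "Cod C f" g "Cod C g" h "Cod C h"] assms by auto

lemma inverse_arrows_unique:
  assumes "inverse_arrows C f g" "inverse_arrows C f h"
  shows "g = h"
proof -
  have "g = g \<cdot> (f \<cdot> h)"
    using assms by (simp add: inverse_arrows_def)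
  also have "\<dots> = (g \<cdot> f) \<cdot> h"
    using assms by (subst assoc) (auto simp: inverse_arrows_def)
  also have "\<dots> = h"
    using assms by (simp add: inverse_arrows_def)
  finally show ?thesis .
qed

lemma inv_arr_eq: "inverse_arrows C f g \<Longrightarrow> inv_arr C f = g"
  unfolding inv_arr_def using inverse_arrows_unique by blast

lemma inverse_arrows_inv: "iso_arr C f \<Longrightarrow> inverse_arrows C f (inv_arr C f)"
  unfolding iso_arr_def using inv_arr_eq by blast

lemma iso_simps [simp]:
  assumes "iso_arr C f"
  shows "f \<in> Arr C" "inv_arr C f \<in> Arr C" "Dom C (inv_arr C f) = Cod C f"
    "Cod C (inv_arr C f) = Dom C f"
    "f \<cdot> inv_arr C f = ide C (Cod C f)" "inv_arr C f \<cdot> f = ide C (Dom C f)"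
  using inverse_arrows_inv[OF assms] by (auto simp: inverse_arrows_def)

lemma iso_cancel [simp]:
  assumes "iso_arr C f" "g \<in> Arr C"
  shows "Cod C g = Cod C f \<Longrightarrow> f \<cdot> inv_arr C f \<cdot> g = g"
    "Cod C g = Dom C f \<Longrightarrow> inv_arr C f \<cdot> f \<cdot> g = g"
  using assms by (simp_all flip: assoc)

lemma iso_ide: "a \<in> Obj C \<Longrightarrow> iso_arr C (ide C a)"
  unfolding iso_arr_def by (rule exI[of _ "ide C a"]) (simp add: inverse_arrows_def)

lemma inv_ide [simp]: "a \<in> Obj C \<Longrightarrow> inv_arr C (ide C a) = ide C a"
  by (rule inv_arr_eq) (simp add: inverse_arrows_def)

lemma iso_comp: "iso_arr C f \<Longrightarrow> iso_arr C g \<Longrightarrow> Dom C g = Cod C f \<Longrightarrow> iso_arr C (g \<cdot> f)"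
  unfolding iso_arr_def[of C "g \<cdot> f"]
  by (rule exI[of _ "inv_arr C f \<cdot> inv_arr C g"]) (simp add: inverse_arrows_def assoc)

lemma iso_epi:
  assumes "iso_arr C h" "f \<cdot> h = g \<cdot> h" "f \<in> Arr C" "g \<in> Arr C" "Dom C f = Cod C h" "Dom C g = Cod C h"
  shows "f = g"
proof -
  have "(f \<cdot> h) \<cdot> inv_arr C h = (g \<cdot> h) \<cdot> inv_arr C h"
    by (simp add: assms)
  then show ?thesis
    using assms(1,3-) by (simp add: assoc)
qed

lemma iso_mono:
  assumes "iso_arr C h" "h \<cdot> f = h \<cdot> g" "f \<in> Arr C" "g \<in> Arr C" "Cod C f = Dom C h" "Cod C g = Dom C h"
  shows "f = g"
proof -
  have "inv_arr C h \<cdot> h \<cdot> f = inv_arr C h \<cdot> h \<cdot> g"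
    by (simp only: assms)
  then show ?thesis
    using assms(1,3-) by simp
qed

text \<open>With composites nested to the right, \<open>g \<cdot> f\<close> is not a subterm of
  \<open>g \<cdot> f \<cdot> h\<close>. This rule and \<open>comp_cong2\<close> make an equation
  between composites applicable in front of a tail \<open>h\<close>.\<close>

lemma comp_cong:
  assumes "g \<cdot> f = k" "h \<in> Arr C" "f \<in> Arr C" "g \<in> Arr C" "Dom C g = Cod C f" "Dom C f = Cod C h"
  shows "g \<cdot> f \<cdot> h = k \<cdot> h"
  using assms by (simp flip: assoc)

lemma comp_cong2:
  assumes "g \<cdot> f = g' \<cdot> f'" "h \<in> Arr C" "f \<in> Arr C" "g \<in> Arr C" "Dom C g = Cod C f"
    "f' \<in> Arr C" "g' \<in> Arr C" "Dom C g' = Cod C f'" "Dom C f = Cod C h" "Dom C f' = Cod C h"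
  shows "g \<cdot> f \<cdot> h = g' \<cdot> f' \<cdot> h"
  using assms by (simp flip: assoc)

end

section \<open>Interchange, naturality and coherence of the unit\<close>

context symmetric_monoidal_category
begin

abbreviation unit_object (\<open>\<I>\<close>) where "\<I> \<equiv> unit_obj C"
abbreviation ident (\<open>\<ii>\<close>) where "\<ii> a \<equiv> ide C a"
abbreviation assc (\<open>\<aa>\<close>) where "\<aa> a b c \<equiv> associator C a b c"
abbreviation assc_inv (\<open>\<aa>\<aa>\<close>) where "\<aa>\<aa> a b c \<equiv> inv_arr C (associator C a b c)"
abbreviation lunit (\<open>\<ll>\<close>) where "\<ll> a \<equiv> left_unitor C a"
abbreviation runit (\<open>\<rr>\<close>) where "\<rr> a \<equiv> right_unitor C a"
abbreviation symm (\<open>\<ss>\<close>) where "\<ss> a b \<equiv> symmetry C a b"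

lemma smc_simps [simp]:
  "\<I> \<in> Obj C"
  "a \<in> Obj C \<Longrightarrow> b \<in> Obj C \<Longrightarrow> a \<otimes>\<^sub>o b \<in> Obj C"
  "a \<in> Obj C \<Longrightarrow> iso_arr C (\<ll> a)"
  "a \<in> Obj C \<Longrightarrow> Dom C (\<ll> a) = \<I> \<otimes>\<^sub>o a"
  "a \<in> Obj C \<Longrightarrow> Cod C (\<ll> a) = a"
  "a \<in> Obj C \<Longrightarrow> iso_arr C (\<rr> a)"
  "a \<in> Obj C \<Longrightarrow> Dom C (\<rr> a) = a \<otimes>\<^sub>o \<I>"
  "a \<in> Obj C \<Longrightarrow> Cod C (\<rr> a) = a"
  "a \<in> Obj C \<Longrightarrow> b \<in> Obj C \<Longrightarrow> c \<in> Obj C \<Longrightarrow> iso_arr C (\<aa> a b c)"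
  "a \<in> Obj C \<Longrightarrow> b \<in> Obj C \<Longrightarrow> c \<in> Obj C \<Longrightarrow> Dom C (\<aa> a b c) = (a \<otimes>\<^sub>o b) \<otimes>\<^sub>o c"
  "a \<in> Obj C \<Longrightarrow> b \<in> Obj C \<Longrightarrow> c \<in> Obj C \<Longrightarrow> Cod C (\<aa> a b c) = a \<otimes>\<^sub>o b \<otimes>\<^sub>o c"
  "a \<in> Obj C \<Longrightarrow> b \<in> Obj C \<Longrightarrow> \<ss> a b \<in> Arr C"
  "a \<in> Obj C \<Longrightarrow> b \<in> Obj C \<Longrightarrow> Dom C (\<ss> a b) = a \<otimes>\<^sub>o b"
  "a \<in> Obj C \<Longrightarrow> b \<in> Obj C \<Longrightarrow> Cod C (\<ss> a b) = b \<otimes>\<^sub>o a"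
  "a \<in> Obj C \<Longrightarrow> b \<in> Obj C \<Longrightarrow> \<ss> b a \<cdot> \<ss> a b = \<ii> (a \<otimes>\<^sub>o b)"
  using unit_obj_closed tensor_obj_closed left_unitor_iso left_unitor_in_hom right_unitor_iso
    right_unitor_in_hom associator_iso associator_in_hom symmetry_in_hom symmetry_involutive
  by auto

declare tensor_ide [simp]

lemma tensor_simps [simp]:
  assumes "f \<in> Arr C" "g \<in> Arr C"
  shows "f \<otimes>\<^sub>a g \<in> Arr C" "Dom C (f \<otimes>\<^sub>a g) = Dom C f \<otimes>\<^sub>o Dom C g"
    "Cod C (f \<otimes>\<^sub>a g) = Cod C f \<otimes>\<^sub>o Cod C g"
  using tensor_arr_in_hom[of f "Dom C f" "Cod C f" g "Dom C g" "Cod C g"] assms by auto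

lemma symm_cancel [simp]:
  "a \<in> Obj C \<Longrightarrow> b \<in> Obj C \<Longrightarrow> f \<in> Arr C \<Longrightarrow> Cod C f = a \<otimes>\<^sub>o b \<Longrightarrow> \<ss> b a \<cdot> \<ss> a b \<cdot> f = f"
  by (simp flip: assoc)

lemma inverse_symm: "a \<in> Obj C \<Longrightarrow> b \<in> Obj C \<Longrightarrow> inverse_arrows C (\<ss> a b) (\<ss> b a)"
  by (simp add: inverse_arrows_def)

lemma iso_symm [simp]: "a \<in> Obj C \<Longrightarrow> b \<in> Obj C \<Longrightarrow> iso_arr C (\<ss> a b)"
  unfolding iso_arr_def by (blast intro: inverse_symm)

lemma interchange:
  assumes "f \<in> Arr C" "g \<in> Arr C" "f' \<in> Arr C" "g' \<in> Arr C" "Dom C g = Cod C f" "Dom C g' = Cod C f'"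
  shows "(g \<otimes>\<^sub>a g') \<cdot> (f \<otimes>\<^sub>a f') = (g \<cdot> f) \<otimes>\<^sub>a (g' \<cdot> f')"
  using tensor_comp[of f "Dom C f" "Cod C f" g "Cod C g" f' "Dom C f'" "Cod C f'" g' "Cod C g'"] assms
  by simp

text \<open>The interchange law in front of a tail. Together, as \<open>ich\<close>, the two forms
  merge composites of tensors into tensors of composites, so that equations are compared factor by
  factor.\<close>

lemma interchange_comp:
  assumes "f \<in> Arr C" "g \<in> Arr C" "f' \<in> Arr C" "g' \<in> Arr C" "Dom C g = Cod C f" "Dom C g' = Cod C f'"
    "h \<in> Arr C" "Cod C h = Dom C f \<otimes>\<^sub>o Dom C f'"
  shows "(g \<otimes>\<^sub>a g') \<cdot> (f \<otimes>\<^sub>a f') \<cdot> h = ((g \<cdot> f) \<otimes>\<^sub>a (g' \<cdot> f')) \<cdot> h"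
  using assms by (simp add: interchange[symmetric] assoc)

lemmas ich = interchange interchange_comp

lemma inverse_tensor:
  "iso_arr C f \<Longrightarrow> iso_arr C g \<Longrightarrow> inverse_arrows C (f \<otimes>\<^sub>a g) (inv_arr C f \<otimes>\<^sub>a inv_arr C g)"
  by (simp add: inverse_arrows_def ich)

lemma iso_tensor [simp]: "iso_arr C f \<Longrightarrow> iso_arr C g \<Longrightarrow> iso_arr C (f \<otimes>\<^sub>a g)"
  unfolding iso_arr_def[of C "f \<otimes>\<^sub>a g"] by (blast intro: inverse_tensor)

lemma lunit_nat: "f \<in> Arr C \<Longrightarrow> Cod C f = b \<Longrightarrow> \<ll> b \<cdot> (\<ii> \<I> \<otimes>\<^sub>a f) = f \<cdot> \<ll> (Dom C f)"
  using left_unitor_natural by auto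

lemma runit_nat: "f \<in> Arr C \<Longrightarrow> Cod C f = b \<Longrightarrow> \<rr> b \<cdot> (f \<otimes>\<^sub>a \<ii> \<I>) = f \<cdot> \<rr> (Dom C f)"
  using right_unitor_natural by auto

lemma assc_nat:
  "f \<in> Arr C \<Longrightarrow> g \<in> Arr C \<Longrightarrow> h \<in> Arr C \<Longrightarrow> Cod C f = a \<Longrightarrow> Cod C g = b \<Longrightarrow> Cod C h = c \<Longrightarrow>
   \<aa> a b c \<cdot> ((f \<otimes>\<^sub>a g) \<otimes>\<^sub>a h) = (f \<otimes>\<^sub>a (g \<otimes>\<^sub>a h)) \<cdot> \<aa> (Dom C f) (Dom C g) (Dom C h)"
  using associator_natural by auto

lemma symm_nat:
  "f \<in> Arr C \<Longrightarrow> g \<in> Arr C \<Longrightarrow> Cod C f = a \<Longrightarrow> Cod C g = b \<Longrightarrow>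
   \<ss> a b \<cdot> (f \<otimes>\<^sub>a g) = (g \<otimes>\<^sub>a f) \<cdot> \<ss> (Dom C f) (Dom C g)"
  using symmetry_natural by auto

lemma assc_inv_nat:
  assumes "f \<in> Arr C" "g \<in> Arr C" "h \<in> Arr C" "Cod C f = a" "Cod C g = b" "Cod C h = c"
  shows "\<aa>\<aa> a b c \<cdot> (f \<otimes>\<^sub>a (g \<otimes>\<^sub>a h)) = ((f \<otimes>\<^sub>a g) \<otimes>\<^sub>a h) \<cdot> \<aa>\<aa> (Dom C f) (Dom C g) (Dom C h)"
proof -
  have [simp]: "a \<in> Obj C" "b \<in> Obj C" "c \<in> Obj C"
    using assms by auto
  have "\<aa> a b c \<cdot> (\<aa>\<aa> a b c \<cdot> (f \<otimes>\<^sub>a (g \<otimes>\<^sub>a h))) \<cdot> \<aa> (Dom C f) (Dom C g) (Dom C h)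
      = \<aa> a b c \<cdot> (((f \<otimes>\<^sub>a g) \<otimes>\<^sub>a h) \<cdot> \<aa>\<aa> (Dom C f) (Dom C g) (Dom C h)) \<cdot> \<aa> (Dom C f) (Dom C g) (Dom C h)"
    using assms by (simp add: assoc assc_nat)
  then have "(\<aa>\<aa> a b c \<cdot> (f \<otimes>\<^sub>a (g \<otimes>\<^sub>a h))) \<cdot> \<aa> (Dom C f) (Dom C g) (Dom C h)
      = (((f \<otimes>\<^sub>a g) \<otimes>\<^sub>a h) \<cdot> \<aa>\<aa> (Dom C f) (Dom C g) (Dom C h)) \<cdot> \<aa> (Dom C f) (Dom C g) (Dom C h)"
    by (rule iso_mono[rotated]) (use assms in simp_all)
  then show ?thesis
    by (rule iso_epi[rotated]) (use assms in simp_all)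
qed

text \<open>The left unitor is a natural isomorphism from \<open>\<I> \<otimes> -\<close> to the
  identity functor, so tensoring with the unit is faithful. Equations may thus be proved after
  adding a factor \<open>\<I>\<close>, which gives the pentagon and the triangle something to act
  on.\<close>

lemma unit_tensor_faithful:
  assumes "\<ii> \<I> \<otimes>\<^sub>a f = \<ii> \<I> \<otimes>\<^sub>a g" "f \<in> Arr C" "g \<in> Arr C" "Dom C f = Dom C g" "Cod C f = Cod C g"
  shows "f = g"
proof -
  have "f \<cdot> \<ll> (Dom C f) = g \<cdot> \<ll> (Dom C f)"
    using assms lunit_nat[of f] lunit_nat[of g] by auto
  then show ?thesis
    by (rule iso_epi[rotated]) (use assms in simp_all)
qed

lemma tensor_unit_faithful:
  assumes "f \<otimes>\<^sub>a \<ii> \<I> = g \<otimes>\<^sub>a \<ii> \<I>" "f \<in> Arr C" "g \<in> Arr C" "Dom C f = Dom C g" "Cod C f = Cod C g"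
  shows "f = g"
proof -
  have "f \<cdot> \<rr> (Dom C f) = g \<cdot> \<rr> (Dom C f)"
    using assms runit_nat[of f] runit_nat[of g] by auto
  then show ?thesis
    by (rule iso_epi[rotated]) (use assms in simp_all)
qed

text \<open>Kelly's argument: after tensoring with \<open>\<I>\<close>, the pentagon at
  \<open>\<I>, \<I>, x, y\<close> and two instances of the triangle identify both sides, up to the
  isomorphism \<open>?k\<close>.\<close>

lemma lunit_assc:
  assumes [simp]: "x \<in> Obj C" "y \<in> Obj C"
  shows "\<ll> (x \<otimes>\<^sub>o y) \<cdot> \<aa> \<I> x y = \<ll> x \<otimes>\<^sub>a \<ii> y"
proof (rule unit_tensor_faithful)
  let ?k = "\<aa> \<I> (\<I> \<otimes>\<^sub>o x) y \<cdot> (\<aa> \<I> \<I> x \<otimes>\<^sub>a \<ii> y)"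
  have "(\<ii> \<I> \<otimes>\<^sub>a (\<ll> (x \<otimes>\<^sub>o y) \<cdot> \<aa> \<I> x y)) \<cdot> ?k
      = (\<ii> \<I> \<otimes>\<^sub>a \<ll> (x \<otimes>\<^sub>o y)) \<cdot> (\<ii> \<I> \<otimes>\<^sub>a \<aa> \<I> x y) \<cdot> ?k"
    by (simp add: ich)
  also have "\<dots> = (\<ii> \<I> \<otimes>\<^sub>a \<ll> (x \<otimes>\<^sub>o y)) \<cdot> \<aa> \<I> \<I> (x \<otimes>\<^sub>o y) \<cdot> \<aa> (\<I> \<otimes>\<^sub>o \<I>) x y"
    by (simp add: pentagon)
  also have "\<dots> = (\<rr> \<I> \<otimes>\<^sub>a (\<ii> x \<otimes>\<^sub>a \<ii> y)) \<cdot> \<aa> (\<I> \<otimes>\<^sub>o \<I>) x y"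
    using triangle[of \<I> "x \<otimes>\<^sub>o y"] by (simp flip: assoc)
  also have "\<dots> = \<aa> \<I> x y \<cdot> ((\<rr> \<I> \<otimes>\<^sub>a \<ii> x) \<otimes>\<^sub>a \<ii> y)"
    by (subst assc_nat) simp_all
  also have "\<dots> = \<aa> \<I> x y \<cdot> ((\<ii> \<I> \<otimes>\<^sub>a \<ll> x) \<otimes>\<^sub>a \<ii> y) \<cdot> (\<aa> \<I> \<I> x \<otimes>\<^sub>a \<ii> y)"
    by (simp add: ich triangle)
  also have "\<dots> = (\<ii> \<I> \<otimes>\<^sub>a (\<ll> x \<otimes>\<^sub>a \<ii> y)) \<cdot> ?k"
    using assc_nat[of "\<ii> \<I>" "\<ll> x" "\<ii> y" \<I> x y]
    by (simp flip: assoc)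
  finally show "\<ii> \<I> \<otimes>\<^sub>a (\<ll> (x \<otimes>\<^sub>o y) \<cdot> \<aa> \<I> x y) = \<ii> \<I> \<otimes>\<^sub>a \<ll> x \<otimes>\<^sub>a \<ii> y"
    by (rule iso_epi[rotated]) (simp_all add: iso_comp iso_ide)
qed simp_all

text \<open>Naturality of the left unitor against itself gives \<open>\<ll> (\<I> \<otimes> \<I>) =
  \<ii> \<I> \<otimes> \<ll> \<I>\<close>; then \<open>lunit_assc\<close> and the triangle express
  the same arrow through the two unitors.\<close>

lemma lunit_unit: "\<ll> \<I> = \<rr> \<I>"
proof (rule tensor_unit_faithful)
  have "\<ll> \<I> \<cdot> \<ll> (\<I> \<otimes>\<^sub>o \<I>) = \<ll> \<I> \<cdot> (\<ii> \<I> \<otimes>\<^sub>a \<ll> \<I>)"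
    by (simp add: lunit_nat)
  then have "\<ll> (\<I> \<otimes>\<^sub>o \<I>) = \<ii> \<I> \<otimes>\<^sub>a \<ll> \<I>"
    by (rule iso_mono[rotated]) simp_all
  then show "\<ll> \<I> \<otimes>\<^sub>a \<ii> \<I> = \<rr> \<I> \<otimes>\<^sub>a \<ii> \<I>"
    using lunit_assc[of \<I> \<I>] triangle[of \<I> \<I>] by simp
qed simp_all

text \<open>The hexagon at \<open>x, \<I>, \<I>\<close>, with the unit factors removed by the
  triangle and \<open>lunit_assc\<close>, leaves one symmetry on both sides, which cancels.\<close>

lemma lunit_symm:
  assumes [simp]: "x \<in> Obj C"
  shows "\<ll> x \<cdot> \<ss> x \<I> = \<rr> x"
proof -
  have "\<ss> x \<I> \<cdot> (\<rr> x \<otimes>\<^sub>a \<ii> \<I>) = \<ss> x \<I> \<cdot> (\<ii> x \<otimes>\<^sub>a \<ll> \<I>) \<cdot> \<aa> x \<I> \<I>"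
    by (simp add: triangle)
  also have "\<dots> = (\<ll> \<I> \<otimes>\<^sub>a \<ii> x) \<cdot> \<ss> x (\<I> \<otimes>\<^sub>o \<I>) \<cdot> \<aa> x \<I> \<I>"
    using symm_nat[of "\<ii> x" "\<ll> \<I>" x \<I>] by (simp flip: assoc)
  also have "\<dots> = \<ll> (\<I> \<otimes>\<^sub>o x) \<cdot> \<aa> \<I> \<I> x \<cdot> \<ss> x (\<I> \<otimes>\<^sub>o \<I>) \<cdot> \<aa> x \<I> \<I>"
    by (simp add: lunit_assc[symmetric] assoc)
  also have "\<dots> = \<ll> (\<I> \<otimes>\<^sub>o x) \<cdot> (\<ii> \<I> \<otimes>\<^sub>a \<ss> x \<I>) \<cdot> \<aa> \<I> x \<I> \<cdot> (\<ss> x \<I> \<otimes>\<^sub>a \<ii> \<I>)"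
    by (simp add: hexagon)
  also have "\<dots> = \<ss> x \<I> \<cdot> \<ll> (x \<otimes>\<^sub>o \<I>) \<cdot> \<aa> \<I> x \<I> \<cdot> (\<ss> x \<I> \<otimes>\<^sub>a \<ii> \<I>)"
    using lunit_nat[of "\<ss> x \<I>"] by (simp flip: assoc)
  also have "\<dots> = \<ss> x \<I> \<cdot> ((\<ll> x \<cdot> \<ss> x \<I>) \<otimes>\<^sub>a \<ii> \<I>)"
    using lunit_assc[of x \<I>] by (simp add: ich flip: assoc)
  finally have "\<rr> x \<otimes>\<^sub>a \<ii> \<I> = (\<ll> x \<cdot> \<ss> x \<I>) \<otimes>\<^sub>a \<ii> \<I>"
    by (rule iso_mono[rotated]) simp_all
  then have "\<rr> x = \<ll> x \<cdot> \<ss> x \<I>"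
    by (rule tensor_unit_faithful) simp_all
  then show ?thesis ..
qed

lemma symm_unit: "\<ss> \<I> \<I> = \<ii> (\<I> \<otimes>\<^sub>o \<I>)"
  by (rule iso_mono[of "\<ll> \<I>"]) (simp_all add: lunit_symm lunit_unit[symmetric])

end

section \<open>Permutations of tensor factors and coherence of the middle swap\<close>

context symmetric_monoidal_category
begin

definition lswap (\<open>\<cc>\<close>) where
  "\<cc> x y z = \<aa> y x z \<cdot> (\<ss> x y \<otimes>\<^sub>a \<ii> z) \<cdot> \<aa>\<aa> x y z"

text \<open>\<open>middle_swap\<close> with four independent objects: naturality and coherence can
  only be stated if the factors may differ. It is the structure map that makes the tensor product a
  monoidal functor on pairs of objects.\<close>

definition mswap (\<open>\<mm>\<close>) where
  "\<mm> x y z w = \<aa>\<aa> x z (y \<otimes>\<^sub>o w) \<cdot> (\<ii> x \<otimes>\<^sub>a \<cc> y z w) \<cdot> \<aa> x y (z \<otimes>\<^sub>o w)"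

lemma middle_swap_eq: "middle_swap x = \<mm> x x x x"
  by (simp add: middle_swap_def mswap_def lswap_def)

lemma lswap_simps [simp]:
  assumes "x \<in> Obj C" "y \<in> Obj C" "z \<in> Obj C"
  shows "\<cc> x y z \<in> Arr C" "Dom C (\<cc> x y z) = x \<otimes>\<^sub>o y \<otimes>\<^sub>o z" "Cod C (\<cc> x y z) = y \<otimes>\<^sub>o x \<otimes>\<^sub>o z"
  using assms by (simp_all add: lswap_def)

lemma mswap_simps [simp]:
  assumes "x \<in> Obj C" "y \<in> Obj C" "z \<in> Obj C" "w \<in> Obj C"
  shows "\<mm> x y z w \<in> Arr C" "Dom C (\<mm> x y z w) = (x \<otimes>\<^sub>o y) \<otimes>\<^sub>o z \<otimes>\<^sub>o w"
    "Cod C (\<mm> x y z w) = (x \<otimes>\<^sub>o z) \<otimes>\<^sub>o y \<otimes>\<^sub>o w"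
  using assms by (simp_all add: mswap_def)

lemma lswap_inverse:
  assumes [simp]: "x \<in> Obj C" "y \<in> Obj C" "z \<in> Obj C"
  shows "\<cc> y x z \<cdot> \<cc> x y z = \<ii> (x \<otimes>\<^sub>o y \<otimes>\<^sub>o z)"
  by (simp add: lswap_def assoc ich)

lemma lswap_cancel [simp]:
  assumes "x \<in> Obj C" "y \<in> Obj C" "z \<in> Obj C" "f \<in> Arr C" "Cod C f = x \<otimes>\<^sub>o y \<otimes>\<^sub>o z"
  shows "\<cc> y x z \<cdot> \<cc> x y z \<cdot> f = f"
  using assms lswap_inverse by (simp add: comp_cong[OF lswap_inverse])

lemma lswap_nat:
  assumes "f \<in> Arr C" "g \<in> Arr C" "h \<in> Arr C" "Cod C f = a" "Cod C g = b" "Cod C h = c"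
  shows "\<cc> a b c \<cdot> (f \<otimes>\<^sub>a (g \<otimes>\<^sub>a h)) = (g \<otimes>\<^sub>a (f \<otimes>\<^sub>a h)) \<cdot> \<cc> (Dom C f) (Dom C g) (Dom C h)"
proof -
  have [simp]: "a \<in> Obj C" "b \<in> Obj C" "c \<in> Obj C"
    using assms by auto
  have "\<cc> a b c \<cdot> (f \<otimes>\<^sub>a (g \<otimes>\<^sub>a h))
      = \<aa> b a c \<cdot> (\<ss> a b \<otimes>\<^sub>a \<ii> c) \<cdot> ((f \<otimes>\<^sub>a g) \<otimes>\<^sub>a h) \<cdot> \<aa>\<aa> (Dom C f) (Dom C g) (Dom C h)"
    using assms by (simp add: lswap_def assoc assc_inv_nat)
  also have "\<dots> = \<aa> b a c \<cdot> ((g \<otimes>\<^sub>a f) \<otimes>\<^sub>a h) \<cdot> (\<ss> (Dom C f) (Dom C g) \<otimes>\<^sub>a \<ii> (Dom C h)) \<cdot> \<aa>\<aa> (Dom C f) (Dom C g) (Dom C h)"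
    using assms by (simp add: ich symm_nat)
  also have "\<dots> = (g \<otimes>\<^sub>a (f \<otimes>\<^sub>a h)) \<cdot> \<cc> (Dom C f) (Dom C g) (Dom C h)"
    using assms assc_nat[of g f h b a c] by (simp add: lswap_def flip: assoc)
  finally show ?thesis .
qed

lemma mswap_nat:
  assumes "f \<in> Arr C" "g \<in> Arr C" "h \<in> Arr C" "k \<in> Arr C"
    "Cod C f = a" "Cod C g = b" "Cod C h = c" "Cod C k = d"
  shows "\<mm> a b c d \<cdot> ((f \<otimes>\<^sub>a g) \<otimes>\<^sub>a (h \<otimes>\<^sub>a k))
    = ((f \<otimes>\<^sub>a h) \<otimes>\<^sub>a (g \<otimes>\<^sub>a k)) \<cdot> \<mm> (Dom C f) (Dom C g) (Dom C h) (Dom C k)"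
proof -
  have [simp]: "a \<in> Obj C" "b \<in> Obj C" "c \<in> Obj C" "d \<in> Obj C"
    using assms by auto
  have "\<mm> a b c d \<cdot> ((f \<otimes>\<^sub>a g) \<otimes>\<^sub>a (h \<otimes>\<^sub>a k))
      = \<aa>\<aa> a c (b \<otimes>\<^sub>o d) \<cdot> (\<ii> a \<otimes>\<^sub>a \<cc> b c d) \<cdot> (f \<otimes>\<^sub>a (g \<otimes>\<^sub>a (h \<otimes>\<^sub>a k))) \<cdot> \<aa> (Dom C f) (Dom C g) (Dom C h \<otimes>\<^sub>o Dom C k)"
    using assms by (simp add: mswap_def assoc assc_nat)
  also have "\<dots> = \<aa>\<aa> a c (b \<otimes>\<^sub>o d) \<cdot> (f \<otimes>\<^sub>a (h \<otimes>\<^sub>a (g \<otimes>\<^sub>a k))) \<cdot> (\<ii> (Dom C f) \<otimes>\<^sub>a \<cc> (Dom C g) (Dom C h) (Dom C k)) \<cdot> \<aa> (Dom C f) (Dom C g) (Dom C h \<otimes>\<^sub>o Dom C k)"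
    using assms by (simp add: ich lswap_nat)
  also have "\<dots> = ((f \<otimes>\<^sub>a h) \<otimes>\<^sub>a (g \<otimes>\<^sub>a k)) \<cdot> \<mm> (Dom C f) (Dom C g) (Dom C h) (Dom C k)"
    using assms assc_inv_nat[of f h "g \<otimes>\<^sub>a k" a c "b \<otimes>\<^sub>o d"] by (simp add: mswap_def flip: assoc)
  finally show ?thesis .
qed

lemma pentagon_comp:
  assumes "a \<in> Obj C" "b \<in> Obj C" "c \<in> Obj C" "d \<in> Obj C" "h \<in> Arr C" "Cod C h = ((a \<otimes>\<^sub>o b) \<otimes>\<^sub>o c) \<otimes>\<^sub>o d"
  shows "(\<ii> a \<otimes>\<^sub>a \<aa> b c d) \<cdot> \<aa> a (b \<otimes>\<^sub>o c) d \<cdot> (\<aa> a b c \<otimes>\<^sub>a \<ii> d) \<cdot> h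
    = \<aa> a b (c \<otimes>\<^sub>o d) \<cdot> \<aa> (a \<otimes>\<^sub>o b) c d \<cdot> h"
  using pentagon[of a b c d] assms by (simp flip: assoc)

lemma pentagon_inv:
  assumes [simp]: "a \<in> Obj C" "b \<in> Obj C" "c \<in> Obj C" "d \<in> Obj C"
  shows "\<aa> (a \<otimes>\<^sub>o b) c d \<cdot> (\<aa>\<aa> a b c \<otimes>\<^sub>a \<ii> d) = \<aa>\<aa> a b (c \<otimes>\<^sub>o d) \<cdot> (\<ii> a \<otimes>\<^sub>a \<aa> b c d) \<cdot> \<aa> a (b \<otimes>\<^sub>o c) d"
proof -
  have "\<aa> a b (c \<otimes>\<^sub>o d) \<cdot> \<aa> (a \<otimes>\<^sub>o b) c d \<cdot> (\<aa>\<aa> a b c \<otimes>\<^sub>a \<ii> d) = (\<ii> a \<otimes>\<^sub>a \<aa> b c d) \<cdot> \<aa> a (b \<otimes>\<^sub>o c) d"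
    by (simp add: pentagon_comp[symmetric] ich)
  then have "\<aa>\<aa> a b (c \<otimes>\<^sub>o d) \<cdot> \<aa> a b (c \<otimes>\<^sub>o d) \<cdot> \<aa> (a \<otimes>\<^sub>o b) c d \<cdot> (\<aa>\<aa> a b c \<otimes>\<^sub>a \<ii> d)
     = \<aa>\<aa> a b (c \<otimes>\<^sub>o d) \<cdot> (\<ii> a \<otimes>\<^sub>a \<aa> b c d) \<cdot> \<aa> a (b \<otimes>\<^sub>o c) d"
    by (simp only:)
  then show ?thesis by simp
qed

lemma lswap_whisker:
  assumes [simp]: "y \<in> Obj C" "z \<in> Obj C" "w \<in> Obj C" "t \<in> Obj C"
  shows "(\<ii> z \<otimes>\<^sub>a \<aa> y w t) \<cdot> \<aa> z (y \<otimes>\<^sub>o w) t \<cdot> (\<cc> y z w \<otimes>\<^sub>a \<ii> t)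
    = \<cc> y z (w \<otimes>\<^sub>o t) \<cdot> (\<ii> y \<otimes>\<^sub>a \<aa> z w t) \<cdot> \<aa> y (z \<otimes>\<^sub>o w) t"
proof -
  have "(\<ii> z \<otimes>\<^sub>a \<aa> y w t) \<cdot> \<aa> z (y \<otimes>\<^sub>o w) t \<cdot> (\<cc> y z w \<otimes>\<^sub>a \<ii> t)
      = (\<ii> z \<otimes>\<^sub>a \<aa> y w t) \<cdot> \<aa> z (y \<otimes>\<^sub>o w) t \<cdot> (\<aa> z y w \<otimes>\<^sub>a \<ii> t) \<cdot> ((\<ss> y z \<otimes>\<^sub>a \<ii> w) \<otimes>\<^sub>a \<ii> t) \<cdot> (\<aa>\<aa> y z w \<otimes>\<^sub>a \<ii> t)"
    by (simp add: lswap_def ich)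
  also have "\<dots> = \<aa> z y (w \<otimes>\<^sub>o t) \<cdot> \<aa> (z \<otimes>\<^sub>o y) w t \<cdot> ((\<ss> y z \<otimes>\<^sub>a \<ii> w) \<otimes>\<^sub>a \<ii> t) \<cdot> (\<aa>\<aa> y z w \<otimes>\<^sub>a \<ii> t)"
    by (subst pentagon_comp) simp_all
  also have "\<dots> = \<aa> z y (w \<otimes>\<^sub>o t) \<cdot> (\<ss> y z \<otimes>\<^sub>a (\<ii> w \<otimes>\<^sub>a \<ii> t)) \<cdot> \<aa> (y \<otimes>\<^sub>o z) w t \<cdot> (\<aa>\<aa> y z w \<otimes>\<^sub>a \<ii> t)"
    using assc_nat[of "\<ss> y z" "\<ii> w" "\<ii> t" "z \<otimes>\<^sub>o y" w t] by (simp del: tensor_ide flip: assoc)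
  also have "\<dots> = \<cc> y z (w \<otimes>\<^sub>o t) \<cdot> (\<ii> y \<otimes>\<^sub>a \<aa> z w t) \<cdot> \<aa> y (z \<otimes>\<^sub>o w) t"
    by (simp add: pentagon_inv lswap_def assoc)
  finally show ?thesis .
qed

text \<open>The hexagon for right-nested products: carrying \<open>y\<close> past
  \<open>z \<otimes> u\<close> is carrying it past \<open>z\<close> and then past
  \<open>u\<close>.\<close>

lemma lswap_tensor_right:
  assumes [simp]: "y \<in> Obj C" "z \<in> Obj C" "u \<in> Obj C" "v \<in> Obj C"
  shows "\<aa> z u (y \<otimes>\<^sub>o v) \<cdot> \<cc> y (z \<otimes>\<^sub>o u) v
    = (\<ii> z \<otimes>\<^sub>a \<cc> y u v) \<cdot> \<cc> y z (u \<otimes>\<^sub>o v) \<cdot> (\<ii> y \<otimes>\<^sub>a \<aa> z u v)"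
proof -
  let ?k = "((\<ss> y z \<otimes>\<^sub>a \<ii> u) \<otimes>\<^sub>a \<ii> v) \<cdot> (\<aa>\<aa> y z u \<otimes>\<^sub>a \<ii> v) \<cdot> \<aa>\<aa> y (z \<otimes>\<^sub>o u) v"
  have hex: "\<aa> z u y \<cdot> \<ss> y (z \<otimes>\<^sub>o u) = (\<ii> z \<otimes>\<^sub>a \<ss> y u) \<cdot> \<aa> z y u \<cdot> (\<ss> y z \<otimes>\<^sub>a \<ii> u) \<cdot> \<aa>\<aa> y z u"
    (is "?f = ?g")
  proof (rule iso_epi[of "\<aa> y z u"])
    show "?f \<cdot> \<aa> y z u = ?g \<cdot> \<aa> y z u"
      by (simp add: assoc hexagon)
  qed simp_all
  have "\<aa> z u (y \<otimes>\<^sub>o v) \<cdot> \<cc> y (z \<otimes>\<^sub>o u) v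
      = (\<ii> z \<otimes>\<^sub>a \<aa> u y v) \<cdot> \<aa> z (u \<otimes>\<^sub>o y) v \<cdot> (\<aa> z u y \<otimes>\<^sub>a \<ii> v) \<cdot> (\<ss> y (z \<otimes>\<^sub>o u) \<otimes>\<^sub>a \<ii> v) \<cdot> \<aa>\<aa> y (z \<otimes>\<^sub>o u) v"
    by (subst pentagon_comp) (simp_all add: lswap_def)
  also have "\<dots> = (\<ii> z \<otimes>\<^sub>a \<aa> u y v) \<cdot> \<aa> z (u \<otimes>\<^sub>o y) v \<cdot> ((\<ii> z \<otimes>\<^sub>a \<ss> y u) \<otimes>\<^sub>a \<ii> v) \<cdot> (\<aa> z y u \<otimes>\<^sub>a \<ii> v) \<cdot> ?k"
    by (simp add: ich hex)
  also have "\<dots> = (\<ii> z \<otimes>\<^sub>a \<aa> u y v) \<cdot> (\<ii> z \<otimes>\<^sub>a (\<ss> y u \<otimes>\<^sub>a \<ii> v)) \<cdot> \<aa> z (y \<otimes>\<^sub>o u) v \<cdot> (\<aa> z y u \<otimes>\<^sub>a \<ii> v) \<cdot> ?k"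
    using assc_nat[of "\<ii> z" "\<ss> y u" "\<ii> v" z "u \<otimes>\<^sub>o y" v] by (simp flip: assoc)
  also have "\<dots> = (\<ii> z \<otimes>\<^sub>a \<cc> y u v) \<cdot> (\<ii> z \<otimes>\<^sub>a \<aa> y u v) \<cdot> \<aa> z (y \<otimes>\<^sub>o u) v \<cdot> (\<aa> z y u \<otimes>\<^sub>a \<ii> v) \<cdot> ?k"
    by (simp add: ich lswap_def assoc)
  also have "\<dots> = (\<ii> z \<otimes>\<^sub>a \<cc> y u v) \<cdot> \<aa> z y (u \<otimes>\<^sub>o v) \<cdot> \<aa> (z \<otimes>\<^sub>o y) u v \<cdot> ?k"
    by (subst pentagon_comp) simp_all
  also have "\<dots> = (\<ii> z \<otimes>\<^sub>a \<cc> y u v) \<cdot> \<aa> z y (u \<otimes>\<^sub>o v) \<cdot> (\<ss> y z \<otimes>\<^sub>a (\<ii> u \<otimes>\<^sub>a \<ii> v)) \<cdot> \<aa> (y \<otimes>\<^sub>o z) u v \<cdot> (\<aa>\<aa> y z u \<otimes>\<^sub>a \<ii> v) \<cdot> \<aa>\<aa> y (z \<otimes>\<^sub>o u) v"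
    using assc_nat[of "\<ss> y z" "\<ii> u" "\<ii> v" "z \<otimes>\<^sub>o y" u v] by (simp del: tensor_ide flip: assoc)
  also have "\<dots> = (\<ii> z \<otimes>\<^sub>a \<cc> y u v) \<cdot> \<aa> z y (u \<otimes>\<^sub>o v) \<cdot> (\<ss> y z \<otimes>\<^sub>a \<ii> (u \<otimes>\<^sub>o v)) \<cdot> (\<aa> (y \<otimes>\<^sub>o z) u v \<cdot> (\<aa>\<aa> y z u \<otimes>\<^sub>a \<ii> v)) \<cdot> \<aa>\<aa> y (z \<otimes>\<^sub>o u) v"
    by (simp add: assoc)
  also have "\<dots> = (\<ii> z \<otimes>\<^sub>a \<cc> y u v) \<cdot> \<cc> y z (u \<otimes>\<^sub>o v) \<cdot> (\<ii> y \<otimes>\<^sub>a \<aa> z u v)"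
    by (simp add: pentagon_inv lswap_def assoc)
  finally show ?thesis .
qed

text \<open>Exchanging the first two arguments of \<open>\<cc>\<close> inverts it, so this is
  \<open>lswap_tensor_right\<close> read backwards. It takes the part of a second hexagon.\<close>

lemma lswap_tensor_left:
  assumes [simp]: "y \<in> Obj C" "w \<in> Obj C" "u \<in> Obj C" "v \<in> Obj C"
  shows "(\<ii> u \<otimes>\<^sub>a \<aa> y w v) \<cdot> \<cc> (y \<otimes>\<^sub>o w) u v
    = \<cc> y u (w \<otimes>\<^sub>o v) \<cdot> (\<ii> y \<otimes>\<^sub>a \<cc> w u v) \<cdot> \<aa> y w (u \<otimes>\<^sub>o v)"
proof -
  have "\<cc> y u (w \<otimes>\<^sub>o v) \<cdot> (\<ii> y \<otimes>\<^sub>a \<cc> w u v) \<cdot> \<aa> y w (u \<otimes>\<^sub>o v)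
     = \<cc> y u (w \<otimes>\<^sub>o v) \<cdot> (\<ii> y \<otimes>\<^sub>a \<cc> w u v) \<cdot> (\<aa> y w (u \<otimes>\<^sub>o v) \<cdot> \<cc> u (y \<otimes>\<^sub>o w) v) \<cdot> \<cc> (y \<otimes>\<^sub>o w) u v"
    by (simp add: assoc lswap_inverse)
  also have "\<dots> = \<cc> y u (w \<otimes>\<^sub>o v) \<cdot> (\<ii> y \<otimes>\<^sub>a \<cc> w u v) \<cdot> (\<ii> y \<otimes>\<^sub>a \<cc> u w v) \<cdot> \<cc> u y (w \<otimes>\<^sub>o v) \<cdot> (\<ii> u \<otimes>\<^sub>a \<aa> y w v) \<cdot> \<cc> (y \<otimes>\<^sub>o w) u v"
    by (simp add: lswap_tensor_right assoc)
  also have "\<dots> = (\<cc> y u (w \<otimes>\<^sub>o v) \<cdot> \<cc> u y (w \<otimes>\<^sub>o v)) \<cdot> (\<ii> u \<otimes>\<^sub>a \<aa> y w v) \<cdot> \<cc> (y \<otimes>\<^sub>o w) u v"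
    by (simp add: ich lswap_inverse assoc)
  finally show ?thesis
    by (simp add: lswap_inverse)
qed

lemma mswap_assc:
  assumes "x \<in> Obj C" "y \<in> Obj C" "z \<in> Obj C" "w \<in> Obj C"
  shows "\<aa> x z (y \<otimes>\<^sub>o w) \<cdot> \<mm> x y z w = (\<ii> x \<otimes>\<^sub>a \<cc> y z w) \<cdot> \<aa> x y (z \<otimes>\<^sub>o w)"
  using assms by (simp add: mswap_def)

text \<open>The swap touches only \<open>y\<close> and \<open>z\<close>, so an extra right factor
  \<open>t\<close> can be absorbed into the tail \<open>w\<close> by rebracketing.\<close>

lemma mswap_whisker:
  assumes [simp]: "x \<in> Obj C" "y \<in> Obj C" "z \<in> Obj C" "w \<in> Obj C" "t \<in> Obj C"
  shows "(\<ii> x \<otimes>\<^sub>a (\<ii> z \<otimes>\<^sub>a \<aa> y w t)) \<cdot> \<aa> x z ((y \<otimes>\<^sub>o w) \<otimes>\<^sub>o t) \<cdot> \<aa> (x \<otimes>\<^sub>o z) (y \<otimes>\<^sub>o w) t \<cdot> (\<mm> x y z w \<otimes>\<^sub>a \<ii> t)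
    = (\<ii> x \<otimes>\<^sub>a \<cc> y z (w \<otimes>\<^sub>o t)) \<cdot> (\<ii> x \<otimes>\<^sub>a (\<ii> y \<otimes>\<^sub>a \<aa> z w t)) \<cdot> \<aa> x y ((z \<otimes>\<^sub>o w) \<otimes>\<^sub>o t) \<cdot> \<aa> (x \<otimes>\<^sub>o y) (z \<otimes>\<^sub>o w) t"
    (is "?A \<cdot> _ \<cdot> _ \<cdot> (_ \<otimes>\<^sub>a _) = _")
proof -
  have "\<aa> x z ((y \<otimes>\<^sub>o w) \<otimes>\<^sub>o t) \<cdot> \<aa> (x \<otimes>\<^sub>o z) (y \<otimes>\<^sub>o w) t \<cdot> (\<mm> x y z w \<otimes>\<^sub>a \<ii> t)
      = (\<ii> x \<otimes>\<^sub>a \<aa> z (y \<otimes>\<^sub>o w) t) \<cdot> \<aa> x (z \<otimes>\<^sub>o (y \<otimes>\<^sub>o w)) t \<cdot> (\<aa> x z (y \<otimes>\<^sub>o w) \<otimes>\<^sub>a \<ii> t) \<cdot> (\<mm> x y z w \<otimes>\<^sub>a \<ii> t)"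
    by (subst pentagon_comp) simp_all
  also have "\<dots> = (\<ii> x \<otimes>\<^sub>a \<aa> z (y \<otimes>\<^sub>o w) t) \<cdot> \<aa> x (z \<otimes>\<^sub>o (y \<otimes>\<^sub>o w)) t \<cdot> ((\<ii> x \<otimes>\<^sub>a \<cc> y z w) \<otimes>\<^sub>a \<ii> t) \<cdot> (\<aa> x y (z \<otimes>\<^sub>o w) \<otimes>\<^sub>a \<ii> t)"
    by (simp add: ich mswap_assc)
  also have "\<dots> = (\<ii> x \<otimes>\<^sub>a \<aa> z (y \<otimes>\<^sub>o w) t) \<cdot> (\<ii> x \<otimes>\<^sub>a (\<cc> y z w \<otimes>\<^sub>a \<ii> t)) \<cdot> \<aa> x (y \<otimes>\<^sub>o (z \<otimes>\<^sub>o w)) t \<cdot> (\<aa> x y (z \<otimes>\<^sub>o w) \<otimes>\<^sub>a \<ii> t)"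
    using assc_nat[of "\<ii> x" "\<cc> y z w" "\<ii> t"] by (simp flip: assoc)
  finally have "?A \<cdot> \<aa> x z ((y \<otimes>\<^sub>o w) \<otimes>\<^sub>o t) \<cdot> \<aa> (x \<otimes>\<^sub>o z) (y \<otimes>\<^sub>o w) t \<cdot> (\<mm> x y z w \<otimes>\<^sub>a \<ii> t)
     = (\<ii> x \<otimes>\<^sub>a ((\<ii> z \<otimes>\<^sub>a \<aa> y w t) \<cdot> \<aa> z (y \<otimes>\<^sub>o w) t \<cdot> (\<cc> y z w \<otimes>\<^sub>a \<ii> t))) \<cdot> \<aa> x (y \<otimes>\<^sub>o (z \<otimes>\<^sub>o w)) t \<cdot> (\<aa> x y (z \<otimes>\<^sub>o w) \<otimes>\<^sub>a \<ii> t)"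
    by (simp add: ich)
  also have "\<dots> = (\<ii> x \<otimes>\<^sub>a \<cc> y z (w \<otimes>\<^sub>o t)) \<cdot> (\<ii> x \<otimes>\<^sub>a (\<ii> y \<otimes>\<^sub>a \<aa> z w t)) \<cdot> (\<ii> x \<otimes>\<^sub>a \<aa> y (z \<otimes>\<^sub>o w) t) \<cdot> \<aa> x (y \<otimes>\<^sub>o (z \<otimes>\<^sub>o w)) t \<cdot> (\<aa> x y (z \<otimes>\<^sub>o w) \<otimes>\<^sub>a \<ii> t)"
    by (simp add: lswap_whisker ich)
  finally show ?thesis
    by (simp add: pentagon)
qed

text \<open>The associativity axiom of the monoidal functor
  \<open>(x, y) \<mapsto> x \<otimes> y\<close> with structure map \<open>\<mm>\<close>.
  Coassociativity of a tensor product of comonoids rests on it.\<close>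

lemma mswap_coassoc:
  assumes [simp]: "x \<in> Obj C" "y \<in> Obj C" "z \<in> Obj C" "w \<in> Obj C" "u \<in> Obj C" "v \<in> Obj C"
  shows "(\<aa> x z u \<otimes>\<^sub>a \<aa> y w v) \<cdot> \<mm> (x \<otimes>\<^sub>o z) (y \<otimes>\<^sub>o w) u v \<cdot> (\<mm> x y z w \<otimes>\<^sub>a \<ii> (u \<otimes>\<^sub>o v))
    = \<mm> x y (z \<otimes>\<^sub>o u) (w \<otimes>\<^sub>o v) \<cdot> (\<ii> (x \<otimes>\<^sub>o y) \<otimes>\<^sub>a \<mm> z w u v) \<cdot> \<aa> (x \<otimes>\<^sub>o y) (z \<otimes>\<^sub>o w) (u \<otimes>\<^sub>o v)"
    (is "?L = ?R")
proof (rule iso_mono)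
  \<comment> \<open>\<open>?h\<close> nests the common target fully to the right and
    \<open>?Q\<close> does the same to the source. In between, both sides consist of instances of
    \<open>\<cc>\<close> that differ only in the order of the independent exchanges of
    \<open>y\<close> with \<open>z\<close> and of \<open>w\<close> with \<open>u\<close>; naturality
    of \<open>\<cc>\<close> interchanges these.\<close>
  let ?h = "(\<ii> x \<otimes>\<^sub>a \<aa> z u (y \<otimes>\<^sub>o (w \<otimes>\<^sub>o v))) \<cdot> \<aa> x (z \<otimes>\<^sub>o u) (y \<otimes>\<^sub>o (w \<otimes>\<^sub>o v))"
  let ?Q = "(\<ii> x \<otimes>\<^sub>a (\<ii> y \<otimes>\<^sub>a \<aa> z w (u \<otimes>\<^sub>o v))) \<cdot> \<aa> x y ((z \<otimes>\<^sub>o w) \<otimes>\<^sub>o (u \<otimes>\<^sub>o v)) \<cdot> \<aa> (x \<otimes>\<^sub>o y) (z \<otimes>\<^sub>o w) (u \<otimes>\<^sub>o v)"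
  have "?h \<cdot> ?L = ((\<ii> x \<otimes>\<^sub>a \<aa> z u (y \<otimes>\<^sub>o (w \<otimes>\<^sub>o v))) \<cdot> \<aa> x (z \<otimes>\<^sub>o u) (y \<otimes>\<^sub>o (w \<otimes>\<^sub>o v)) \<cdot> (\<aa> x z u \<otimes>\<^sub>a \<ii> (y \<otimes>\<^sub>o (w \<otimes>\<^sub>o v)))) \<cdot> (\<ii> ((x \<otimes>\<^sub>o z) \<otimes>\<^sub>o u) \<otimes>\<^sub>a \<aa> y w v) \<cdot> \<mm> (x \<otimes>\<^sub>o z) (y \<otimes>\<^sub>o w) u v \<cdot> (\<mm> x y z w \<otimes>\<^sub>a \<ii> (u \<otimes>\<^sub>o v))"
    by (simp add: ich assoc)
  also have "\<dots> = \<aa> x z (u \<otimes>\<^sub>o (y \<otimes>\<^sub>o (w \<otimes>\<^sub>o v))) \<cdot> (\<aa> (x \<otimes>\<^sub>o z) u (y \<otimes>\<^sub>o (w \<otimes>\<^sub>o v)) \<cdot> ((\<ii> (x \<otimes>\<^sub>o z) \<otimes>\<^sub>a \<ii> u) \<otimes>\<^sub>a \<aa> y w v)) \<cdot> \<mm> (x \<otimes>\<^sub>o z) (y \<otimes>\<^sub>o w) u v \<cdot> (\<mm> x y z w \<otimes>\<^sub>a \<ii> (u \<otimes>\<^sub>o v))"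
    by (simp add: pentagon[symmetric] assoc)
  also have "\<dots> = \<aa> x z (u \<otimes>\<^sub>o (y \<otimes>\<^sub>o (w \<otimes>\<^sub>o v))) \<cdot> (\<ii> (x \<otimes>\<^sub>o z) \<otimes>\<^sub>a (\<ii> u \<otimes>\<^sub>a \<aa> y w v)) \<cdot> (\<aa> (x \<otimes>\<^sub>o z) u ((y \<otimes>\<^sub>o w) \<otimes>\<^sub>o v) \<cdot> \<mm> (x \<otimes>\<^sub>o z) (y \<otimes>\<^sub>o w) u v) \<cdot> (\<mm> x y z w \<otimes>\<^sub>a \<ii> (u \<otimes>\<^sub>o v))"
    by (subst assc_nat) (simp_all add: assoc)
  also have "\<dots> = \<aa> x z (u \<otimes>\<^sub>o (y \<otimes>\<^sub>o (w \<otimes>\<^sub>o v))) \<cdot> (\<ii> (x \<otimes>\<^sub>o z) \<otimes>\<^sub>a ((\<ii> u \<otimes>\<^sub>a \<aa> y w v) \<cdot> \<cc> (y \<otimes>\<^sub>o w) u v)) \<cdot> \<aa> (x \<otimes>\<^sub>o z) (y \<otimes>\<^sub>o w) (u \<otimes>\<^sub>o v) \<cdot> (\<mm> x y z w \<otimes>\<^sub>a \<ii> (u \<otimes>\<^sub>o v))"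
    by (simp add: mswap_assc ich assoc)
  also have "\<dots> = (\<aa> x z (u \<otimes>\<^sub>o (y \<otimes>\<^sub>o (w \<otimes>\<^sub>o v))) \<cdot> ((\<ii> x \<otimes>\<^sub>a \<ii> z) \<otimes>\<^sub>a (\<cc> y u (w \<otimes>\<^sub>o v) \<cdot> (\<ii> y \<otimes>\<^sub>a \<cc> w u v) \<cdot> \<aa> y w (u \<otimes>\<^sub>o v)))) \<cdot> \<aa> (x \<otimes>\<^sub>o z) (y \<otimes>\<^sub>o w) (u \<otimes>\<^sub>o v) \<cdot> (\<mm> x y z w \<otimes>\<^sub>a \<ii> (u \<otimes>\<^sub>o v))"
    by (simp add: lswap_tensor_left assoc)
  also have "\<dots> = (\<ii> x \<otimes>\<^sub>a (\<ii> z \<otimes>\<^sub>a (\<cc> y u (w \<otimes>\<^sub>o v) \<cdot> (\<ii> y \<otimes>\<^sub>a \<cc> w u v)))) \<cdot> (\<ii> x \<otimes>\<^sub>a (\<ii> z \<otimes>\<^sub>a \<aa> y w (u \<otimes>\<^sub>o v))) \<cdot> \<aa> x z ((y \<otimes>\<^sub>o w) \<otimes>\<^sub>o (u \<otimes>\<^sub>o v)) \<cdot> \<aa> (x \<otimes>\<^sub>o z) (y \<otimes>\<^sub>o w) (u \<otimes>\<^sub>o v) \<cdot> (\<mm> x y z w \<otimes>\<^sub>a \<ii> (u \<otimes>\<^sub>o v))"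
    by (subst assc_nat) (simp_all add: ich assoc)
  also have "\<dots> = (\<ii> x \<otimes>\<^sub>a (\<ii> z \<otimes>\<^sub>a (\<cc> y u (w \<otimes>\<^sub>o v) \<cdot> (\<ii> y \<otimes>\<^sub>a \<cc> w u v)))) \<cdot> (\<ii> x \<otimes>\<^sub>a \<cc> y z (w \<otimes>\<^sub>o (u \<otimes>\<^sub>o v))) \<cdot> ?Q"
    by (subst mswap_whisker) simp_all
  finally have L: "?h \<cdot> ?L = \<dots>" .
  have "?h \<cdot> ?R = (\<ii> x \<otimes>\<^sub>a \<aa> z u (y \<otimes>\<^sub>o (w \<otimes>\<^sub>o v))) \<cdot> (\<ii> x \<otimes>\<^sub>a \<cc> y (z \<otimes>\<^sub>o u) (w \<otimes>\<^sub>o v)) \<cdot> \<aa> x y ((z \<otimes>\<^sub>o u) \<otimes>\<^sub>o (w \<otimes>\<^sub>o v)) \<cdot> ((\<ii> x \<otimes>\<^sub>a \<ii> y) \<otimes>\<^sub>a \<mm> z w u v) \<cdot> \<aa> (x \<otimes>\<^sub>o y) (z \<otimes>\<^sub>o w) (u \<otimes>\<^sub>o v)"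
    by (simp add: comp_cong2[OF mswap_assc] assoc)
  also have "\<dots> = (\<ii> x \<otimes>\<^sub>a (\<aa> z u (y \<otimes>\<^sub>o (w \<otimes>\<^sub>o v)) \<cdot> \<cc> y (z \<otimes>\<^sub>o u) (w \<otimes>\<^sub>o v))) \<cdot> (\<ii> x \<otimes>\<^sub>a (\<ii> y \<otimes>\<^sub>a \<mm> z w u v)) \<cdot> \<aa> x y ((z \<otimes>\<^sub>o w) \<otimes>\<^sub>o (u \<otimes>\<^sub>o v)) \<cdot> \<aa> (x \<otimes>\<^sub>o y) (z \<otimes>\<^sub>o w) (u \<otimes>\<^sub>o v)"
    using assc_nat[of "\<ii> x" "\<ii> y" "\<mm> z w u v"] by (simp add: ich del: tensor_ide flip: assoc)
  also have "\<dots> = (\<ii> x \<otimes>\<^sub>a (\<ii> z \<otimes>\<^sub>a \<cc> y u (w \<otimes>\<^sub>o v))) \<cdot> (\<ii> x \<otimes>\<^sub>a \<cc> y z (u \<otimes>\<^sub>o (w \<otimes>\<^sub>o v))) \<cdot> (\<ii> x \<otimes>\<^sub>a (\<ii> y \<otimes>\<^sub>a (\<aa> z u (w \<otimes>\<^sub>o v) \<cdot> \<mm> z w u v))) \<cdot> \<aa> x y ((z \<otimes>\<^sub>o w) \<otimes>\<^sub>o (u \<otimes>\<^sub>o v)) \<cdot> \<aa> (x \<otimes>\<^sub>o y) (z \<otimes>\<^sub>o w) (u \<otimes>\<^sub>o v)"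
    by (simp add: lswap_tensor_right ich assoc)
  also have "\<dots> = (\<ii> x \<otimes>\<^sub>a (\<ii> z \<otimes>\<^sub>a \<cc> y u (w \<otimes>\<^sub>o v))) \<cdot> (\<ii> x \<otimes>\<^sub>a (\<cc> y z (u \<otimes>\<^sub>o (w \<otimes>\<^sub>o v)) \<cdot> (\<ii> y \<otimes>\<^sub>a (\<ii> z \<otimes>\<^sub>a \<cc> w u v)))) \<cdot> ?Q"
    by (simp add: mswap_assc ich assoc)
  also have "\<dots> = ?h \<cdot> ?L"
    unfolding L by (simp add: lswap_nat ich assoc)
  finally show "?h \<cdot> ?L = ?h \<cdot> ?R" ..
qed (simp_all add: iso_comp iso_ide)

text \<open>The axiom that makes the same functor symmetric, written with \<open>\<mm>\<close> in
  the inverse direction. It yields cocommutativity of tensor products and lets the symmetry be a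
  comonoid homomorphism.\<close>

lemma mswap_symm:
  assumes [simp]: "x \<in> Obj C" "y \<in> Obj C" "z \<in> Obj C" "w \<in> Obj C"
  shows "\<ss> (x \<otimes>\<^sub>o y) (z \<otimes>\<^sub>o w) \<cdot> \<mm> x z y w = \<mm> z x w y \<cdot> (\<ss> x z \<otimes>\<^sub>a \<ss> y w)"
  (is "?L = ?R")
proof (rule iso_mono[of "\<aa> z w (x \<otimes>\<^sub>o y)"])
  have hex: "\<aa> z w (x \<otimes>\<^sub>o y) \<cdot> \<ss> (x \<otimes>\<^sub>o y) (z \<otimes>\<^sub>o w) = (\<ii> z \<otimes>\<^sub>a \<ss> (x \<otimes>\<^sub>o y) w) \<cdot> \<cc> (x \<otimes>\<^sub>o y) z w"
    (is "?f = ?g")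
  proof (rule iso_epi[of "\<aa> (x \<otimes>\<^sub>o y) z w"])
    show "?f \<cdot> \<aa> (x \<otimes>\<^sub>o y) z w = ?g \<cdot> \<aa> (x \<otimes>\<^sub>o y) z w"
      by (simp add: assoc hexagon lswap_def)
  qed simp_all
  \<comment> \<open>The other hexagon, obtained from the given one at \<open>w, x, y\<close> because
    the symmetry is an involution: \<open>?h\<close> is chosen so that the right-hand side cancels
    down to an associator.\<close>
  have hex': "\<cc> x w y \<cdot> (\<ii> x \<otimes>\<^sub>a \<ss> y w) = \<ss> (x \<otimes>\<^sub>o y) w \<cdot> \<aa>\<aa> x y w" (is "?f = ?g")
  proof (rule iso_epi[of "\<aa> x y w \<cdot> \<ss> w (x \<otimes>\<^sub>o y) \<cdot> \<aa> w x y"])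
    let ?h = "\<aa> x y w \<cdot> \<ss> w (x \<otimes>\<^sub>o y) \<cdot> \<aa> w x y"
    have "?f \<cdot> ?h = \<aa> w x y"
      by (simp add: assoc ich lswap_def hexagon)
    also have "\<dots> = ?g \<cdot> ?h"
      by (simp add: assoc)
    finally show "?f \<cdot> ?h = ?g \<cdot> ?h" .
  qed (simp_all add: iso_comp)
  have "\<aa> z w (x \<otimes>\<^sub>o y) \<cdot> ?L
     = (\<ii> z \<otimes>\<^sub>a (\<ss> (x \<otimes>\<^sub>o y) w \<cdot> \<aa>\<aa> x y w)) \<cdot> ((\<ii> z \<otimes>\<^sub>a \<aa> x y w) \<cdot> \<cc> (x \<otimes>\<^sub>o y) z w) \<cdot> \<mm> x z y w"
    by (simp add: ich assoc comp_cong2[OF hex])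
  also have "\<dots> = (\<ii> z \<otimes>\<^sub>a (\<cc> x w y \<cdot> (\<ii> x \<otimes>\<^sub>a \<ss> y w))) \<cdot> \<cc> x z (y \<otimes>\<^sub>o w) \<cdot> (\<ii> x \<otimes>\<^sub>a \<cc> y z w) \<cdot> \<aa> x y (z \<otimes>\<^sub>o w) \<cdot> \<mm> x z y w"
    by (simp add: hex' lswap_tensor_left assoc)
  also have "\<dots> = (\<ii> z \<otimes>\<^sub>a (\<cc> x w y \<cdot> (\<ii> x \<otimes>\<^sub>a \<ss> y w))) \<cdot> \<cc> x z (y \<otimes>\<^sub>o w) \<cdot> \<aa> x z (y \<otimes>\<^sub>o w)"
    by (simp add: mswap_assc ich lswap_inverse)
  also have "\<dots> = (\<ii> z \<otimes>\<^sub>a \<cc> x w y) \<cdot> ((\<ii> z \<otimes>\<^sub>a (\<ii> x \<otimes>\<^sub>a \<ss> y w)) \<cdot> \<aa> z x (y \<otimes>\<^sub>o w)) \<cdot> (\<ss> x z \<otimes>\<^sub>a \<ii> (y \<otimes>\<^sub>o w))"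
    by (simp add: lswap_def ich assoc)
  also have "\<dots> = (\<ii> z \<otimes>\<^sub>a \<cc> x w y) \<cdot> \<aa> z x (w \<otimes>\<^sub>o y) \<cdot> (\<ss> x z \<otimes>\<^sub>a \<ss> y w)"
    using assc_nat[of "\<ii> z" "\<ii> x" "\<ss> y w" z x "w \<otimes>\<^sub>o y", symmetric] by (simp add: ich assoc)
  also have "\<dots> = \<aa> z w (x \<otimes>\<^sub>o y) \<cdot> \<mm> z x w y \<cdot> (\<ss> x z \<otimes>\<^sub>a \<ss> y w)"
    by (simp add: comp_cong2[OF mswap_assc])
  finally show "\<aa> z w (x \<otimes>\<^sub>o y) \<cdot> ?L = \<aa> z w (x \<otimes>\<^sub>o y) \<cdot> ?R" .
qed simp_all

lemma lswap_unit:
  assumes [simp]: "x \<in> Obj C" "y \<in> Obj C"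
  shows "\<ll> (x \<otimes>\<^sub>o y) \<cdot> \<cc> x \<I> y = \<ii> x \<otimes>\<^sub>a \<ll> y"
proof -
  have "\<ll> (x \<otimes>\<^sub>o y) \<cdot> \<cc> x \<I> y = (\<ll> (x \<otimes>\<^sub>o y) \<cdot> \<aa> \<I> x y) \<cdot> (\<ss> x \<I> \<otimes>\<^sub>a \<ii> y) \<cdot> \<aa>\<aa> x \<I> y"
    by (simp add: lswap_def assoc)
  also have "\<dots> = ((\<ii> x \<otimes>\<^sub>a \<ll> y) \<cdot> \<aa> x \<I> y) \<cdot> \<aa>\<aa> x \<I> y"
    by (simp only: lunit_assc triangle assms) (simp add: ich lunit_symm)
  finally show ?thesis
    by (simp add: assoc)
qed

text \<open>The left unit axiom of the monoidal functor
  \<open>(x, y) \<mapsto> x \<otimes> y\<close>; it gives the counit law of a tensor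
  product.\<close>

lemma mswap_lunit:
  assumes [simp]: "x \<in> Obj C" "y \<in> Obj C"
  shows "\<ll> (x \<otimes>\<^sub>o y) \<cdot> (\<ll> \<I> \<otimes>\<^sub>a \<ii> (x \<otimes>\<^sub>o y)) \<cdot> \<mm> \<I> x \<I> y = \<ll> x \<otimes>\<^sub>a \<ll> y"
proof -
  have "\<ll> (x \<otimes>\<^sub>o y) \<cdot> (\<ll> \<I> \<otimes>\<^sub>a \<ii> (x \<otimes>\<^sub>o y)) \<cdot> \<mm> \<I> x \<I> y
      = \<ll> (x \<otimes>\<^sub>o y) \<cdot> \<ll> (\<I> \<otimes>\<^sub>o (x \<otimes>\<^sub>o y)) \<cdot> \<aa> \<I> \<I> (x \<otimes>\<^sub>o y) \<cdot> \<mm> \<I> x \<I> y"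
    by (simp add: lunit_assc[symmetric] assoc)
  also have "\<dots> = (\<ll> (x \<otimes>\<^sub>o y) \<cdot> \<ll> (\<I> \<otimes>\<^sub>o (x \<otimes>\<^sub>o y))) \<cdot> (\<ii> \<I> \<otimes>\<^sub>a \<cc> x \<I> y) \<cdot> \<aa> \<I> x (\<I> \<otimes>\<^sub>o y)"
    by (simp add: mswap_assc assoc)
  also have "\<dots> = \<ll> (x \<otimes>\<^sub>o y) \<cdot> (\<ii> \<I> \<otimes>\<^sub>a (\<ll> (x \<otimes>\<^sub>o y) \<cdot> \<cc> x \<I> y)) \<cdot> \<aa> \<I> x (\<I> \<otimes>\<^sub>o y)"
    by (simp add: lunit_nat comp_cong2[OF lunit_nat] assoc)
  also have "\<dots> = (\<ll> (x \<otimes>\<^sub>o y) \<cdot> (\<ii> \<I> \<otimes>\<^sub>a (\<ii> x \<otimes>\<^sub>a \<ll> y))) \<cdot> \<aa> \<I> x (\<I> \<otimes>\<^sub>o y)"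
    by (simp add: lswap_unit assoc)
  also have "\<dots> = (\<ii> x \<otimes>\<^sub>a \<ll> y) \<cdot> (\<ll> (x \<otimes>\<^sub>o (\<I> \<otimes>\<^sub>o y)) \<cdot> \<aa> \<I> x (\<I> \<otimes>\<^sub>o y))"
    by (simp add: lunit_nat assoc)
  also have "\<dots> = \<ll> x \<otimes>\<^sub>a \<ll> y"
    by (simp add: lunit_assc ich)
  finally show ?thesis .
qed

text \<open>The two exchanged factors are both the unit, whose self-symmetry is the
  identity.\<close>

lemma mswap_unit:
  assumes [simp]: "x \<in> Obj C" "y \<in> Obj C"
  shows "\<mm> x \<I> \<I> y = \<ii> ((x \<otimes>\<^sub>o \<I>) \<otimes>\<^sub>o (\<I> \<otimes>\<^sub>o y))"
  by (simp add: mswap_def lswap_def symm_unit)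

end

section \<open>Cocommutative comonoids\<close>

record ('o, 'a) comonoid =
  cobj :: 'o
  comul :: 'a
  coun :: 'a

context symmetric_monoidal_category
begin

lemma mswap_inverse:
  assumes [simp]: "x \<in> Obj C" "y \<in> Obj C" "z \<in> Obj C" "w \<in> Obj C"
  shows "\<mm> x z y w \<cdot> \<mm> x y z w = \<ii> ((x \<otimes>\<^sub>o y) \<otimes>\<^sub>o z \<otimes>\<^sub>o w)"
  by (simp add: mswap_def assoc ich lswap_inverse)

lemma mswap_cancel [simp]:
  assumes "x \<in> Obj C" "y \<in> Obj C" "z \<in> Obj C" "w \<in> Obj C" "f \<in> Arr C" "Cod C f = (x \<otimes>\<^sub>o y) \<otimes>\<^sub>o z \<otimes>\<^sub>o w"
  shows "\<mm> x z y w \<cdot> \<mm> x y z w \<cdot> f = f"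
  using assms by (simp add: comp_cong[OF mswap_inverse])

text \<open>The form of \<open>mswap_coassoc\<close> that comultiplications need: the equation is
  composed on both sides with middle swaps, which cancel in inverse pairs.\<close>

lemma mswap_assoc:
  assumes [simp]: "x \<in> Obj C" "y \<in> Obj C" "z \<in> Obj C" "w \<in> Obj C" "u \<in> Obj C" "v \<in> Obj C"
  shows "\<aa> (x \<otimes>\<^sub>o y) (z \<otimes>\<^sub>o w) (u \<otimes>\<^sub>o v) \<cdot> (\<mm> x z y w \<otimes>\<^sub>a \<ii> (u \<otimes>\<^sub>o v)) \<cdot> \<mm> (x \<otimes>\<^sub>o z) u (y \<otimes>\<^sub>o w) v
    = (\<ii> (x \<otimes>\<^sub>o y) \<otimes>\<^sub>a \<mm> z u w v) \<cdot> \<mm> x (z \<otimes>\<^sub>o u) y (w \<otimes>\<^sub>o v) \<cdot> (\<aa> x z u \<otimes>\<^sub>a \<aa> y w v)"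
proof -
  let ?k = "(\<ii> (x \<otimes>\<^sub>o y) \<otimes>\<^sub>a \<mm> z u w v) \<cdot> \<mm> x (z \<otimes>\<^sub>o u) y (w \<otimes>\<^sub>o v)"
  let ?l = "(\<mm> x z y w \<otimes>\<^sub>a \<ii> (u \<otimes>\<^sub>o v)) \<cdot> \<mm> (x \<otimes>\<^sub>o z) u (y \<otimes>\<^sub>o w) v"
  have "?k \<cdot> ((\<aa> x z u \<otimes>\<^sub>a \<aa> y w v) \<cdot> \<mm> (x \<otimes>\<^sub>o z) (y \<otimes>\<^sub>o w) u v \<cdot> (\<mm> x y z w \<otimes>\<^sub>a \<ii> (u \<otimes>\<^sub>o v))) \<cdot> ?l
    = ?k \<cdot> (\<mm> x y (z \<otimes>\<^sub>o u) (w \<otimes>\<^sub>o v) \<cdot> (\<ii> (x \<otimes>\<^sub>o y) \<otimes>\<^sub>a \<mm> z w u v) \<cdot> \<aa> (x \<otimes>\<^sub>o y) (z \<otimes>\<^sub>o w) (u \<otimes>\<^sub>o v)) \<cdot> ?l"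
    by (simp only: mswap_coassoc assms)
  then show ?thesis
    by (simp add: assoc ich mswap_inverse)
qed

section \<open>Comonoids, their homomorphisms and their tensor products\<close>

definition comon where
  "comon X \<longleftrightarrow> cocommutative_comonoid C (cobj X) (comul X) (coun X)"

definition chom where
  "chom X Y f \<longleftrightarrow> comon X \<and> comon Y \<and> f \<in> homset C (cobj X) (cobj Y) \<and>
     comul Y \<cdot> f = (f \<otimes>\<^sub>a f) \<cdot> comul X \<and> coun Y \<cdot> f = coun X"

definition ctens where
  "ctens X Y = \<lparr>cobj = cobj X \<otimes>\<^sub>o cobj Y,
     comul = \<mm> (cobj X) (cobj X) (cobj Y) (cobj Y) \<cdot> (comul X \<otimes>\<^sub>a comul Y),
     coun = \<ll> \<I> \<cdot> (coun X \<otimes>\<^sub>a coun Y)\<rparr>"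

definition cunit where
  "cunit = \<lparr>cobj = \<I>, comul = inv_arr C (\<ll> \<I>), coun = \<ii> \<I>\<rparr>"

text \<open>The pairing of the categorical product that \<open>ctens\<close> will turn out to be.
  Its projections \<open>cfst\<close> and \<open>csnd\<close> discard a factor by applying the
  counit.\<close>

definition cpair where
  "cpair X f g = (f \<otimes>\<^sub>a g) \<cdot> comul X"

definition cfst where
  "cfst X Y = \<rr> (cobj X) \<cdot> (\<ii> (cobj X) \<otimes>\<^sub>a coun Y)"

definition csnd where
  "csnd X Y = \<ll> (cobj Y) \<cdot> (coun X \<otimes>\<^sub>a \<ii> (cobj Y))"

text \<open>Cocommutativity and \<open>lunit_symm\<close> turn the left counit law into the right
  one.\<close>

lemma comonI:
  assumes "x \<in> Obj C" "d \<in> homset C x (x \<otimes>\<^sub>o x)" "e \<in> homset C x \<I>"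
    "\<aa> x x x \<cdot> (d \<otimes>\<^sub>a \<ii> x) \<cdot> d = (\<ii> x \<otimes>\<^sub>a d) \<cdot> d"
    "\<ll> x \<cdot> (e \<otimes>\<^sub>a \<ii> x) \<cdot> d = \<ii> x" "\<ss> x x \<cdot> d = d"
  shows "cocommutative_comonoid C x d e"
proof -
  have "\<rr> x \<cdot> (\<ii> x \<otimes>\<^sub>a e) \<cdot> d = \<ll> x \<cdot> \<ss> x \<I> \<cdot> (\<ii> x \<otimes>\<^sub>a e) \<cdot> d"
    using assms(1-3) by (simp add: lunit_symm[symmetric] assoc)
  also have "\<dots> = \<ll> x \<cdot> (e \<otimes>\<^sub>a \<ii> x) \<cdot> \<ss> x x \<cdot> d"
    using assms(1-3) by (simp add: symm_nat comp_cong2[OF symm_nat])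
  finally show ?thesis
    using assms by unfold_locales simp_all
qed

lemma comon_simps [simp]:
  assumes "comon X"
  shows "cobj X \<in> Obj C" "comul X \<in> Arr C" "Dom C (comul X) = cobj X" "Cod C (comul X) = cobj X \<otimes>\<^sub>o cobj X"
    "coun X \<in> Arr C" "Dom C (coun X) = cobj X" "Cod C (coun X) = \<I>"
    "\<aa> (cobj X) (cobj X) (cobj X) \<cdot> (comul X \<otimes>\<^sub>a \<ii> (cobj X)) \<cdot> comul X = (\<ii> (cobj X) \<otimes>\<^sub>a comul X) \<cdot> comul X"
    "\<ll> (cobj X) \<cdot> (coun X \<otimes>\<^sub>a \<ii> (cobj X)) \<cdot> comul X = \<ii> (cobj X)"
    "\<rr> (cobj X) \<cdot> (\<ii> (cobj X) \<otimes>\<^sub>a coun X) \<cdot> comul X = \<ii> (cobj X)"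
    "\<ss> (cobj X) (cobj X) \<cdot> comul X = comul X"
  using assms
  by (simp_all add: comon_def cocommutative_comonoid_def cocommutative_comonoid_axioms_def)

lemma coun_left: "comon X \<Longrightarrow> (coun X \<otimes>\<^sub>a \<ii> (cobj X)) \<cdot> comul X = inv_arr C (\<ll> (cobj X))"
  by (rule iso_mono[of "\<ll> (cobj X)"]) simp_all

text \<open>Naturality moves the comultiplications and counits of the two factors past the middle
  swaps. What remains is each factor's own axiom together with the matching axiom of the monoidal
  functor \<open>\<otimes>\<close>.\<close>

lemma comon_ctens [simp]:
  assumes [simp]: "comon X" "comon Y"
  shows "comon (ctens X Y)"
proof -
  \<comment> \<open>Fresh names block the rules in \<open>comon_simps\<close>: \<open>Xa\<close> and
    \<open>Ya\<close> state coassociativity in the opposite direction and are unfolded only at one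
    place.\<close>
  define x y dx dy ex ey where defs: "x = cobj X" "y = cobj Y" "dx = comul X" "dy = comul Y" "ex = coun X" "ey = coun Y"
  define p where "p = x \<otimes>\<^sub>o y"
  have X [simp]: "x \<in> Obj C" "dx \<in> Arr C" "Dom C dx = x" "Cod C dx = x \<otimes>\<^sub>o x" "ex \<in> Arr C" "Dom C ex = x" "Cod C ex = \<I>"
    and Xa: "(\<ii> x \<otimes>\<^sub>a dx) \<cdot> dx = \<aa> x x x \<cdot> (dx \<otimes>\<^sub>a \<ii> x) \<cdot> dx"
    and [simp]: "\<ll> x \<cdot> (ex \<otimes>\<^sub>a \<ii> x) \<cdot> dx = \<ii> x" "\<ss> x x \<cdot> dx = dx"
    unfolding defs by simp_all
  have Y [simp]: "y \<in> Obj C" "dy \<in> Arr C" "Dom C dy = y" "Cod C dy = y \<otimes>\<^sub>o y" "ey \<in> Arr C" "Dom C ey = y" "Cod C ey = \<I>"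
    and Ya: "(\<ii> y \<otimes>\<^sub>a dy) \<cdot> dy = \<aa> y y y \<cdot> (dy \<otimes>\<^sub>a \<ii> y) \<cdot> dy"
    and [simp]: "\<ll> y \<cdot> (ey \<otimes>\<^sub>a \<ii> y) \<cdot> dy = \<ii> y" "\<ss> y y \<cdot> dy = dy"
    unfolding defs by simp_all
  let ?d = "\<mm> x x y y \<cdot> (dx \<otimes>\<^sub>a dy)" and ?e = "\<ll> \<I> \<cdot> (ex \<otimes>\<^sub>a ey)"
  have ip: "\<ii> p = \<ii> x \<otimes>\<^sub>a \<ii> y" and [simp]: "p \<in> Obj C"
    by (simp_all add: p_def)
  have "\<aa> p p p \<cdot> (?d \<otimes>\<^sub>a \<ii> p) \<cdot> ?d = \<aa> p p p \<cdot> (\<mm> x x y y \<otimes>\<^sub>a \<ii> p) \<cdot> (((dx \<otimes>\<^sub>a dy) \<otimes>\<^sub>a (\<ii> x \<otimes>\<^sub>a \<ii> y)) \<cdot> \<mm> x x y y) \<cdot> (dx \<otimes>\<^sub>a dy)"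
    by (simp add: ich assoc p_def)
  also have "\<dots> = \<aa> p p p \<cdot> (\<mm> x x y y \<otimes>\<^sub>a \<ii> p) \<cdot> (\<mm> (x \<otimes>\<^sub>o x) x (y \<otimes>\<^sub>o y) y \<cdot> ((dx \<otimes>\<^sub>a \<ii> x) \<otimes>\<^sub>a (dy \<otimes>\<^sub>a \<ii> y))) \<cdot> (dx \<otimes>\<^sub>a dy)"
    by (subst mswap_nat) simp_all
  also have "\<dots> = (\<aa> p p p \<cdot> (\<mm> x x y y \<otimes>\<^sub>a \<ii> p) \<cdot> \<mm> (x \<otimes>\<^sub>o x) x (y \<otimes>\<^sub>o y) y) \<cdot> (((dx \<otimes>\<^sub>a \<ii> x) \<cdot> dx) \<otimes>\<^sub>a ((dy \<otimes>\<^sub>a \<ii> y) \<cdot> dy))"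
    by (simp add: ich assoc p_def)
  also have "\<dots> = (\<ii> p \<otimes>\<^sub>a \<mm> x x y y) \<cdot> \<mm> x (x \<otimes>\<^sub>o x) y (y \<otimes>\<^sub>o y) \<cdot> (((\<ii> x \<otimes>\<^sub>a dx) \<cdot> dx) \<otimes>\<^sub>a ((\<ii> y \<otimes>\<^sub>a dy) \<cdot> dy))"
    unfolding p_def mswap_assoc[OF X(1) Y(1) X(1) Y(1) X(1) Y(1)] Xa Ya by (simp add: ich assoc)
  also have "\<dots> = (\<ii> p \<otimes>\<^sub>a \<mm> x x y y) \<cdot> (\<mm> x (x \<otimes>\<^sub>o x) y (y \<otimes>\<^sub>o y) \<cdot> ((\<ii> x \<otimes>\<^sub>a dx) \<otimes>\<^sub>a (\<ii> y \<otimes>\<^sub>a dy))) \<cdot> (dx \<otimes>\<^sub>a dy)"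
    by (simp add: ich assoc p_def)
  also have "\<dots> = (\<ii> p \<otimes>\<^sub>a \<mm> x x y y) \<cdot> (((\<ii> x \<otimes>\<^sub>a \<ii> y) \<otimes>\<^sub>a (dx \<otimes>\<^sub>a dy)) \<cdot> \<mm> x x y y) \<cdot> (dx \<otimes>\<^sub>a dy)"
    by (subst mswap_nat) simp_all
  also have "\<dots> = (\<ii> p \<otimes>\<^sub>a ?d) \<cdot> ?d"
    by (simp add: ich assoc p_def)
  finally have 1: "\<aa> p p p \<cdot> (?d \<otimes>\<^sub>a \<ii> p) \<cdot> ?d = (\<ii> p \<otimes>\<^sub>a ?d) \<cdot> ?d" .
  have "\<ll> p \<cdot> (?e \<otimes>\<^sub>a \<ii> p) \<cdot> ?d = \<ll> p \<cdot> (\<ll> \<I> \<otimes>\<^sub>a \<ii> p) \<cdot> (((ex \<otimes>\<^sub>a ey) \<otimes>\<^sub>a (\<ii> x \<otimes>\<^sub>a \<ii> y)) \<cdot> \<mm> x x y y) \<cdot> (dx \<otimes>\<^sub>a dy)"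
    by (simp add: ich assoc p_def)
  also have "\<dots> = \<ll> p \<cdot> (\<ll> \<I> \<otimes>\<^sub>a \<ii> p) \<cdot> (\<mm> \<I> x \<I> y \<cdot> ((ex \<otimes>\<^sub>a \<ii> x) \<otimes>\<^sub>a (ey \<otimes>\<^sub>a \<ii> y))) \<cdot> (dx \<otimes>\<^sub>a dy)"
    by (subst mswap_nat) simp_all
  also have "\<dots> = (\<ll> p \<cdot> (\<ll> \<I> \<otimes>\<^sub>a \<ii> p) \<cdot> \<mm> \<I> x \<I> y) \<cdot> (((ex \<otimes>\<^sub>a \<ii> x) \<cdot> dx) \<otimes>\<^sub>a ((ey \<otimes>\<^sub>a \<ii> y) \<cdot> dy))"
    by (simp add: ich assoc p_def)
  also have "\<dots> = \<ii> p"
    unfolding p_def mswap_lunit[OF X(1) Y(1)] by (simp add: ich)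
  finally have 2: "\<ll> p \<cdot> (?e \<otimes>\<^sub>a \<ii> p) \<cdot> ?d = \<ii> p" .
  have "\<ss> p p \<cdot> ?d = \<mm> x x y y \<cdot> (\<ss> x x \<otimes>\<^sub>a \<ss> y y) \<cdot> (dx \<otimes>\<^sub>a dy)"
    by (simp add: p_def comp_cong2[OF mswap_symm])
  also have "\<dots> = ?d"
    by (simp add: ich)
  finally have "cocommutative_comonoid C p ?d ?e"
    using 1 2 by (intro comonI) (simp_all add: p_def)
  then show ?thesis
    by (simp add: comon_def ctens_def defs p_def)
qed

lemma comon_cunit [simp]: "comon cunit"
proof -
  have "\<aa> \<I> \<I> \<I> \<cdot> (inv_arr C (\<ll> \<I>) \<otimes>\<^sub>a \<ii> \<I>) = \<ii> \<I> \<otimes>\<^sub>a inv_arr C (\<ll> \<I>)"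
  proof (rule iso_mono[of "\<ii> \<I> \<otimes>\<^sub>a \<ll> \<I>"])
    show "(\<ii> \<I> \<otimes>\<^sub>a \<ll> \<I>) \<cdot> \<aa> \<I> \<I> \<I> \<cdot> (inv_arr C (\<ll> \<I>) \<otimes>\<^sub>a \<ii> \<I>) = (\<ii> \<I> \<otimes>\<^sub>a \<ll> \<I>) \<cdot> (\<ii> \<I> \<otimes>\<^sub>a inv_arr C (\<ll> \<I>))"
      by (simp add: comp_cong[OF triangle] lunit_unit[symmetric] ich)
  qed (simp_all add: iso_ide)
  then have "cocommutative_comonoid C \<I> (inv_arr C (\<ll> \<I>)) (\<ii> \<I>)"
    by (intro comonI) (simp_all add: comp_cong symm_unit)
  then show ?thesis
    by (simp add: comon_def cunit_def)
qed

lemma cobj_simps [simp]: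
  "cobj (ctens X Y) = cobj X \<otimes>\<^sub>o cobj Y" "cobj cunit = \<I>" "coun cunit = \<ii> \<I>"
  "comul cunit = inv_arr C (\<ll> \<I>)"
  by (simp_all add: ctens_def cunit_def)

lemma chom_simps:
  assumes "chom X Y f"
  shows "comon X" "comon Y" "f \<in> Arr C" "Dom C f = cobj X" "Cod C f = cobj Y"
    "coun Y \<cdot> f = coun X"
  using assms by (simp_all add: chom_def)

lemma chom_comul: "chom X Y f \<Longrightarrow> comul Y \<cdot> f = (f \<otimes>\<^sub>a f) \<cdot> comul X"
  by (simp add: chom_def)

lemma chom_ide [simp]: "comon X \<Longrightarrow> cobj X = x \<Longrightarrow> chom X X (\<ii> x)"
  by (auto simp: chom_def)

lemma chom_comp:
  assumes "chom X Y f" "chom Y Z g"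
  shows "chom X Z (g \<cdot> f)"
proof -
  note [simp] = chom_simps[OF assms(1)] chom_simps[OF assms(2)]
  show ?thesis
    unfolding chom_def
    by (simp add: comp_cong[OF chom_simps(6)[OF assms(2)]] comp_cong2[OF chom_comul[OF assms(2)]] chom_comul[OF assms(1)] ich)
qed

text \<open>Conjugating the equations for \<open>f\<close> with \<open>g\<close> gives those for
  \<open>g\<close>. This is how the inverse shear and the inverse right unitor, found merely as
  arrows of \<open>C\<close>, become comonoid homomorphisms.\<close>

lemma chom_inverse:
  assumes f: "chom X Y f" and "inverse_arrows C f g"
  shows "chom Y X g"
proof -
  note [simp] = chom_simps[OF f]
  have [simp]: "g \<in> Arr C" "Dom C g = cobj Y" "Cod C g = cobj X"
    "g \<cdot> f = \<ii> (cobj X)" "f \<cdot> g = \<ii> (cobj Y)"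
    using assms by (simp_all add: inverse_arrows_def)
  have *: "g \<cdot> f \<cdot> h = h" if "h \<in> Arr C" "Cod C h = cobj X" for h
    using that by (simp add: comp_cong)
  have "comul X \<cdot> g = (g \<otimes>\<^sub>a g) \<cdot> ((f \<otimes>\<^sub>a f) \<cdot> comul X) \<cdot> g"
    by (simp add: ich assoc)
  also have "\<dots> = (g \<otimes>\<^sub>a g) \<cdot> comul Y"
    by (simp add: chom_comul[OF f, symmetric] assoc)
  finally have 1: "comul X \<cdot> g = (g \<otimes>\<^sub>a g) \<cdot> comul Y" .
  have "coun X \<cdot> g = (coun Y \<cdot> f) \<cdot> g"
    by simp
  also have "\<dots> = coun Y"
    by (subst assoc) simp_all
  finally show ?thesis
    using 1 by (simp add: chom_def)
qed

lemma chom_tensor: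
  assumes "chom X Y f" "chom X' Y' f'"
  shows "chom (ctens X X') (ctens Y Y') (f \<otimes>\<^sub>a f')"
proof -
  note [simp] = chom_simps[OF assms(1)] chom_simps[OF assms(2)]
  have "comul (ctens Y Y') \<cdot> (f \<otimes>\<^sub>a f') = \<mm> (cobj Y) (cobj Y) (cobj Y') (cobj Y') \<cdot> ((f \<otimes>\<^sub>a f) \<otimes>\<^sub>a (f' \<otimes>\<^sub>a f')) \<cdot> (comul X \<otimes>\<^sub>a comul X')"
    by (simp add: ctens_def ich assoc chom_comul[OF assms(1)] chom_comul[OF assms(2)])
  also have "\<dots> = ((f \<otimes>\<^sub>a f') \<otimes>\<^sub>a (f \<otimes>\<^sub>a f')) \<cdot> comul (ctens X X')"
    by (simp add: ctens_def comp_cong2[OF mswap_nat] assoc)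
  finally show ?thesis
    by (simp add: chom_def) (simp add: ctens_def ich assoc)
qed

text \<open>Existence half of terminality of \<open>cunit\<close>; the uniqueness half is
  \<open>cunit_ext\<close>.\<close>

lemma chom_coun:
  assumes [simp]: "comon X"
  shows "chom X cunit (coun X)"
proof -
  have "(coun X \<otimes>\<^sub>a coun X) \<cdot> comul X = (\<ii> \<I> \<otimes>\<^sub>a coun X) \<cdot> (coun X \<otimes>\<^sub>a \<ii> (cobj X)) \<cdot> comul X"
    by (simp add: ich)
  also have "\<dots> = inv_arr C (\<ll> \<I>) \<cdot> (\<ll> \<I> \<cdot> (\<ii> \<I> \<otimes>\<^sub>a coun X)) \<cdot> inv_arr C (\<ll> (cobj X))"
    by (simp add: coun_left assoc)
  also have "\<dots> = inv_arr C (\<ll> \<I>) \<cdot> coun X"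
    by (simp add: lunit_nat assoc)
  finally show ?thesis
    by (simp add: chom_def)
qed

text \<open>This is where cocommutativity enters the product structure: the two sides are fourfold
  comultiplications that differ by exchanging the two middle copies. Every pairing is a comonoid
  homomorphism because of it.\<close>

lemma chom_comul_arrow:
  assumes [simp]: "comon X"
  shows "chom X (ctens X X) (comul X)"
proof -
  define x d where defs: "x = cobj X" "d = comul X"
  have [simp]: "x \<in> Obj C" "d \<in> Arr C" "Dom C d = x" "Cod C d = x \<otimes>\<^sub>o x" "\<ss> x x \<cdot> d = d"
    and a: "\<aa> x x x \<cdot> (d \<otimes>\<^sub>a \<ii> x) \<cdot> d = (\<ii> x \<otimes>\<^sub>a d) \<cdot> d"
    by (simp_all add: defs)
  have a': "\<aa>\<aa> x x x \<cdot> (\<ii> x \<otimes>\<^sub>a d) \<cdot> d = (d \<otimes>\<^sub>a \<ii> x) \<cdot> d"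
    by (simp add: a[symmetric])
  have "\<cc> x x x \<cdot> (\<ii> x \<otimes>\<^sub>a d) \<cdot> d = \<aa> x x x \<cdot> (\<ss> x x \<otimes>\<^sub>a \<ii> x) \<cdot> (d \<otimes>\<^sub>a \<ii> x) \<cdot> d"
    by (simp add: lswap_def assoc a')
  also have "\<dots> = (\<ii> x \<otimes>\<^sub>a d) \<cdot> d"
    by (simp add: ich a)
  finally have c: "\<cc> x x x \<cdot> (\<ii> x \<otimes>\<^sub>a d) \<cdot> d = (\<ii> x \<otimes>\<^sub>a d) \<cdot> d" .
  \<comment> \<open>Nesting to the right exposes a threefold comultiplication in the last three
    positions; by \<open>c\<close>, exchanging its first two copies changes nothing.\<close>
  have "\<aa> x x (x \<otimes>\<^sub>o x) \<cdot> (d \<otimes>\<^sub>a d) \<cdot> d = (\<aa> x x (x \<otimes>\<^sub>o x) \<cdot> ((\<ii> x \<otimes>\<^sub>a \<ii> x) \<otimes>\<^sub>a d)) \<cdot> (d \<otimes>\<^sub>a \<ii> x) \<cdot> d"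
    by (simp add: ich assoc)
  also have "\<dots> = (\<ii> x \<otimes>\<^sub>a (\<ii> x \<otimes>\<^sub>a d)) \<cdot> \<aa> x x x \<cdot> (d \<otimes>\<^sub>a \<ii> x) \<cdot> d"
    by (subst assc_nat) (simp_all add: assoc)
  also have "\<dots> = (\<ii> x \<otimes>\<^sub>a ((\<ii> x \<otimes>\<^sub>a d) \<cdot> d)) \<cdot> d"
    by (simp add: a ich)
  finally have r: "\<aa> x x (x \<otimes>\<^sub>o x) \<cdot> (d \<otimes>\<^sub>a d) \<cdot> d = (\<ii> x \<otimes>\<^sub>a ((\<ii> x \<otimes>\<^sub>a d) \<cdot> d)) \<cdot> d" .
  have "\<mm> x x x x \<cdot> (d \<otimes>\<^sub>a d) \<cdot> d = \<aa>\<aa> x x (x \<otimes>\<^sub>o x) \<cdot> \<aa> x x (x \<otimes>\<^sub>o x) \<cdot> (d \<otimes>\<^sub>a d) \<cdot> d"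
    unfolding mswap_def by (simp add: assoc r ich c)
  then have "\<mm> x x x x \<cdot> (d \<otimes>\<^sub>a d) \<cdot> d = (d \<otimes>\<^sub>a d) \<cdot> d"
    by simp
  moreover have "\<ll> \<I> \<cdot> (coun X \<otimes>\<^sub>a coun X) \<cdot> comul X = coun X"
    using chom_comul[OF chom_coun[OF assms], symmetric] by simp
  ultimately show ?thesis
    by (simp add: chom_def) (simp add: ctens_def assoc defs)
qed

lemma chom_cpair:
  assumes "chom X Y f" "chom X Z g"
  shows "chom X (ctens Y Z) (cpair X f g)"
  unfolding cpair_def
  by (rule chom_comp[OF chom_comul_arrow chom_tensor]) (rule chom_simps(1) assms)+

text \<open>Compatibility with comultiplication is \<open>mswap_symm\<close> with the middle swaps
  brought to the other side by \<open>mswap_inverse\<close>.\<close>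

lemma chom_symm:
  assumes [simp]: "comon X" "comon Y"
  shows "chom (ctens X Y) (ctens Y X) (\<ss> (cobj X) (cobj Y))"
proof -
  define x y dx dy where defs: "x = cobj X" "y = cobj Y" "dx = comul X" "dy = comul Y"
  have [simp]: "x \<in> Obj C" "dx \<in> Arr C" "Dom C dx = x" "Cod C dx = x \<otimes>\<^sub>o x"
    "y \<in> Obj C" "dy \<in> Arr C" "Dom C dy = y" "Cod C dy = y \<otimes>\<^sub>o y"
    by (simp_all add: defs)
  have "(\<mm> y y x x \<cdot> \<ss> (x \<otimes>\<^sub>o x) (y \<otimes>\<^sub>o y) \<cdot> \<mm> x y x y) \<cdot> \<mm> x x y y = (\<mm> y y x x \<cdot> \<mm> y x y x \<cdot> (\<ss> x y \<otimes>\<^sub>a \<ss> x y)) \<cdot> \<mm> x x y y"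
    by (simp add: mswap_symm)
  then have *: "\<mm> y y x x \<cdot> \<ss> (x \<otimes>\<^sub>o x) (y \<otimes>\<^sub>o y) = (\<ss> x y \<otimes>\<^sub>a \<ss> x y) \<cdot> \<mm> x x y y"
    by (simp add: assoc mswap_inverse)
  have "(\<mm> y y x x \<cdot> (dy \<otimes>\<^sub>a dx)) \<cdot> \<ss> x y = \<mm> y y x x \<cdot> \<ss> (x \<otimes>\<^sub>o x) (y \<otimes>\<^sub>o y) \<cdot> (dx \<otimes>\<^sub>a dy)"
    by (simp add: assoc symm_nat)
  also have "\<dots> = (\<ss> x y \<otimes>\<^sub>a \<ss> x y) \<cdot> \<mm> x x y y \<cdot> (dx \<otimes>\<^sub>a dy)"
    by (simp add: comp_cong2[OF *])
  finally have "comul (ctens Y X) \<cdot> \<ss> x y = (\<ss> x y \<otimes>\<^sub>a \<ss> x y) \<cdot> comul (ctens X Y)"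
    by (simp add: ctens_def defs)
  moreover have "\<ll> \<I> \<cdot> (coun Y \<otimes>\<^sub>a coun X) \<cdot> \<ss> x y = \<ll> \<I> \<cdot> \<ss> \<I> \<I> \<cdot> (coun X \<otimes>\<^sub>a coun Y)"
    by (simp add: symm_nat defs)
  ultimately show ?thesis
    by (simp add: chom_def defs[symmetric]) (simp add: ctens_def symm_unit assoc defs)
qed

lemma chom_lunit:
  assumes [simp]: "comon X"
  shows "chom (ctens cunit X) X (\<ll> (cobj X))"
proof -
  define x d where defs: "x = cobj X" "d = comul X"
  have [simp]: "x \<in> Obj C" "d \<in> Arr C" "Dom C d = x" "Cod C d = x \<otimes>\<^sub>o x"
    by (simp_all add: defs)
  have "(\<ll> x \<otimes>\<^sub>a \<ll> x) \<cdot> \<mm> \<I> \<I> x x = \<ll> (x \<otimes>\<^sub>o x) \<cdot> (\<ll> \<I> \<otimes>\<^sub>a \<ii> (x \<otimes>\<^sub>o x))"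
    by (simp add: mswap_lunit[symmetric] assoc mswap_inverse)
  then have "(\<ll> x \<otimes>\<^sub>a \<ll> x) \<cdot> \<mm> \<I> \<I> x x \<cdot> (inv_arr C (\<ll> \<I>) \<otimes>\<^sub>a d) = d \<cdot> \<ll> x"
    by (simp add: comp_cong2 ich lunit_nat)
  then have "comul X \<cdot> \<ll> x = (\<ll> x \<otimes>\<^sub>a \<ll> x) \<cdot> comul (ctens cunit X)"
    by (simp add: ctens_def defs)
  then show ?thesis
    by (simp add: chom_def defs[symmetric]) (simp add: ctens_def lunit_nat defs)
qed

section \<open>The tensor product of comonoids as a categorical product\<close>

lemma chom_csnd [simp]: "comon X \<Longrightarrow> comon Y \<Longrightarrow> chom (ctens X Y) Y (csnd X Y)"
  unfolding csnd_def by (rule chom_comp[OF chom_tensor[OF chom_coun chom_ide] chom_lunit]) simp_all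

text \<open>Transfers the homomorphism property from the second projection to the first, so that
  only the left unitor has to be treated directly.\<close>

lemma cfst_symm: "comon X \<Longrightarrow> comon Y \<Longrightarrow> csnd Y X \<cdot> \<ss> (cobj X) (cobj Y) = cfst X Y"
  by (simp add: cfst_def csnd_def lunit_symm[symmetric] symm_nat assoc)

lemma chom_cfst [simp]: "comon X \<Longrightarrow> comon Y \<Longrightarrow> chom (ctens X Y) X (cfst X Y)"
  unfolding cfst_symm[symmetric] by (rule chom_comp[OF chom_symm chom_csnd])

lemma cfst_arr [simp]:
  assumes "comon X" "comon Y"
  shows "cfst X Y \<in> Arr C" "Dom C (cfst X Y) = cobj X \<otimes>\<^sub>o cobj Y" "Cod C (cfst X Y) = cobj X"
    "csnd X Y \<in> Arr C" "Dom C (csnd X Y) = cobj X \<otimes>\<^sub>o cobj Y" "Cod C (csnd X Y) = cobj Y"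
  using chom_simps[OF chom_cfst[OF assms]] chom_simps[OF chom_csnd[OF assms]] by simp_all

lemma cfst_cpair:
  assumes "chom X Y f" "chom X Z g"
  shows "cfst Y Z \<cdot> cpair X f g = f"
proof -
  note [simp] = chom_simps[OF assms(1)] chom_simps[OF assms(2)]
  have "cfst Y Z \<cdot> cpair X f g = (\<rr> (cobj Y) \<cdot> (f \<otimes>\<^sub>a \<ii> \<I>)) \<cdot> (\<ii> (cobj X) \<otimes>\<^sub>a coun X) \<cdot> comul X"
    by (simp add: cfst_def cpair_def ich assoc)
  also have "\<dots> = f \<cdot> \<rr> (cobj X) \<cdot> (\<ii> (cobj X) \<otimes>\<^sub>a coun X) \<cdot> comul X"
    by (simp only: runit_nat chom_simps[OF assms(1)]) (simp add: assoc)
  finally show ?thesis by simp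
qed

lemma csnd_cpair:
  assumes "chom X Y f" "chom X Z g"
  shows "csnd Y Z \<cdot> cpair X f g = g"
proof -
  note [simp] = chom_simps[OF assms(1)] chom_simps[OF assms(2)]
  have "csnd Y Z \<cdot> cpair X f g = (\<ll> (cobj Z) \<cdot> (\<ii> \<I> \<otimes>\<^sub>a g)) \<cdot> (coun X \<otimes>\<^sub>a \<ii> (cobj X)) \<cdot> comul X"
    by (simp add: csnd_def cpair_def ich assoc)
  also have "\<dots> = g \<cdot> \<ll> (cobj X) \<cdot> (coun X \<otimes>\<^sub>a \<ii> (cobj X)) \<cdot> comul X"
    by (simp only: lunit_nat chom_simps[OF assms(2)]) (simp add: assoc)
  finally show ?thesis by simp
qed

text \<open>The counits can be moved in front of the middle swap by naturality. The swapped factors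
  are then both \<open>\<I>\<close>, \<open>mswap_unit\<close> removes the swap, and one counit law
  for each comonoid finishes.\<close>

lemma cpair_proj:
  assumes [simp]: "comon X" "comon Y"
  shows "cpair (ctens X Y) (cfst X Y) (csnd X Y) = \<ii> (cobj X \<otimes>\<^sub>o cobj Y)"
proof -
  define x y dx dy ex ey where defs: "x = cobj X" "y = cobj Y" "dx = comul X" "dy = comul Y" "ex = coun X" "ey = coun Y"
  have X [simp]: "x \<in> Obj C" "dx \<in> Arr C" "Dom C dx = x" "Cod C dx = x \<otimes>\<^sub>o x" "ex \<in> Arr C" "Dom C ex = x" "Cod C ex = \<I>"
     "\<rr> x \<cdot> (\<ii> x \<otimes>\<^sub>a ex) \<cdot> dx = \<ii> x"
    unfolding defs by simp_all
  have Y [simp]: "y \<in> Obj C" "dy \<in> Arr C" "Dom C dy = y" "Cod C dy = y \<otimes>\<^sub>o y" "ey \<in> Arr C" "Dom C ey = y" "Cod C ey = \<I>"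
     "\<ll> y \<cdot> (ey \<otimes>\<^sub>a \<ii> y) \<cdot> dy = \<ii> y"
    unfolding defs by simp_all
  have "cpair (ctens X Y) (cfst X Y) (csnd X Y) = (\<rr> x \<otimes>\<^sub>a \<ll> y) \<cdot> (((\<ii> x \<otimes>\<^sub>a ey) \<otimes>\<^sub>a (ex \<otimes>\<^sub>a \<ii> y)) \<cdot> \<mm> x x y y) \<cdot> (dx \<otimes>\<^sub>a dy)"
    by (simp add: cpair_def cfst_def csnd_def ctens_def defs ich assoc)
  also have "\<dots> = (\<rr> x \<otimes>\<^sub>a \<ll> y) \<cdot> (\<mm> x \<I> \<I> y \<cdot> ((\<ii> x \<otimes>\<^sub>a ex) \<otimes>\<^sub>a (ey \<otimes>\<^sub>a \<ii> y))) \<cdot> (dx \<otimes>\<^sub>a dy)"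
    by (subst mswap_nat) simp_all
  also have "\<dots> = \<ii> (x \<otimes>\<^sub>o y)"
    by (simp add: mswap_unit ich assoc)
  finally show ?thesis
    by (simp add: defs)
qed

lemma cpair_comp:
  assumes "chom X Y h" "f \<in> Arr C" "g \<in> Arr C" "Dom C f = cobj Y" "Dom C g = cobj Y"
  shows "cpair Y f g \<cdot> h = cpair X (f \<cdot> h) (g \<cdot> h)"
proof -
  note [simp] = chom_simps[OF assms(1)]
  show ?thesis
    using assms by (simp add: cpair_def assoc chom_comul[OF assms(1)] ich)
qed

lemma tensor_cpair:
  assumes "comon X" "f \<in> Arr C" "g \<in> Arr C" "Dom C f = cobj X" "Dom C g = cobj X"
    "h \<in> Arr C" "k \<in> Arr C" "Dom C h = Cod C f" "Dom C k = Cod C g"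
  shows "(h \<otimes>\<^sub>a k) \<cdot> cpair X f g = cpair X (h \<cdot> f) (k \<cdot> g)"
  using assms by (simp add: cpair_def ich)

lemma cprod_eta:
  assumes "chom X (ctens Y Z) h" "comon Y" "comon Z"
  shows "cpair X (cfst Y Z \<cdot> h) (csnd Y Z \<cdot> h) = h"
proof -
  note [simp] = chom_simps[OF assms(1)]
  have "cpair X (cfst Y Z \<cdot> h) (csnd Y Z \<cdot> h) = cpair (ctens Y Z) (cfst Y Z) (csnd Y Z) \<cdot> h"
    using assms by (simp add: cpair_comp[OF assms(1)])
  then show ?thesis
    using assms by (simp add: cpair_proj)
qed

text \<open>Uniqueness of the pairing. Together with \<open>cfst_cpair\<close> and
  \<open>csnd_cpair\<close> it is the universal property of the product; it holds for comonoid
  homomorphisms and not for arbitrary arrows of \<open>C\<close>.\<close>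

lemma cprod_ext:
  assumes "chom X (ctens Y Z) h" "chom X (ctens Y Z) k" "comon Y" "comon Z"
    "cfst Y Z \<cdot> h = cfst Y Z \<cdot> k" "csnd Y Z \<cdot> h = csnd Y Z \<cdot> k"
  shows "h = k"
proof -
  have "h = cpair X (cfst Y Z \<cdot> h) (csnd Y Z \<cdot> h)"
    by (rule cprod_eta[OF assms(1,3,4), symmetric])
  also have "\<dots> = cpair X (cfst Y Z \<cdot> k) (csnd Y Z \<cdot> k)"
    by (simp only: assms(5,6))
  also have "\<dots> = k"
    by (rule cprod_eta[OF assms(2-4)])
  finally show ?thesis .
qed

lemma cunit_ext: "chom X cunit h \<Longrightarrow> h = coun X"
  using chom_simps[of X cunit h] by simp

lemma cfst_tensor:
  assumes "chom X Y f" "chom X' Y' f'"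
  shows "cfst Y Y' \<cdot> (f \<otimes>\<^sub>a f') = f \<cdot> cfst X X'"
proof -
  note [simp] = chom_simps[OF assms(1)] chom_simps[OF assms(2)]
  have "cfst Y Y' \<cdot> (f \<otimes>\<^sub>a f') = (\<rr> (cobj Y) \<cdot> (f \<otimes>\<^sub>a \<ii> \<I>)) \<cdot> (\<ii> (cobj X) \<otimes>\<^sub>a coun X')"
    by (simp add: cfst_def ich assoc)
  also have "\<dots> = f \<cdot> cfst X X'"
    by (subst runit_nat) (simp_all add: cfst_def assoc)
  finally show ?thesis .
qed

lemma csnd_tensor:
  assumes "chom X Y f" "chom X' Y' f'"
  shows "csnd Y Y' \<cdot> (f \<otimes>\<^sub>a f') = f' \<cdot> csnd X X'"
proof -
  note [simp] = chom_simps[OF assms(1)] chom_simps[OF assms(2)]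
  have "csnd Y Y' \<cdot> (f \<otimes>\<^sub>a f') = (\<ll> (cobj Y') \<cdot> (\<ii> \<I> \<otimes>\<^sub>a f')) \<cdot> (coun X \<otimes>\<^sub>a \<ii> (cobj X'))"
    by (simp add: csnd_def ich assoc)
  also have "\<dots> = f' \<cdot> csnd X X'"
    by (subst lunit_nat) (simp_all add: csnd_def assoc)
  finally show ?thesis .
qed

lemma csnd_symm: "comon X \<Longrightarrow> comon Y \<Longrightarrow> cfst Y X \<cdot> \<ss> (cobj X) (cobj Y) = csnd X Y"
  by (simp add: cfst_symm[symmetric] assoc)

text \<open>Only naturality and coassociativity of the threefold product enter here, so it is not necessary
  to verify by a coherence argument that the associator is a comonoid homomorphism.\<close>

lemma assc_cpair:
  assumes [simp]: "comon X" "comon Y" "comon Z"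
  defines "W \<equiv> ctens (ctens X Y) Z" and "P \<equiv> cfst (ctens X Y) Z"
  shows "cpair W (cfst X Y \<cdot> P) (cpair W (csnd X Y \<cdot> P) (csnd (ctens X Y) Z)) = \<aa> (cobj X) (cobj Y) (cobj Z)"
proof -
  define p q r w d where defs: "p = cfst X Y \<cdot> P" "q = csnd X Y \<cdot> P" "r = csnd (ctens X Y) Z" "w = cobj W" "d = comul W"
  define x y z where xyz: "x = cobj X" "y = cobj Y" "z = cobj Z"
  have W: "comon W" and P: "chom W (ctens X Y) P" and W': "cobj W = (x \<otimes>\<^sub>o y) \<otimes>\<^sub>o z"
    by (simp_all add: W_def P_def xyz)
  note [simp] = chom_simps[OF P]
  have [simp]: "w \<in> Obj C" "d \<in> Arr C" "Dom C d = w" "Cod C d = w \<otimes>\<^sub>o w"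
    and a: "(\<ii> w \<otimes>\<^sub>a d) \<cdot> d = \<aa> w w w \<cdot> (d \<otimes>\<^sub>a \<ii> w) \<cdot> d"
    using W by (simp_all add: defs)
  have w: "w = (x \<otimes>\<^sub>o y) \<otimes>\<^sub>o z"
    using W' by (simp add: defs)
  have [simp]: "x \<in> Obj C" "y \<in> Obj C" "z \<in> Obj C" "p \<in> Arr C" "q \<in> Arr C" "r \<in> Arr C" "Dom C p = w" "Dom C q = w" "Dom C r = w"
    "Cod C p = x" "Cod C q = y" "Cod C r = z"
    using W' by (simp_all add: defs xyz)
  have "cpair W p (cpair W q r) = (p \<otimes>\<^sub>a (q \<otimes>\<^sub>a r)) \<cdot> (\<ii> w \<otimes>\<^sub>a d) \<cdot> d"
    by (simp add: cpair_def ich defs(4,5)[symmetric])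
  also have "\<dots> = ((p \<otimes>\<^sub>a (q \<otimes>\<^sub>a r)) \<cdot> \<aa> w w w) \<cdot> (d \<otimes>\<^sub>a \<ii> w) \<cdot> d"
    unfolding a by (simp add: assoc)
  also have "\<dots> = \<aa> x y z \<cdot> (((p \<otimes>\<^sub>a q) \<cdot> d) \<otimes>\<^sub>a r) \<cdot> d"
    using assc_nat[of p q r x y z, symmetric] by (simp add: assoc ich)
  also have "\<dots> = \<aa> x y z \<cdot> cpair W (cpair W p q) r"
    by (simp add: cpair_def defs(4,5))
  also have "cpair W p q = P"
    unfolding defs by (rule cprod_eta[OF P]) simp_all
  also have "cpair W P r = \<ii> ((x \<otimes>\<^sub>o y) \<otimes>\<^sub>o z)"
    using cpair_proj[of "ctens X Y" Z] by (simp add: W_def P_def defs xyz)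
  finally show ?thesis
    by (simp add: defs xyz)
qed

lemma chom_assc:
  assumes [simp]: "comon X" "comon Y" "comon Z"
  shows "chom (ctens (ctens X Y) Z) (ctens X (ctens Y Z)) (\<aa> (cobj X) (cobj Y) (cobj Z))"
  unfolding assc_cpair[OF assms, symmetric]
  by (intro chom_cpair chom_comp[OF chom_cfst chom_cfst] chom_comp[OF chom_cfst chom_csnd] chom_csnd)
    simp_all

lemma assc_proj:
  assumes [simp]: "comon X" "comon Y" "comon Z"
  shows "cfst X (ctens Y Z) \<cdot> \<aa> (cobj X) (cobj Y) (cobj Z) = cfst X Y \<cdot> cfst (ctens X Y) Z"
    and "csnd X (ctens Y Z) \<cdot> \<aa> (cobj X) (cobj Y) (cobj Z)
      = cpair (ctens (ctens X Y) Z) (csnd X Y \<cdot> cfst (ctens X Y) Z) (csnd (ctens X Y) Z)"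
  unfolding assc_cpair[OF assms, symmetric]
  by (intro cfst_cpair csnd_cpair chom_cpair chom_comp[OF chom_cfst chom_cfst]
      chom_comp[OF chom_cfst chom_csnd] chom_csnd; simp)+

end

section \<open>Integer combinations in commutative groups\<close>

text \<open>The linear combination of \<open>x 0, ..., x (n - 1)\<close> with integer coefficients
  \<open>r\<close>, in the multiplicative notation of the group library. A matrix row supplies
  \<open>r\<close>, and projections supply \<open>x\<close>.\<close>

primrec int_comb :: "('g, 'm) monoid_scheme \<Rightarrow> nat \<Rightarrow> (nat \<Rightarrow> int) \<Rightarrow> (nat \<Rightarrow> 'g) \<Rightarrow> 'g" where
  "int_comb G 0 r x = \<one>\<^bsub>G\<^esub>"
| "int_comb G (Suc n) r x = int_comb G n r x \<otimes>\<^bsub>G\<^esub> (x n [^]\<^bsub>G\<^esub> r n)"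

lemma int_comb_cong:
  "(\<And>i. i < n \<Longrightarrow> r i = s i) \<Longrightarrow> (\<And>i. i < n \<Longrightarrow> x i = y i) \<Longrightarrow> int_comb G n r x = int_comb G n s y"
  by (induction n) simp_all

context comm_group
begin

lemma int_comb_closed [simp]: "(\<And>i. i < n \<Longrightarrow> x i \<in> carrier G) \<Longrightarrow> int_comb G n r x \<in> carrier G"
  by (induction n) simp_all

lemma int_comb_zero: "(\<And>i. i < n \<Longrightarrow> r i = 0) \<Longrightarrow> int_comb G n r x = \<one>"
  by (induction n) simp_all

lemma int_comb_add:
  "(\<And>i. i < n \<Longrightarrow> x i \<in> carrier G) \<Longrightarrow>
    int_comb G n (\<lambda>i. r i + s i) x = int_comb G n r x \<otimes> int_comb G n s x"
proof (induction n)
  case (Suc n)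
  have [simp]: "int_comb G n r x \<in> carrier G" "int_comb G n s x \<in> carrier G" "x n \<in> carrier G"
    using Suc by auto
  have "int_comb G (Suc n) (\<lambda>i. r i + s i) x
      = (int_comb G n r x \<otimes> int_comb G n s x) \<otimes> (x n [^] r n \<otimes> x n [^] s n)"
    using Suc by (simp add: int_pow_mult)
  also have "\<dots> = int_comb G (Suc n) r x \<otimes> int_comb G (Suc n) s x"
    by (simp add: m_ac)
  finally show ?case .
qed simp

lemma int_comb_pow:
  "(\<And>i. i < n \<Longrightarrow> x i \<in> carrier G) \<Longrightarrow> int_comb G n (\<lambda>i. r i * z) x = int_comb G n r x [^] (z :: int)"
  by (induction n) (simp_all add: int_pow_distrib int_pow_pow)

lemma int_comb_delta:
  "i < n \<Longrightarrow> (\<And>i. i < n \<Longrightarrow> x i \<in> carrier G) \<Longrightarrow> int_comb G n (\<lambda>j. if j = i then 1 else 0) x = x i"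
proof (induction n)
  case (Suc n)
  then show ?case
    by (cases "i = n") (simp_all add: int_comb_zero)
qed simp

lemma int_comb_single: "x 0 \<in> carrier G \<Longrightarrow> int_comb G 1 r x = x 0 [^] r 0"
  by simp

lemma int_comb_two:
  "x 0 \<in> carrier G \<Longrightarrow> x 1 \<in> carrier G \<Longrightarrow> int_comb G 2 r x = x 0 [^] r 0 \<otimes> x 1 [^] r 1"
  by (simp add: numeral_2_eq_2)

lemma int_comb_append:
  assumes "\<And>i. i < m + n \<Longrightarrow> x i \<in> carrier G"
  shows "int_comb G (m + n) r x = int_comb G m r x \<otimes> int_comb G n (\<lambda>i. r (m + i)) (\<lambda>i. x (m + i))"
  using assms by (induction n) (simp_all add: m_assoc)

text \<open>Substituting combinations into a combination multiplies the coefficient matrices; this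
  is the algebra behind functoriality of the matrix action.\<close>

lemma int_comb_comb:
  assumes "\<And>j. j < n \<Longrightarrow> x j \<in> carrier G"
  shows "int_comb G m r (\<lambda>i. int_comb G n (s i) x) = int_comb G n (\<lambda>j. \<Sum>i<m. r i * s i j) x"
proof (induction m)
  case 0
  then show ?case by (simp add: int_comb_zero)
next
  case (Suc m)
  have "int_comb G (Suc m) r (\<lambda>i. int_comb G n (s i) x)
      = int_comb G n (\<lambda>j. \<Sum>i<m. r i * s i j) x \<otimes> int_comb G n (\<lambda>j. s m j * r m) x"
    using assms by (simp add: Suc int_comb_pow)
  also have "\<dots> = int_comb G n (\<lambda>j. (\<Sum>i<m. r i * s i j) + s m j * r m) x"
    using assms by (simp add: int_comb_add)
  also have "\<dots> = int_comb G n (\<lambda>j. \<Sum>i<Suc m. r i * s i j) x"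
    by (simp add: mult.commute)
  finally show ?case .
qed

end

lemma (in group_hom) hom_int_comb:
  assumes "\<And>i. i < n \<Longrightarrow> x i \<in> carrier G"
  shows "h (int_comb G n r x) = int_comb H n r (\<lambda>i. h (x i))"
  using assms
proof (induction n)
  case (Suc n)
  have "int_comb G n r x \<in> carrier G"
    using Suc.prems by (induction n) simp_all
  then show ?case
    using Suc by (simp add: hom_int_pow)
qed simp

section \<open>Hopf monoids as group objects\<close>

context symmetric_monoidal_category
begin

text \<open>Including the unit at the end gives all powers one uniform recursion. The price is that
  \<open>cpow X 1\<close> is \<open>ctens X cunit\<close> and not \<open>X\<close>.\<close>

primrec cpow :: "('o, 'a) comonoid \<Rightarrow> nat \<Rightarrow> ('o, 'a) comonoid" where
  "cpow X 0 = cunit"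
| "cpow X (Suc n) = ctens X (cpow X n)"

primrec proj :: "('o, 'a) comonoid \<Rightarrow> nat \<Rightarrow> nat \<Rightarrow> 'a" where
  "proj X 0 i = undefined"
| "proj X (Suc n) i = (case i of 0 \<Rightarrow> cfst X (cpow X n) | Suc j \<Rightarrow> proj X n j \<cdot> csnd X (cpow X n))"

primrec tuple :: "('o, 'a) comonoid \<Rightarrow> nat \<Rightarrow> (nat \<Rightarrow> 'a) \<Rightarrow> 'a" where
  "tuple W 0 f = coun W"
| "tuple W (Suc n) f = cpair W (f 0) (tuple W n (\<lambda>i. f (Suc i)))"

lemma comon_cpow [simp]: "comon X \<Longrightarrow> comon (cpow X n)"
  by (induction n) simp_all

lemma chom_proj: "comon X \<Longrightarrow> i < n \<Longrightarrow> chom (cpow X n) X (proj X n i)"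
proof (induction n arbitrary: i)
  case (Suc n)
  then show ?case
    by (auto split: nat.split intro: chom_comp[OF chom_csnd])
qed simp

lemma chom_tuple:
  "comon W \<Longrightarrow> (\<And>i. i < n \<Longrightarrow> chom W X (f i)) \<Longrightarrow> chom W (cpow X n) (tuple W n f)"
proof (induction n arbitrary: f)
  case 0
  then show ?case by (simp add: chom_coun)
next
  case (Suc n)
  then show ?case by (simp add: chom_cpair)
qed

lemma proj_tuple:
  "comon W \<Longrightarrow> (\<And>i. i < n \<Longrightarrow> chom W X (f i)) \<Longrightarrow> i < n \<Longrightarrow> proj X n i \<cdot> tuple W n f = f i"
proof (induction n arbitrary: f i)
  case (Suc n)
  have f: "chom W X (f 0)" and t: "chom W (cpow X n) (tuple W n (\<lambda>i. f (Suc i)))"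
    using Suc by (auto intro: chom_tuple)
  have X: "comon X"
    using chom_simps(2)[OF f] .
  show ?case
  proof (cases i)
    case 0
    then show ?thesis
      by (simp add: cfst_cpair[OF f t])
  next
    case (Suc j)
    then have p: "chom (cpow X n) X (proj X n j)"
      using Suc.prems X by (auto intro: chom_proj)
    have "(proj X n j \<cdot> csnd X (cpow X n)) \<cdot> tuple W (Suc n) f = proj X n j \<cdot> csnd X (cpow X n) \<cdot> tuple W (Suc n) f"
      using X chom_simps[OF p] chom_simps[OF chom_cpair[OF f t]] by (subst assoc) simp_all
    also have "\<dots> = proj X n j \<cdot> tuple W n (\<lambda>i. f (Suc i))"
      by (simp add: csnd_cpair[OF f t])
    also have "\<dots> = f i"
      using Suc.IH[of "\<lambda>i. f (Suc i)" j] Suc.prems Suc by simp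
    finally show ?thesis
      by (simp add: Suc)
  qed
qed simp

text \<open>The projections of a finite product are jointly monic. Equations below are checked
  through this rule, always after both sides have been shown to be comonoid homomorphisms.\<close>

lemma cpow_ext:
  "chom W (cpow X n) f \<Longrightarrow> chom W (cpow X n) g \<Longrightarrow> comon X \<Longrightarrow>
    (\<And>i. i < n \<Longrightarrow> proj X n i \<cdot> f = proj X n i \<cdot> g) \<Longrightarrow> f = g"
proof (induction n arbitrary: f g)
  case 0
  then show ?case using cunit_ext[of W f] cunit_ext[of W g] by simp
next
  case (Suc n)
  note f = Suc.prems(1)[unfolded cpow.simps] and g = Suc.prems(2)[unfolded cpow.simps]
  note [simp] = chom_simps[OF f] chom_simps[OF g] \<open>comon X\<close>
  show ?case
  proof (rule cprod_ext[OF f g])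
    show "cfst X (cpow X n) \<cdot> f = cfst X (cpow X n) \<cdot> g"
      using Suc.prems(4)[of 0] by simp
    show "csnd X (cpow X n) \<cdot> f = csnd X (cpow X n) \<cdot> g"
    proof (rule Suc.IH)
      show "proj X n i \<cdot> csnd X (cpow X n) \<cdot> f = proj X n i \<cdot> csnd X (cpow X n) \<cdot> g" if "i < n" for i
      proof -
        note [simp] = chom_simps[OF chom_proj[OF \<open>comon X\<close> that]]
        show ?thesis
          using Suc.prems(4)[of "Suc i"] that by (simp add: assoc)
      qed
    qed (auto intro: chom_comp[OF f chom_csnd] chom_comp[OF g chom_csnd])
  qed simp_all
qed

end

section \<open>Convolution and the antipode\<close>

locale hopf_object = bicommutative_bimonoid C A \<mu> \<eta> \<Delta> \<epsilon>
  for C :: "('o, 'a, 'x) smc_scheme" (structure) and A \<mu> \<eta> \<Delta> \<epsilon> +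
  fixes S :: 'a
  assumes antipode_in_hom: "S \<in> homset C A A"
    and antipode_left: "\<mu> \<cdot> (S \<otimes>\<^sub>a ide C A) \<cdot> \<Delta> = \<eta> \<cdot> \<epsilon>"
    and antipode_right: "\<mu> \<cdot> (ide C A \<otimes>\<^sub>a S) \<cdot> \<Delta> = \<eta> \<cdot> \<epsilon>"
begin

definition B :: "('o, 'a) comonoid" where
  "B = \<lparr>cobj = A, comul = \<Delta>, coun = \<epsilon>\<rparr>"

lemma B_simps [simp]: "cobj B = A" "comul B = \<Delta>" "coun B = \<epsilon>"
  by (simp_all add: B_def)

lemma comon_B [simp]: "comon B"
  by (simp add: comon_def cocommutative_comonoid_axioms)

lemma hopf_simps [simp]:
  "A \<in> Obj C" "\<mu> \<in> Arr C" "Dom C \<mu> = A \<otimes>\<^sub>o A" "Cod C \<mu> = A" "\<eta> \<in> Arr C" "Dom C \<eta> = \<I>" "Cod C \<eta> = A"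
  "\<Delta> \<in> Arr C" "Dom C \<Delta> = A" "Cod C \<Delta> = A \<otimes>\<^sub>o A" "\<epsilon> \<in> Arr C" "Dom C \<epsilon> = A" "Cod C \<epsilon> = \<I>"
  "S \<in> Arr C" "Dom C S = A" "Cod C S = A"
  using carrier_obj mult_in_hom unit_in_hom comult_in_hom counit_in_hom antipode_in_hom by auto

text \<open>The compatibility axioms of a bimonoid say precisely that \<open>\<mu>\<close> and
  \<open>\<eta>\<close> are comonoid homomorphisms, that is, that \<open>A\<close> is a monoid
  object among comonoids.\<close>

lemma chom_mult: "chom (ctens B B) B \<mu>"
  unfolding chom_def using comult_mult counit_mult
  by simp (simp add: ctens_def middle_swap_eq)

lemma chom_unit: "chom cunit B \<eta>"
  by (simp add: chom_def comult_unit counit_unit)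

text \<open>Multiplication of generalised elements of \<open>A\<close> of shape \<open>W\<close>. It
  makes sense for all arrows, which matters because it is applied to \<open>S\<close> before
  \<open>S\<close> is known to be a comonoid homomorphism.\<close>

definition conv where
  "conv W f g = \<mu> \<cdot> (f \<otimes>\<^sub>a g) \<cdot> comul W"

lemma conv_simps [simp]:
  assumes "comon W" "f \<in> Arr C" "Dom C f = cobj W" "Cod C f = A" "g \<in> Arr C" "Dom C g = cobj W" "Cod C g = A"
  shows "conv W f g \<in> Arr C" "Dom C (conv W f g) = cobj W" "Cod C (conv W f g) = A"
  using assms by (simp_all add: conv_def)

lemma chom_conv: "chom W B f \<Longrightarrow> chom W B g \<Longrightarrow> chom W B (conv W f g)"
  unfolding conv_def cpair_def[symmetric] by (rule chom_comp[OF chom_cpair chom_mult])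

lemma conv_assoc:
  assumes [simp]: "comon W" "f \<in> Arr C" "Dom C f = cobj W" "Cod C f = A" "g \<in> Arr C" "Dom C g = cobj W" "Cod C g = A"
    "h \<in> Arr C" "Dom C h = cobj W" "Cod C h = A"
  shows "conv W (conv W f g) h = conv W f (conv W g h)"
proof -
  define w d where defs: "w = cobj W" "d = comul W"
  have [simp]: "w \<in> Obj C" "d \<in> Arr C" "Dom C d = w" "Cod C d = w \<otimes>\<^sub>o w" "cobj W = w"
    and a: "\<aa> w w w \<cdot> (d \<otimes>\<^sub>a \<ii> w) \<cdot> d = (\<ii> w \<otimes>\<^sub>a d) \<cdot> d"
    by (simp_all add: defs)
  have "conv W (conv W f g) h = (\<mu> \<cdot> (\<mu> \<otimes>\<^sub>a \<ii> A)) \<cdot> ((f \<otimes>\<^sub>a g) \<otimes>\<^sub>a h) \<cdot> (d \<otimes>\<^sub>a \<ii> w) \<cdot> d"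
    by (simp add: conv_def ich assoc defs(2)[symmetric])
  also have "\<dots> = \<mu> \<cdot> (\<ii> A \<otimes>\<^sub>a \<mu>) \<cdot> (\<aa> A A A \<cdot> ((f \<otimes>\<^sub>a g) \<otimes>\<^sub>a h)) \<cdot> (d \<otimes>\<^sub>a \<ii> w) \<cdot> d"
    unfolding mult_assoc by (simp add: assoc)
  also have "\<dots> = \<mu> \<cdot> (\<ii> A \<otimes>\<^sub>a \<mu>) \<cdot> (f \<otimes>\<^sub>a (g \<otimes>\<^sub>a h)) \<cdot> \<aa> w w w \<cdot> (d \<otimes>\<^sub>a \<ii> w) \<cdot> d"
    by (subst assc_nat) (simp_all add: assoc)
  also have "\<dots> = conv W f (conv W g h)"
    by (simp add: a ich) (simp add: conv_def defs)
  finally show ?thesis .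
qed

lemma conv_unit:
  assumes [simp]: "comon W" "f \<in> Arr C" "Dom C f = cobj W" "Cod C f = A"
  shows "conv W (\<eta> \<cdot> coun W) f = f"
proof -
  have "conv W (\<eta> \<cdot> coun W) f = (\<mu> \<cdot> (\<eta> \<otimes>\<^sub>a \<ii> A)) \<cdot> (\<ii> \<I> \<otimes>\<^sub>a f) \<cdot> (coun W \<otimes>\<^sub>a \<ii> (cobj W)) \<cdot> comul W"
    by (simp add: conv_def ich assoc)
  also have "\<dots> = (\<ll> A \<cdot> (\<ii> \<I> \<otimes>\<^sub>a f)) \<cdot> inv_arr C (\<ll> (cobj W))"
    by (simp add: mult_unit_left coun_left assoc)
  also have "\<dots> = f"
    by (simp add: lunit_nat assoc)
  finally show ?thesis .
qed

lemma conv_commute: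
  assumes [simp]: "comon W" "f \<in> Arr C" "Dom C f = cobj W" "Cod C f = A" "g \<in> Arr C" "Dom C g = cobj W" "Cod C g = A"
  shows "conv W f g = conv W g f"
proof -
  have "conv W f g = (\<mu> \<cdot> \<ss> A A) \<cdot> (f \<otimes>\<^sub>a g) \<cdot> comul W"
    by (simp add: mult_commutative conv_def)
  also have "\<dots> = \<mu> \<cdot> (g \<otimes>\<^sub>a f) \<cdot> \<ss> (cobj W) (cobj W) \<cdot> comul W"
    by (simp add: assoc comp_cong2[OF symm_nat])
  also have "\<dots> = conv W g f"
    by (simp add: conv_def)
  finally show ?thesis .
qed

lemma conv_comp:
  assumes h: "chom V W h" and [simp]: "f \<in> Arr C" "Dom C f = cobj W" "Cod C f = A" "g \<in> Arr C" "Dom C g = cobj W" "Cod C g = A"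
  shows "conv W f g \<cdot> h = conv V (f \<cdot> h) (g \<cdot> h)"
proof -
  note [simp] = chom_simps[OF h]
  show ?thesis
    by (simp add: conv_def assoc chom_comul[OF h] ich)
qed

text \<open>For \<open>g = 1\<close> this is the shear map \<open>(a, b) \<mapsto> (a, a b)\<close>. As a comonoid homomorphism it has an
  inverse in \<open>C\<close>, the shear along \<open>S\<close>, which is therefore a comonoid homomorphism too.\<close>

definition shear where
  "shear g = (\<ii> A \<otimes>\<^sub>a (\<mu> \<cdot> (g \<otimes>\<^sub>a \<ii> A))) \<cdot> \<aa> A A A \<cdot> (\<Delta> \<otimes>\<^sub>a \<ii> A)"

lemma shear_simps [simp]:
  assumes "g \<in> Arr C" "Dom C g = A" "Cod C g = A"
  shows "shear g \<in> Arr C" "Dom C (shear g) = A \<otimes>\<^sub>o A" "Cod C (shear g) = A \<otimes>\<^sub>o A"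
  using assms by (simp_all add: shear_def)

text \<open>On elements, \<open>(a, b) \<mapsto> (a, h a b) \<mapsto> (a, g a h a b)\<close>, so
  shears turn convolution of endomorphisms into composition. In particular convolution inverses give
  inverse shears.\<close>

lemma shear_comp:
  assumes [simp]: "g \<in> Arr C" "Dom C g = A" "Cod C g = A" "h \<in> Arr C" "Dom C h = A" "Cod C h = A"
  shows "shear g \<cdot> shear h = shear (conv B g h)"
proof -
  let ?q = "\<mu> \<cdot> (h \<otimes>\<^sub>a \<ii> A)"
  let ?d = "\<Delta> \<otimes>\<^sub>a \<ii> A"
  have "shear g \<cdot> shear h = (\<ii> A \<otimes>\<^sub>a (\<mu> \<cdot> (g \<otimes>\<^sub>a \<ii> A))) \<cdot> (\<aa> A A A \<cdot> ((\<ii> A \<otimes>\<^sub>a \<ii> A) \<otimes>\<^sub>a ?q)) \<cdot> (\<Delta> \<otimes>\<^sub>a \<ii> (A \<otimes>\<^sub>o A)) \<cdot> \<aa> A A A \<cdot> ?d"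
    by (simp add: shear_def ich assoc)
  also have "\<dots> = (\<ii> A \<otimes>\<^sub>a (\<mu> \<cdot> (g \<otimes>\<^sub>a \<ii> A))) \<cdot> (\<ii> A \<otimes>\<^sub>a (\<ii> A \<otimes>\<^sub>a ?q)) \<cdot> \<aa> A A (A \<otimes>\<^sub>o A) \<cdot> ((\<Delta> \<otimes>\<^sub>a (\<ii> A \<otimes>\<^sub>a \<ii> A)) \<cdot> \<aa> A A A) \<cdot> ?d"
    by (subst assc_nat) (simp_all add: assoc)
  also have "\<dots> = (\<ii> A \<otimes>\<^sub>a (\<mu> \<cdot> (g \<otimes>\<^sub>a ?q))) \<cdot> \<aa> A A (A \<otimes>\<^sub>o A) \<cdot> (\<aa> (A \<otimes>\<^sub>o A) A A \<cdot> (?d \<otimes>\<^sub>a \<ii> A)) \<cdot> ?d"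
    using assc_nat[of \<Delta> "\<ii> A" "\<ii> A" "A \<otimes>\<^sub>o A" A A] by (simp add: ich assoc)
  also have "\<dots> = (\<ii> A \<otimes>\<^sub>a (\<mu> \<cdot> (g \<otimes>\<^sub>a ?q))) \<cdot> (\<ii> A \<otimes>\<^sub>a \<aa> A A A) \<cdot> \<aa> A (A \<otimes>\<^sub>o A) A \<cdot> (\<aa> A A A \<otimes>\<^sub>a \<ii> A) \<cdot> (?d \<otimes>\<^sub>a \<ii> A) \<cdot> ?d"
    by (subst pentagon_comp) (simp_all add: assoc)
  also have "\<dots> = (\<ii> A \<otimes>\<^sub>a (\<mu> \<cdot> (g \<otimes>\<^sub>a ?q) \<cdot> \<aa> A A A)) \<cdot> (\<aa> A (A \<otimes>\<^sub>o A) A \<cdot> ((\<ii> A \<otimes>\<^sub>a \<Delta>) \<otimes>\<^sub>a \<ii> A)) \<cdot> ?d"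
    by (simp add: ich assoc comult_coassoc)
  also have "\<dots> = (\<ii> A \<otimes>\<^sub>a (\<mu> \<cdot> (g \<otimes>\<^sub>a ?q) \<cdot> \<aa> A A A \<cdot> ?d)) \<cdot> \<aa> A A A \<cdot> ?d"
    by (subst assc_nat) (simp_all add: ich assoc)
  also have "\<mu> \<cdot> (g \<otimes>\<^sub>a ?q) \<cdot> \<aa> A A A \<cdot> ?d = \<mu> \<cdot> (\<ii> A \<otimes>\<^sub>a \<mu>) \<cdot> ((g \<otimes>\<^sub>a (h \<otimes>\<^sub>a \<ii> A)) \<cdot> \<aa> A A A) \<cdot> ?d"
    by (simp add: ich assoc)
  also have "\<dots> = (\<mu> \<cdot> (\<ii> A \<otimes>\<^sub>a \<mu>) \<cdot> \<aa> A A A) \<cdot> ((g \<otimes>\<^sub>a h) \<otimes>\<^sub>a \<ii> A) \<cdot> ?d"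
    using assc_nat[of g h "\<ii> A" A A A, symmetric] by (simp add: assoc)
  also have "\<dots> = \<mu> \<cdot> (conv B g h \<otimes>\<^sub>a \<ii> A)"
    unfolding mult_assoc[symmetric] by (simp add: assoc ich conv_def)
  finally show ?thesis
    by (simp add: shear_def)
qed

lemma shear_unit: "shear (\<eta> \<cdot> \<epsilon>) = \<ii> (A \<otimes>\<^sub>o A)"
proof -
  have "shear (\<eta> \<cdot> \<epsilon>) = (\<ii> A \<otimes>\<^sub>a (\<mu> \<cdot> (\<eta> \<otimes>\<^sub>a \<ii> A))) \<cdot> ((\<ii> A \<otimes>\<^sub>a (\<epsilon> \<otimes>\<^sub>a \<ii> A)) \<cdot> \<aa> A A A) \<cdot> (\<Delta> \<otimes>\<^sub>a \<ii> A)"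
    by (simp add: shear_def ich assoc)
  also have "\<dots> = ((\<ii> A \<otimes>\<^sub>a \<ll> A) \<cdot> \<aa> A \<I> A) \<cdot> (((\<ii> A \<otimes>\<^sub>a \<epsilon>) \<cdot> \<Delta>) \<otimes>\<^sub>a \<ii> A)"
    using assc_nat[of "\<ii> A" \<epsilon> "\<ii> A" A \<I> A, symmetric] by (simp add: mult_unit_left assoc ich)
  also have "\<dots> = \<ii> (A \<otimes>\<^sub>o A)"
    by (simp add: triangle ich comult_counit_right)
  finally show ?thesis .
qed

text \<open>\<open>S a\<close> is the second component of the inverse shear applied to
  \<open>(a, 1)\<close>. This writes \<open>S\<close> as a composite of comonoid
  homomorphisms.\<close>

lemma chom_antipode: "chom B B S"
proof -
  have d: "chom (ctens B B) (ctens (ctens B B) B) (\<Delta> \<otimes>\<^sub>a \<ii> A)"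
    using chom_tensor[OF chom_comul_arrow[OF comon_B] chom_ide[OF comon_B refl]] by simp
  have "shear (\<ii> A) = (\<ii> A \<otimes>\<^sub>a \<mu>) \<cdot> \<aa> A A A \<cdot> (\<Delta> \<otimes>\<^sub>a \<ii> A)"
    by (simp add: shear_def)
  then have 1: "chom (ctens B B) (ctens B B) (shear (\<ii> A))"
    using chom_comp[OF chom_comp[OF d chom_assc[of B B B, unfolded B_simps]]
        chom_tensor[OF chom_ide[OF comon_B refl] chom_mult]]
    by simp
  have "conv B (\<ii> A) S = \<eta> \<cdot> \<epsilon>" "conv B S (\<ii> A) = \<eta> \<cdot> \<epsilon>"
    by (simp_all add: conv_def antipode_left antipode_right)
  then have "inverse_arrows C (shear (\<ii> A)) (shear S)"
    by (simp add: inverse_arrows_def shear_comp shear_unit)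
  then have 2: "chom (ctens B B) (ctens B B) (shear S)"
    using chom_inverse[OF 1] by simp
  have 3: "chom (ctens B cunit) (ctens B B) (\<ii> A \<otimes>\<^sub>a \<eta>)"
    by (rule chom_tensor[OF _ chom_unit]) simp
  \<comment> \<open>The counit of \<open>cunit\<close> is an identity, so this projection is an
    invertible homomorphism, and \<open>chom_inverse\<close> applies to the arrow that adds a unit
    factor.\<close>
  have "cfst B cunit = \<rr> A"
    by (simp add: cfst_def)
  then have 4: "chom B (ctens B cunit) (inv_arr C (\<rr> A))"
    using chom_inverse[OF chom_cfst[OF comon_B comon_cunit]] by (simp add: inverse_arrows_inv)
  let ?q = "\<mu> \<cdot> (S \<otimes>\<^sub>a \<ii> A)"
  have e: "(\<epsilon> \<otimes>\<^sub>a (\<ii> A \<otimes>\<^sub>a \<ii> A)) \<cdot> \<aa> A A A = \<aa> \<I> A A \<cdot> ((\<epsilon> \<otimes>\<^sub>a \<ii> A) \<otimes>\<^sub>a \<ii> A)"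
    by (subst assc_nat) simp_all
  have "csnd B B \<cdot> shear S = \<ll> A \<cdot> (\<ii> \<I> \<otimes>\<^sub>a ?q) \<cdot> ((\<epsilon> \<otimes>\<^sub>a (\<ii> A \<otimes>\<^sub>a \<ii> A)) \<cdot> \<aa> A A A) \<cdot> (\<Delta> \<otimes>\<^sub>a \<ii> A)"
    by (simp add: csnd_def shear_def ich assoc)
  also have "\<dots> = (\<ll> A \<cdot> (\<ii> \<I> \<otimes>\<^sub>a ?q)) \<cdot> \<aa> \<I> A A \<cdot> (((\<epsilon> \<otimes>\<^sub>a \<ii> A) \<cdot> \<Delta>) \<otimes>\<^sub>a \<ii> A)"
    unfolding e by (simp add: assoc ich)
  also have "\<dots> = ?q \<cdot> (\<ll> (A \<otimes>\<^sub>o A) \<cdot> \<aa> \<I> A A) \<cdot> (((\<epsilon> \<otimes>\<^sub>a \<ii> A) \<cdot> \<Delta>) \<otimes>\<^sub>a \<ii> A)"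
    by (subst lunit_nat) (simp_all add: assoc)
  also have "\<dots> = ?q"
    by (simp add: lunit_assc ich comult_counit_left)
  finally have "csnd B B \<cdot> shear S \<cdot> (\<ii> A \<otimes>\<^sub>a \<eta>) \<cdot> inv_arr C (\<rr> A) = ?q \<cdot> (\<ii> A \<otimes>\<^sub>a \<eta>) \<cdot> inv_arr C (\<rr> A)"
    by (rule comp_cong) simp_all
  also have "\<dots> = (\<mu> \<cdot> (\<ii> A \<otimes>\<^sub>a \<eta>)) \<cdot> (S \<otimes>\<^sub>a \<ii> \<I>) \<cdot> inv_arr C (\<rr> A)"
    by (simp add: ich assoc)
  also have "\<dots> = (\<rr> A \<cdot> (S \<otimes>\<^sub>a \<ii> \<I>)) \<cdot> inv_arr C (\<rr> A)"
    by (simp add: mult_unit_right assoc)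
  also have "\<dots> = S"
    by (simp add: runit_nat assoc)
  finally have "S = csnd B B \<cdot> shear S \<cdot> (\<ii> A \<otimes>\<^sub>a \<eta>) \<cdot> inv_arr C (\<rr> A)" ..
  then show ?thesis
    using chom_comp[OF chom_comp[OF chom_comp[OF 4 3] 2] chom_csnd] by simp
qed

section \<open>The abelian group of comonoid homomorphisms into a Hopf monoid\<close>

definition hom_group :: "('o, 'a) comonoid \<Rightarrow> 'a monoid" where
  "hom_group W = \<lparr>carrier = {f. chom W B f}, mult = conv W, one = \<eta> \<cdot> coun W\<rparr>"

lemma hom_group_simps [simp]:
  "f \<in> carrier (hom_group W) \<longleftrightarrow> chom W B f" "mult (hom_group W) = conv W" "one (hom_group W) = \<eta> \<cdot> coun W"
  by (simp_all add: hom_group_def)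

lemma chom_B_simps:
  assumes "chom W B f"
  shows "f \<in> Arr C" "Dom C f = cobj W" "Cod C f = A" "\<epsilon> \<cdot> f = coun W"
  using chom_simps[OF assms] by simp_all

lemma conv_inverse:
  assumes "chom W B f"
  shows "conv W (S \<cdot> f) f = \<eta> \<cdot> coun W"
proof -
  note [simp] = chom_B_simps[OF assms]
  have "conv W (S \<cdot> f) f = conv B S (\<ii> A) \<cdot> f"
    by (subst conv_comp[OF assms]) simp_all
  then show ?thesis
    by (simp add: conv_def antipode_left assoc)
qed

lemma comm_group_hom_group:
  assumes "comon W"
  shows "comm_group (hom_group W)"
proof (rule comm_groupI)
  fix f assume "f \<in> carrier (hom_group W)"
  then have f: "chom W B f" by simp
  show "\<exists>g\<in>carrier (hom_group W). g \<otimes>\<^bsub>hom_group W\<^esub> f = \<one>\<^bsub>hom_group W\<^esub>"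
    using f conv_inverse[OF f] chom_comp[OF f chom_antipode] by auto
  show "\<one>\<^bsub>hom_group W\<^esub> \<otimes>\<^bsub>hom_group W\<^esub> f = f"
    using chom_B_simps[OF f] assms by (simp add: conv_unit)
next
  fix f g assume "f \<in> carrier (hom_group W)" "g \<in> carrier (hom_group W)"
  then have f: "chom W B f" "chom W B g" by simp_all
  show "f \<otimes>\<^bsub>hom_group W\<^esub> g \<in> carrier (hom_group W)"
    using chom_conv[OF f] by simp
  show "f \<otimes>\<^bsub>hom_group W\<^esub> g = g \<otimes>\<^bsub>hom_group W\<^esub> f"
    using chom_B_simps[OF f(1)] chom_B_simps[OF f(2)] assms conv_commute by simp
next
  fix f g h assume "f \<in> carrier (hom_group W)" "g \<in> carrier (hom_group W)" "h \<in> carrier (hom_group W)"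
  then show "f \<otimes>\<^bsub>hom_group W\<^esub> g \<otimes>\<^bsub>hom_group W\<^esub> h = f \<otimes>\<^bsub>hom_group W\<^esub> (g \<otimes>\<^bsub>hom_group W\<^esub> h)"
    using assms chom_B_simps[of W f] chom_B_simps[of W g] chom_B_simps[of W h] conv_assoc by simp
next
  show "\<one>\<^bsub>hom_group W\<^esub> \<in> carrier (hom_group W)"
    using chom_comp[OF chom_coun[OF assms] chom_unit] by simp
qed

lemma group_hom_comp:
  assumes h: "chom V W h"
  shows "group_hom (hom_group W) (hom_group V) (\<lambda>f. f \<cdot> h)"
proof -
  note [simp] = chom_simps[OF h]
  interpret V: comm_group "hom_group V" by (simp add: comm_group_hom_group)
  interpret W: comm_group "hom_group W" by (simp add: comm_group_hom_group)
  show ?thesis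
    by unfold_locales
      (auto simp: hom_def chom_comp[OF h] conv_comp[OF h] chom_B_simps)
qed

end

section \<open>Integer matrices\<close>

definition dsum :: "int mat \<Rightarrow> int mat \<Rightarrow> int mat" where
  "dsum f g = four_block_mat f (0\<^sub>m (dim_row f) (dim_col g)) (0\<^sub>m (dim_row g) (dim_col f)) g"

definition swap_mat :: "nat \<Rightarrow> nat \<Rightarrow> int mat" where
  "swap_mat m n = four_block_mat (0\<^sub>m n m) (1\<^sub>m n) (1\<^sub>m m) (0\<^sub>m m n)"

text \<open>Giving the tensor product and the symmetry names of their own lets the simplifier use
  entry formulas instead of nested block matrices.\<close>

lemma MatZ_simps [simp]:
  "Obj MatZ = UNIV" "Arr MatZ = UNIV" "Dom MatZ = dim_col" "Cod MatZ = dim_row" "ide MatZ = 1\<^sub>m"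
  "arr_comp MatZ = (*)" "tensor_obj MatZ = (+)" "tensor_arr MatZ = dsum" "unit_obj MatZ = 0"
  "associator MatZ l m n = 1\<^sub>m (l + m + n)" "left_unitor MatZ = 1\<^sub>m" "right_unitor MatZ = 1\<^sub>m"
  "symmetry MatZ = swap_mat"
  by (simp_all add: MatZ_def dsum_def swap_mat_def fun_eq_iff)

lemma dsum_dim [simp]:
  "dim_row (dsum f g) = dim_row f + dim_row g" "dim_col (dsum f g) = dim_col f + dim_col g"
  by (simp_all add: dsum_def)

lemma dsum_index [simp]:
  assumes "i < dim_row f + dim_row g" "j < dim_col f + dim_col g"
  shows "dsum f g $$ (i, j) =
    (if i < dim_row f then if j < dim_col f then f $$ (i, j) else 0
     else if j < dim_col f then 0 else g $$ (i - dim_row f, j - dim_col f))"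
  using assms by (auto simp: dsum_def)

lemma swap_mat_dim [simp]: "dim_row (swap_mat m n) = n + m" "dim_col (swap_mat m n) = m + n"
  by (simp_all add: swap_mat_def)

lemma swap_mat_index [simp]:
  assumes "i < n + m" "j < m + n"
  shows "swap_mat m n $$ (i, j) = (if j = (if i < n then m + i else i - n) then 1 else 0)"
  using assms by (auto simp: swap_mat_def)

lemma one_mult_mat [simp]:
  "dim_row (A :: int mat) = n \<Longrightarrow> 1\<^sub>m n * A = A" "dim_col (A :: int mat) = n \<Longrightarrow> A * 1\<^sub>m n = A"
  by (auto intro: left_mult_one_mat[of _ _ "dim_col A"] right_mult_one_mat[of _ "dim_row A"])

lemma dsum_one [simp]: "dsum (1\<^sub>m m) (1\<^sub>m n) = 1\<^sub>m (m + n)"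
  by (rule eq_matI) auto

lemma dsum_assoc: "dsum (dsum f g) h = dsum f (dsum g h)"
proof (rule eq_matI)
  fix i j
  assume "i < dim_row (dsum f (dsum g h))" "j < dim_col (dsum f (dsum g h))"
  then have ij: "i < dim_row f + (dim_row g + dim_row h)" "j < dim_col f + (dim_col g + dim_col h)"
    by simp_all
  have "i - dim_row f < dim_row g \<longleftrightarrow> i < dim_row f + dim_row g" if "\<not> i < dim_row f"
    using that by linarith
  moreover have "j - dim_col f < dim_col g \<longleftrightarrow> j < dim_col f + dim_col g" if "\<not> j < dim_col f"
    using that by linarith
  ultimately show "dsum (dsum f g) h $$ (i, j) = dsum f (dsum g h) $$ (i, j)"
    using ij by (simp add: less_diff_conv2)
qed simp_all

lemma dsum_empty [simp]: "dsum (1\<^sub>m 0) f = f" "dsum f (1\<^sub>m 0) = f"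
  by (rule eq_matI; auto)+

lemma mult_mat_assoc:
  "dim_row (B :: int mat) = dim_col A \<Longrightarrow> dim_row D = dim_col B \<Longrightarrow> (A * B) * D = A * (B * D)"
  by (rule assoc_mult_mat[of A "dim_row A" "dim_col A" B "dim_col B" D "dim_col D"]) auto

lemma dsum_mult:
  assumes "dim_col g = dim_row f" "dim_col g' = dim_row f'"
  shows "dsum (g * f) (g' * f') = dsum g g' * dsum f f'"
proof -
  have [simp]: "f \<in> carrier_mat (dim_row f) (dim_col f)" "f' \<in> carrier_mat (dim_row f') (dim_col f')"
    "g \<in> carrier_mat (dim_row g) (dim_row f)" "g' \<in> carrier_mat (dim_row g') (dim_row f')"
    using assms by auto
  have [simp]: "g * f \<in> carrier_mat (dim_row g) (dim_col f)" "g' * f' \<in> carrier_mat (dim_row g') (dim_col f')"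
    by auto
  have gg: "dsum g g' = four_block_mat g (0\<^sub>m (dim_row g) (dim_row f')) (0\<^sub>m (dim_row g') (dim_row f)) g'"
    by (simp add: dsum_def assms)
  have "dsum g g' * dsum f f' = four_block_mat
      (g * f + 0\<^sub>m (dim_row g) (dim_row f') * 0\<^sub>m (dim_row f') (dim_col f))
      (g * 0\<^sub>m (dim_row f) (dim_col f') + 0\<^sub>m (dim_row g) (dim_row f') * f')
      (0\<^sub>m (dim_row g') (dim_row f) * f + g' * 0\<^sub>m (dim_row f') (dim_col f))
      (0\<^sub>m (dim_row g') (dim_row f) * 0\<^sub>m (dim_row f) (dim_col f') + g' * f')"
    unfolding dsum_def[of f] gg
    by (rule mult_four_block_mat[where ?n1.0 = "dim_row f" and ?nr2.0 = "dim_row g'"]) (auto simp: assms)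
  moreover have "g * 0\<^sub>m (dim_row f) (dim_col f') = 0\<^sub>m (dim_row g) (dim_col f')"
    "g' * 0\<^sub>m (dim_row f') (dim_col f) = 0\<^sub>m (dim_row g') (dim_col f)"
    by (rule right_mult_zero_mat, simp)+
  ultimately show ?thesis
    by (simp add: dsum_def)
qed

text \<open>A row with a single entry 1 in column \<open>p\<close> selects row \<open>p\<close> of
  the other factor, so products with permutation matrices are computed by reindexing, without
  sums.\<close>

lemma row_delta_mult:
  assumes "i < dim_row A" "j < dim_col M" "dim_row M = dim_col A" "p < dim_col A"
    "\<And>k. k < dim_col A \<Longrightarrow> A $$ (i, k) = (if k = p then 1 else 0)"
  shows "(A * M) $$ (i, j) = (M $$ (p, j) :: int)"
proof -
  have "(A * M) $$ (i, j) = (\<Sum>k<dim_col A. A $$ (i, k) * M $$ (k, j))"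
    using assms by (simp add: scalar_prod_def lessThan_atLeast0)
  also have "\<dots> = (\<Sum>k<dim_col A. if k = p then M $$ (k, j) else 0)"
    using assms by (intro sum.cong) auto
  finally show ?thesis
    using assms by simp
qed

lemma swap_mat_mult:
  assumes "dim_row M = m + n" "i < n + m" "j < dim_col M"
  shows "(swap_mat m n * M) $$ (i, j) = M $$ (if i < n then m + i else i - n, j)"
  using assms by (intro row_delta_mult) auto

lemma col_delta_mult:
  assumes "i < dim_row M" "j < dim_col A" "dim_col M = dim_row A" "p < dim_row A"
    "\<And>k. k < dim_row A \<Longrightarrow> A $$ (k, j) = (if k = p then 1 else 0)"
  shows "(M * A) $$ (i, j) = (M $$ (i, p) :: int)"
proof -
  have "(M * A) $$ (i, j) = (\<Sum>k<dim_row A. M $$ (i, k) * A $$ (k, j))"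
    using assms by (simp add: scalar_prod_def lessThan_atLeast0)
  also have "\<dots> = (\<Sum>k<dim_row A. if k = p then M $$ (i, k) else 0)"
    using assms by (intro sum.cong) auto
  finally show ?thesis
    using assms by simp
qed

lemma mult_swap_mat:
  assumes "dim_col M = n + m" "j < m + n" "i < dim_row M"
  shows "(M * swap_mat m n) $$ (i, j) = M $$ (i, if j < m then n + j else j - m)"
  using assms by (intro col_delta_mult) auto

lemma swap_mat_natural: "swap_mat (dim_row f) (dim_row g) * dsum f g = dsum g f * swap_mat (dim_col f) (dim_col g)"
  by (rule eq_matI) (auto simp: swap_mat_mult mult_swap_mat simp del: index_mult_mat(1))

lemma swap_mat_inverse: "swap_mat n m * swap_mat m n = 1\<^sub>m (m + n)"
  by (rule eq_matI) (auto simp: swap_mat_mult simp del: index_mult_mat(1))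

lemma swap_mat_hexagon:
  "swap_mat a (b + c) = dsum (1\<^sub>m b) (swap_mat a c) * dsum (swap_mat a b) (1\<^sub>m c)"
proof (rule eq_matI)
  fix i j
  assume "i < dim_row (dsum (1\<^sub>m b) (swap_mat a c) * dsum (swap_mat a b) (1\<^sub>m c))"
    "j < dim_col (dsum (1\<^sub>m b) (swap_mat a c) * dsum (swap_mat a b) (1\<^sub>m c))"
  then have ij: "i < b + (c + a)" "j < a + b + c" by simp_all
  \<comment> \<open>The column of the only 1 in row \<open>i\<close> of the left factor: fixed in
    the first block, shifted by \<open>a\<close> in the second, moved back by \<open>c\<close> in
    the third.\<close>
  let ?p = "if i < b then i else if i < b + c then a + i else i - c"
  have "(dsum (1\<^sub>m b) (swap_mat a c) * dsum (swap_mat a b) (1\<^sub>m c)) $$ (i, j) = dsum (swap_mat a b) (1\<^sub>m c) $$ (?p, j)"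
    using ij by (intro row_delta_mult) auto
  moreover have "swap_mat a (b + c) $$ (i, j) = dsum (swap_mat a b) (1\<^sub>m c) $$ (?p, j)"
  proof (cases "i < b")
    case True
    then show ?thesis using ij by simp
  next
    case False
    show ?thesis
    proof (cases "i < b + c")
      case True
      with False have "a + i - (b + a) < c" "\<not> a + i < b + a" "a + i < b + a + c"
        by linarith+
      then show ?thesis using ij True False by (simp; linarith?)
    next
      case F: False
      with ij have "i - c < b + a" "\<not> i - c < b" "i - c - b = i - (b + c)"
        by linarith+
      then show ?thesis using ij False F by (simp; linarith?)
    qed
  qed
  ultimately show "swap_mat a (b + c) $$ (i, j) = (dsum (1\<^sub>m b) (swap_mat a c) * dsum (swap_mat a b) (1\<^sub>m c)) $$ (i, j)"
    by simp
qed simp_all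

interpretation MatZ_category: category MatZ
  by unfold_locales (auto simp: mult_mat_assoc)

lemma iso_one_mat [simp]: "iso_arr MatZ (1\<^sub>m n)"
  using MatZ_category.iso_ide[of n] by simp

interpretation MatZ: symmetric_monoidal_category MatZ
  by unfold_locales
    (auto simp: dsum_mult dsum_assoc swap_mat_natural swap_mat_inverse swap_mat_hexagon add.assoc)

lemma prop_category_MatZ: "prop_category MatZ"
  by unfold_locales simp_all

section \<open>Generation of all integer matrices\<close>

lemma dsum_zero [simp]: "dsum (0\<^sub>m m n) (0\<^sub>m m' n') = 0\<^sub>m (m + m') (n + n')"
  by (rule eq_matI) auto

text \<open>The diagonal: two identity matrices on top of each other. It stacks matrices, because
  \<open>dsum M N * dup_mat n\<close> is \<open>M\<close> above \<open>N\<close> when both have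
  \<open>n\<close> columns.\<close>

definition dup_mat :: "nat \<Rightarrow> int mat" where
  "dup_mat n = mat (n + n) n (\<lambda>(i, j). if i = j \<or> i = n + j then 1 else 0)"

lemma dup_mat_dim [simp]: "dim_row (dup_mat n) = n + n" "dim_col (dup_mat n) = n"
  by (simp_all add: dup_mat_def)

lemma mult_dup_mat:
  assumes "i < dim_row M" "j < n" "dim_col M = n + n"
  shows "(M * dup_mat n) $$ (i, j) = M $$ (i, j) + M $$ (i, n + j)"
proof -
  have "(M * dup_mat n) $$ (i, j) = (\<Sum>k<n + n. M $$ (i, k) * dup_mat n $$ (k, j))"
    using assms by (simp add: scalar_prod_def lessThan_atLeast0)
  also have "\<dots> = (\<Sum>k<n + n. (if k = j then M $$ (i, k) else 0) + (if k = n + j then M $$ (i, k) else 0))"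
    using assms by (intro sum.cong) (auto simp: dup_mat_def)
  finally show ?thesis
    using assms by (simp add: sum.distrib)
qed

text \<open>Duplicating \<open>n + 1\<close> inputs is duplicating the first \<open>n\<close> and
  the last one separately, and then moving a copy of the last input in front of the second
  block.\<close>

lemma dup_mat_Suc:
  "dup_mat (Suc n) = dsum (1\<^sub>m n) (dsum (swap_mat n 1) (1\<^sub>m 1)) * dsum (dup_mat n) (mat 2 1 (\<lambda>_. 1))"
  (is "_ = ?A * ?B")
proof (rule eq_matI)
  fix i j
  assume "i < dim_row (?A * ?B)" "j < dim_col (?A * ?B)"
  then have ij: "i < Suc n + Suc n" "j < Suc n" by simp_all
  \<comment> \<open>Row \<open>n\<close> of the result is the first copy of the last input, which
    \<open>?B\<close> puts in row \<open>n + n\<close>; the second copies of the other inputs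
    therefore move down by one.\<close>
  let ?p = "if i < n then i else if i = n then n + n else if i < n + n + 1 then i - 1 else i"
  have "(?A * ?B) $$ (i, j) = ?B $$ (?p, j)"
    using ij by (intro row_delta_mult) auto
  also have "\<dots> = dup_mat (Suc n) $$ (i, j)"
    using ij by (auto simp: dup_mat_def)
  finally show "dup_mat (Suc n) $$ (i, j) = (?A * ?B) $$ (i, j)" ..
qed simp_all

abbreviation "gen_add \<equiv> mat 1 2 (\<lambda>_. 1) :: int mat"
abbreviation "gen_zero \<equiv> 0\<^sub>m 1 0 :: int mat"
abbreviation "gen_copy \<equiv> mat 2 1 (\<lambda>_. 1) :: int mat"
abbreviation "gen_del \<equiv> 0\<^sub>m 0 1 :: int mat"
abbreviation "gen_neg \<equiv> mat 1 1 (\<lambda>_. -1) :: int mat"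

text \<open>The axioms of a bicommutative Hopf monoid for the object 1 of \<open>MatZ\<close>, with
  identity associators and unitors omitted. The right counit law will come from
  \<open>comonI\<close>.\<close>

lemma gen_identities:
  "gen_add * dsum gen_add (1\<^sub>m 1) = gen_add * dsum (1\<^sub>m 1) gen_add"
  "gen_add * dsum gen_zero (1\<^sub>m 1) = 1\<^sub>m 1"
  "gen_add * dsum (1\<^sub>m 1) gen_zero = 1\<^sub>m 1"
  "gen_add * swap_mat 1 1 = gen_add"
  "dsum gen_copy (1\<^sub>m 1) * gen_copy = dsum (1\<^sub>m 1) gen_copy * gen_copy"
  "dsum gen_del (1\<^sub>m 1) * gen_copy = 1\<^sub>m 1"
  "swap_mat 1 1 * gen_copy = gen_copy"
  "gen_copy * gen_add = dsum gen_add gen_add *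
    (dsum (1\<^sub>m 1) (dsum (swap_mat 1 1) (1\<^sub>m 1)) * dsum gen_copy gen_copy)"
  "gen_copy * gen_zero = dsum gen_zero gen_zero"
  "gen_del * gen_add = dsum gen_del gen_del"
  "gen_del * gen_zero = 1\<^sub>m 0"
  "gen_add * (dsum gen_neg (1\<^sub>m 1) * gen_copy) = gen_zero * gen_del"
  "gen_add * (dsum (1\<^sub>m 1) gen_neg * gen_copy) = gen_zero * gen_del"
  by (rule eq_matI; auto simp: scalar_prod_def numeral_eq_Suc less_Suc_eq)+

text \<open>Duplicating the inputs stacks rows, a row is a sum of scalars applied to separate
  inputs, a positive scalar is an iterated sum of ones, and \<open>gen_neg\<close> supplies the
  sign. A property closed under composition and block sums thus has to be checked only on
  identities, swaps and five matrices.\<close>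

lemma mat_induct [case_names mult dsum one swap add zero dup del neg]:
  fixes M :: "int mat"
  assumes mult: "\<And>f g. P f \<Longrightarrow> P g \<Longrightarrow> dim_col g = dim_row f \<Longrightarrow> P (g * f)"
    and dsum: "\<And>f g. P f \<Longrightarrow> P g \<Longrightarrow> P (dsum f g)"
    and one: "\<And>n. P (1\<^sub>m n)" and swap: "\<And>m n. P (swap_mat m n)"
    and add: "P gen_add" and zero: "P gen_zero" and dup: "P gen_copy" and del: "P gen_del" and neg: "P gen_neg"
  shows "P M"
proof -
  have nat: "P (mat 1 1 (\<lambda>_. int n))" for n
  proof (induction n)
    case 0
    have "mat 1 1 (\<lambda>_. int 0) = gen_zero * gen_del"
      by (rule eq_matI) (auto simp: scalar_prod_def)
    then show ?case
      using mult[OF del zero] by simp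
  next
    case (Suc n)
    \<comment> \<open>The scalar \<open>n + 1\<close> copies \<open>x\<close>, multiplies one copy
      by \<open>n\<close> and adds the two: \<open>n x + x\<close>.\<close>
    have "mat 1 1 (\<lambda>_. int (Suc n)) = gen_add * (dsum (mat 1 1 (\<lambda>_. int n)) (1\<^sub>m 1) * gen_copy)"
      by (rule eq_matI) (auto simp: scalar_prod_def numeral_2_eq_2)
    moreover have "P (dsum (mat 1 1 (\<lambda>_. int n)) (1\<^sub>m 1) * gen_copy)"
      by (rule mult[OF dup dsum[OF Suc one]]) simp
    ultimately show ?case
      using mult[OF _ add] by simp
  qed
  have scal: "P (mat 1 1 (\<lambda>_. z))" for z
  proof (cases "z \<ge> 0")
    case True
    then show ?thesis using nat[of "nat z"] by simp
  next
    case False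
    have "mat 1 1 (\<lambda>_. z) = gen_neg * mat 1 1 (\<lambda>_. int (nat (- z)))"
      using False by (intro eq_matI) (auto simp: scalar_prod_def)
    moreover have "P (gen_neg * mat 1 1 (\<lambda>_. int (nat (- z))))"
      by (rule mult[OF nat neg]) simp
    ultimately show ?thesis by (simp only:)
  qed
  have row: "P M" if "dim_row M = 1" for M
    using that
  proof (induction "dim_col M" arbitrary: M)
    case 0
    then have "M = 0\<^sub>m 1 0"
      by (intro eq_matI) auto
    then show ?case using zero by simp
  next
    case (Suc n)
    let ?N = "mat 1 n (\<lambda>(i, j). M $$ (0, j))" and ?s = "mat 1 1 (\<lambda>_. M $$ (0, n))"
    \<comment> \<open>The last column is split off: the row sends an input \<open>(v, y)\<close> to
      \<open>?N v + ?s y\<close>.\<close>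
    have "M = gen_add * dsum ?N ?s"
      using Suc.prems Suc.hyps(2)[symmetric]
      by (intro eq_matI) (auto simp: scalar_prod_def numeral_2_eq_2 less_Suc_eq)
    moreover have "P (dsum ?N ?s)"
      using Suc.hyps(1)[of ?N] scal by (intro dsum) auto
    ultimately show ?case
      using mult[OF _ add, of "dsum ?N ?s"] by simp
  qed
  have dups: "P (dup_mat n)" for n
  proof (induction n)
    case 0
    have "dup_mat 0 = 1\<^sub>m 0" by (rule eq_matI) auto
    then show ?case using one by simp
  next
    case (Suc n)
    show ?case
      unfolding dup_mat_Suc
      by (rule mult[OF dsum[OF Suc dup] dsum[OF one dsum[OF swap one]]]) simp
  qed
  show ?thesis
  proof (induction "dim_row M" arbitrary: M)
    case 0
    have "P (0\<^sub>m 0 n)" for n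
    proof (induction n)
      case 0
      have "(0\<^sub>m 0 0 :: int mat) = 1\<^sub>m 0" by (rule eq_matI) auto
      then show ?case using one by simp
    next
      case (Suc n)
      then show ?case using dsum[OF Suc del] by simp
    qed
    moreover have "M = 0\<^sub>m 0 (dim_col M)"
      using 0 by (intro eq_matI) auto
    ultimately show ?case by metis
  next
    case (Suc m)
    let ?n = "dim_col M"
    let ?M = "mat m ?n (\<lambda>(i, j). M $$ (i, j))" and ?r = "mat 1 ?n (\<lambda>(i, j). M $$ (m, j))"
    \<comment> \<open>\<open>dup_mat\<close> feeds the same input to the first \<open>m\<close> rows
      and to the last row.\<close>
    have "M = dsum ?M ?r * dup_mat ?n"
      using Suc.hyps(2)[symmetric] by (intro eq_matI) (auto simp: mult_dup_mat less_Suc_eq simp del: index_mult_mat(1))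
    moreover have "P (dsum ?M ?r)"
      using Suc.hyps(1)[of ?M] row[of ?r] by (intro dsum) auto
    ultimately show ?case
      using mult[OF dups, of "dsum ?M ?r" ?n] by simp
  qed
qed

section \<open>The algebra of a Hopf monoid\<close>

context hopf_object
begin

abbreviation P where "P \<equiv> cpow B"
abbreviation p where "p \<equiv> proj B"
abbreviation comb where "comb W \<equiv> int_comb (hom_group W)"

lemma proj_simps [simp]:
  assumes "i < n"
  shows "p n i \<in> Arr C" "Dom C (p n i) = cobj (P n)" "Cod C (p n i) = A"
  using chom_B_simps[OF chom_proj[OF comon_B assms]] by simp_all

lemma chom_comb:
  assumes "comon W" "\<And>i. i < n \<Longrightarrow> chom W B (x i)"
  shows "chom W B (comb W n r x)"
proof -
  interpret W: comm_group "hom_group W" by (rule comm_group_hom_group[OF assms(1)])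
  show ?thesis
    using W.int_comb_closed[of n x r] assms(2) by simp
qed

lemma comb_comp:
  assumes h: "chom V W h" and x: "\<And>i. i < n \<Longrightarrow> chom W B (x i)"
  shows "comb W n r x \<cdot> h = comb V n r (\<lambda>i. x i \<cdot> h)"
proof -
  interpret h: group_hom "hom_group W" "hom_group V" "\<lambda>f. f \<cdot> h" by (rule group_hom_comp[OF h])
  show ?thesis
    by (rule h.hom_int_comb) (simp add: x)
qed

lemma comb_delta:
  assumes "comon W" "i < n" "\<And>i. i < n \<Longrightarrow> chom W B (x i)" "\<And>j. j < n \<Longrightarrow> r j = (if j = i then 1 else 0)"
  shows "comb W n r x = x i"
proof -
  interpret W: comm_group "hom_group W" by (rule comm_group_hom_group[OF assms(1)])
  have "comb W n r x = comb W n (\<lambda>j. if j = i then 1 else 0) x"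
    using assms(4) by (intro int_comb_cong) simp_all
  also have "\<dots> = x i"
    using assms(2,3) by (intro W.int_comb_delta) simp_all
  finally show ?thesis .
qed

section \<open>The action of matrices on powers of a Hopf monoid\<close>

definition marr :: "int mat \<Rightarrow> 'a" where
  "marr M = tuple (P (dim_col M)) (dim_row M)
     (\<lambda>i. comb (P (dim_col M)) (dim_col M) (\<lambda>j. M $$ (i, j)) (p (dim_col M)))"

lemma chom_marr: "dim_col M = n \<Longrightarrow> dim_row M = m \<Longrightarrow> chom (P n) (P m) (marr M)"
  unfolding marr_def by (auto intro!: chom_tuple chom_comb chom_proj)

lemma marr_simps [simp]:
  "marr M \<in> Arr C" "Dom C (marr M) = cobj (P (dim_col M))" "Cod C (marr M) = cobj (P (dim_row M))"
  using chom_simps[OF chom_marr[OF refl refl, of M]] by simp_all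

lemma proj_marr_ide:
  "i < dim_row M \<Longrightarrow> p (dim_row M) i \<cdot> marr M = comb (P (dim_col M)) (dim_col M) (\<lambda>j. M $$ (i, j)) (p (dim_col M))"
  unfolding marr_def by (intro proj_tuple) (auto intro!: chom_comb chom_proj)

lemma proj_marr:
  assumes "i < dim_row M" "chom W (P (dim_col M)) h"
  shows "p (dim_row M) i \<cdot> marr M \<cdot> h = comb W (dim_col M) (\<lambda>j. M $$ (i, j)) (\<lambda>j. p (dim_col M) j \<cdot> h)"
proof -
  note [simp] = chom_simps[OF assms(2)]
  have "p (dim_row M) i \<cdot> marr M = comb (P (dim_col M)) (dim_col M) (\<lambda>j. M $$ (i, j)) (p (dim_col M))"
    by (rule proj_marr_ide[OF assms(1)])
  then have "p (dim_row M) i \<cdot> marr M \<cdot> h = comb (P (dim_col M)) (dim_col M) (\<lambda>j. M $$ (i, j)) (p (dim_col M)) \<cdot> h"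
    by (rule comp_cong) (use assms(1) in simp_all)
  also have "\<dots> = comb W (dim_col M) (\<lambda>j. M $$ (i, j)) (\<lambda>j. p (dim_col M) j \<cdot> h)"
    by (rule comb_comp[OF assms(2)]) (simp add: chom_proj)
  finally show ?thesis .
qed

lemma marr_one: "marr (1\<^sub>m n) = \<ii> (cobj (P n))"
proof (rule cpow_ext[of "P n" B n])
  show "p n i \<cdot> marr (1\<^sub>m n) = p n i \<cdot> \<ii> (cobj (P n))" if "i < n" for i
    using proj_marr_ide[of i "1\<^sub>m n"] that by (simp add: comb_delta[where i = i] chom_proj)
qed (simp_all add: chom_marr)

text \<open>Component \<open>i\<close> is the combination given by row \<open>i\<close> of
  \<open>M\<close> of the combinations given by the rows of \<open>N\<close>.
  \<open>int_comb_comb\<close> evaluates it to row \<open>i\<close> of the matrix product.\<close>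

lemma marr_mult:
  assumes "dim_col M = dim_row N"
  shows "marr (M * N) = marr M \<cdot> marr N"
proof (rule cpow_ext[of "P (dim_col N)" B "dim_row M"])
  fix i assume i: "i < dim_row M"
  let ?W = "P (dim_col N)"
  interpret W: comm_group "hom_group ?W" by (rule comm_group_hom_group) simp
  have N: "chom ?W (P (dim_col M)) (marr N)"
    by (rule chom_marr) (simp_all add: assms)
  have "p (dim_row M) i \<cdot> marr M \<cdot> marr N = comb ?W (dim_col M) (\<lambda>j. M $$ (i, j)) (\<lambda>j. p (dim_col M) j \<cdot> marr N)"
    by (rule proj_marr[OF i N])
  also have "\<dots> = comb ?W (dim_col M) (\<lambda>j. M $$ (i, j)) (\<lambda>j. comb ?W (dim_col N) (\<lambda>k. N $$ (j, k)) (p (dim_col N)))"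
    by (rule int_comb_cong) (simp_all add: assms proj_marr_ide)
  also have "\<dots> = comb ?W (dim_col N) (\<lambda>k. \<Sum>j<dim_col M. M $$ (i, j) * N $$ (j, k)) (p (dim_col N))"
    by (rule W.int_comb_comb) (simp add: chom_proj)
  also have "\<dots> = comb ?W (dim_col N) (\<lambda>k. (M * N) $$ (i, k)) (p (dim_col N))"
    using i assms by (intro int_comb_cong) (simp_all add: scalar_prod_def lessThan_atLeast0)
  also have "\<dots> = p (dim_row M) i \<cdot> marr (M * N)"
    using proj_marr_ide[of i "M * N"] i by simp
  finally show "p (dim_row M) i \<cdot> marr (M * N) = p (dim_row M) i \<cdot> marr M \<cdot> marr N" ..
qed (auto intro!: chom_marr chom_comp[OF chom_marr chom_marr] assms)

section \<open>Concatenation of powers as the monoidal structure\<close>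

definition pmult where
  "pmult m n = tuple (ctens (P m) (P n)) (m + n)
     (\<lambda>k. if k < m then p m k \<cdot> cfst (P m) (P n) else p n (k - m) \<cdot> csnd (P m) (P n))"

definition psplit where
  "psplit m n = cpair (P (m + n)) (tuple (P (m + n)) m (p (m + n))) (tuple (P (m + n)) n (\<lambda>k. p (m + n) (m + k)))"

lemma chom_pmult: "chom (ctens (P m) (P n)) (P (m + n)) (pmult m n)"
  unfolding pmult_def
  by (rule chom_tuple) (auto intro!: chom_comp[OF chom_cfst chom_proj] chom_comp[OF chom_csnd chom_proj])

lemma pmult_simps [simp]:
  "pmult m n \<in> Arr C" "Dom C (pmult m n) = cobj (P m) \<otimes>\<^sub>o cobj (P n)" "Cod C (pmult m n) = cobj (P (m + n))"
  using chom_simps[OF chom_pmult] by simp_all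

text \<open>Concatenation is specified by components instead of a recursion through associators. The
  coherence lemmas below use this description together with the fact that \<open>pmult\<close> is a
  comonoid homomorphism.\<close>

lemma proj_pmult:
  assumes "k < m + n"
  shows "p (m + n) k \<cdot> pmult m n = (if k < m then p m k \<cdot> cfst (P m) (P n) else p n (k - m) \<cdot> csnd (P m) (P n))"
  unfolding pmult_def
  by (rule proj_tuple) (use assms in \<open>auto intro!: chom_comp[OF chom_cfst chom_proj] chom_comp[OF chom_csnd chom_proj]\<close>)

lemma proj_pmult_comp:
  assumes "k < m + n" "h \<in> Arr C" "Cod C h = cobj (P m) \<otimes>\<^sub>o cobj (P n)"
  shows "p (m + n) k \<cdot> pmult m n \<cdot> h
    = (if k < m then p m k \<cdot> cfst (P m) (P n) \<cdot> h else p n (k - m) \<cdot> csnd (P m) (P n) \<cdot> h)"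
  using comp_cong[OF proj_pmult[OF assms(1)]] assms by (simp add: assoc)

lemma chom_psplit_aux:
  "chom (P (m + n)) (P m) (tuple (P (m + n)) m (p (m + n)))"
  "chom (P (m + n)) (P n) (tuple (P (m + n)) n (\<lambda>k. p (m + n) (m + k)))"
  by (auto intro!: chom_tuple chom_proj)

lemma chom_psplit: "chom (P (m + n)) (ctens (P m) (P n)) (psplit m n)"
  unfolding psplit_def by (rule chom_cpair[OF chom_psplit_aux])

lemma inverse_pmult: "inverse_arrows C (pmult m n) (psplit m n)"
proof -
  note [simp] = chom_simps[OF chom_psplit[of m n]]
  have 1: "pmult m n \<cdot> psplit m n = \<ii> (cobj (P (m + n)))"
  proof (rule cpow_ext[of "P (m + n)" B "m + n"])
    fix i assume i: "i < m + n"
    show "p (m + n) i \<cdot> pmult m n \<cdot> psplit m n = p (m + n) i \<cdot> \<ii> (cobj (P (m + n)))"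
    proof (cases "i < m")
      case True
      then have "p m i \<cdot> tuple (P (m + n)) m (p (m + n)) = p (m + n) i"
        by (intro proj_tuple) (auto intro: chom_proj)
      then show ?thesis
        using True i cfst_cpair[OF chom_psplit_aux] by (simp add: proj_pmult_comp psplit_def[symmetric])
    next
      case False
      then have "p n (i - m) \<cdot> tuple (P (m + n)) n (\<lambda>k. p (m + n) (m + k)) = p (m + n) (m + (i - m))"
        using i by (intro proj_tuple) (auto intro: chom_proj)
      then show ?thesis
        using False i csnd_cpair[OF chom_psplit_aux] by (simp add: proj_pmult_comp psplit_def[symmetric])
    qed
  qed (auto intro: chom_comp[OF chom_psplit chom_pmult])
  have 2: "psplit m n \<cdot> pmult m n = \<ii> (cobj (P m) \<otimes>\<^sub>o cobj (P n))"
  proof (rule cprod_ext[of "ctens (P m) (P n)" "P m" "P n"])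
    let ?W = "ctens (P m) (P n)"
    have a: "cfst (P m) (P n) \<cdot> psplit m n = tuple (P (m + n)) m (p (m + n))"
      unfolding psplit_def by (rule cfst_cpair[OF chom_psplit_aux])
    have b: "csnd (P m) (P n) \<cdot> psplit m n = tuple (P (m + n)) n (\<lambda>k. p (m + n) (m + k))"
      unfolding psplit_def by (rule csnd_cpair[OF chom_psplit_aux])
    note [simp] = chom_simps[OF chom_psplit_aux(1)[of m n]] chom_simps[OF chom_psplit_aux(2)[of m n]]
    have "tuple (P (m + n)) m (p (m + n)) \<cdot> pmult m n = cfst (P m) (P n)"
    proof (rule cpow_ext[of ?W B m])
      fix i assume i: "i < m"
      have "p m i \<cdot> tuple (P (m + n)) m (p (m + n)) = p (m + n) i"
        using i by (intro proj_tuple) (auto intro: chom_proj)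
      from comp_cong[OF this, of "pmult m n"]
      show "p m i \<cdot> tuple (P (m + n)) m (p (m + n)) \<cdot> pmult m n = p m i \<cdot> cfst (P m) (P n)"
        using i by (simp add: proj_pmult)
    qed (auto intro: chom_comp[OF chom_pmult chom_psplit_aux(1)])
    then show "cfst (P m) (P n) \<cdot> psplit m n \<cdot> pmult m n = cfst (P m) (P n) \<cdot> \<ii> (cobj (P m) \<otimes>\<^sub>o cobj (P n))"
      by (simp add: comp_cong[OF a])
    have "tuple (P (m + n)) n (\<lambda>k. p (m + n) (m + k)) \<cdot> pmult m n = csnd (P m) (P n)"
    proof (rule cpow_ext[of ?W B n])
      fix i assume i: "i < n"
      have "p n i \<cdot> tuple (P (m + n)) n (\<lambda>k. p (m + n) (m + k)) = p (m + n) (m + i)"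
        using i by (intro proj_tuple) (auto intro: chom_proj)
      from comp_cong[OF this, of "pmult m n"]
      show "p n i \<cdot> tuple (P (m + n)) n (\<lambda>k. p (m + n) (m + k)) \<cdot> pmult m n = p n i \<cdot> csnd (P m) (P n)"
        using i by (simp add: proj_pmult)
    qed (auto intro: chom_comp[OF chom_pmult chom_psplit_aux(2)])
    then show "csnd (P m) (P n) \<cdot> psplit m n \<cdot> pmult m n = csnd (P m) (P n) \<cdot> \<ii> (cobj (P m) \<otimes>\<^sub>o cobj (P n))"
      by (simp add: comp_cong[OF b])
  qed (auto intro: chom_comp[OF chom_pmult chom_psplit])
  show ?thesis
    using 1 2 by (simp add: inverse_arrows_def)
qed

lemma iso_pmult [simp]: "iso_arr C (pmult m n)"
  unfolding iso_arr_def by (rule exI) (rule inverse_pmult)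

lemma pmult_natural:
  "pmult (dim_row M) (dim_row N) \<cdot> (marr M \<otimes>\<^sub>a marr N) = marr (dsum M N) \<cdot> pmult (dim_col M) (dim_col N)"
proof (rule cpow_ext[of _ B "dim_row M + dim_row N"])
  define m m' n n' where dims: "m = dim_col M" "m' = dim_row M" "n = dim_col N" "n' = dim_row N"
  let ?W = "ctens (P m) (P n)"
  have MN: "chom ?W (ctens (P m') (P n')) (marr M \<otimes>\<^sub>a marr N)"
    by (rule chom_tensor) (simp_all add: chom_marr dims)
  have D: "chom (P (m + n)) (P (m' + n')) (marr (dsum M N))"
    by (rule chom_marr) (simp_all add: dims)
  show "chom ?W (P (dim_row M + dim_row N)) (pmult (dim_row M) (dim_row N) \<cdot> (marr M \<otimes>\<^sub>a marr N))"
    using chom_comp[OF MN chom_pmult] by (simp add: dims)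
  show "chom ?W (P (dim_row M + dim_row N)) (marr (dsum M N) \<cdot> pmult (dim_col M) (dim_col N))"
    using chom_comp[OF chom_pmult D] by (simp add: dims)
  interpret W: comm_group "hom_group ?W" by (rule comm_group_hom_group) simp
  fix i assume i: "i < dim_row M + dim_row N"
  have p: "chom ?W B (p (m + n) j \<cdot> pmult m n)" if "j < m + n" for j
    by (rule chom_comp[OF chom_pmult chom_proj]) (simp_all add: that)
  have "p (m' + n') i \<cdot> marr (dsum M N) \<cdot> pmult m n = comb ?W (m + n) (\<lambda>j. dsum M N $$ (i, j)) (\<lambda>j. p (m + n) j \<cdot> pmult m n)"
    using proj_marr[of i "dsum M N" ?W "pmult m n"] chom_pmult[of m n] i by (simp add: dims)
  \<comment> \<open>Row \<open>i\<close> of a block sum is cut after the first \<open>m\<close>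
    columns. One of the two pieces has only zero coefficients and contributes the neutral element;
    which piece depends on the block containing \<open>i\<close>.\<close>
  also have "\<dots> = conv ?W (comb ?W m (\<lambda>j. dsum M N $$ (i, j)) (\<lambda>j. p (m + n) j \<cdot> pmult m n))
      (comb ?W n (\<lambda>j. dsum M N $$ (i, m + j)) (\<lambda>j. p (m + n) (m + j) \<cdot> pmult m n))" (is "_ = conv ?W ?x ?y")
    using p by (subst W.int_comb_append) simp_all
  finally have r: "p (m' + n') i \<cdot> marr (dsum M N) \<cdot> pmult m n = conv ?W ?x ?y" .
  have xy: "?x \<in> carrier (hom_group ?W)" "?y \<in> carrier (hom_group ?W)"
    using p by (simp_all add: chom_comb)
  show "p (dim_row M + dim_row N) i \<cdot> pmult (dim_row M) (dim_row N) \<cdot> (marr M \<otimes>\<^sub>a marr N)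
      = p (dim_row M + dim_row N) i \<cdot> marr (dsum M N) \<cdot> pmult (dim_col M) (dim_col N)"
  proof (cases "i < m'")
    case True
    have "?y = \<one>\<^bsub>hom_group ?W\<^esub>"
      using True i by (intro W.int_comb_zero) (simp add: dims)
    then have "conv ?W ?x ?y = ?x"
      using W.r_one[OF xy(1)] by simp
    also have "?x = comb ?W m (\<lambda>j. M $$ (i, j)) (\<lambda>j. p m j \<cdot> cfst (P m) (P n))"
      using True i by (intro int_comb_cong) (simp_all add: dims proj_pmult)
    also have "\<dots> = p m' i \<cdot> marr M \<cdot> cfst (P m) (P n)"
      using proj_marr[of i M ?W "cfst (P m) (P n)"] True by (simp add: dims)
    also have "marr M \<cdot> cfst (P m) (P n) = cfst (P m') (P n') \<cdot> (marr M \<otimes>\<^sub>a marr N)"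
      by (rule cfst_tensor[symmetric]) (simp_all add: chom_marr dims)
    finally show ?thesis
      using r i True by (simp add: proj_pmult_comp dims)
  next
    case False
    have "?x = \<one>\<^bsub>hom_group ?W\<^esub>"
      using False i by (intro W.int_comb_zero) (simp add: dims)
    then have "conv ?W ?x ?y = ?y"
      using W.l_one[OF xy(2)] by simp
    also have "?y = comb ?W n (\<lambda>j. N $$ (i - m', j)) (\<lambda>j. p n j \<cdot> csnd (P m) (P n))"
      using False i by (intro int_comb_cong) (simp_all add: dims proj_pmult)
    also have "\<dots> = p n' (i - m') \<cdot> marr N \<cdot> csnd (P m) (P n)"
      using proj_marr[of "i - m'" N ?W "csnd (P m) (P n)"] False i by (simp add: dims)
    also have "marr N \<cdot> csnd (P m) (P n) = csnd (P m') (P n') \<cdot> (marr M \<otimes>\<^sub>a marr N)"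
      by (rule csnd_tensor[symmetric]) (simp_all add: chom_marr dims)
    finally show ?thesis
      using r i False by (simp add: proj_pmult_comp dims)
  qed
qed simp_all

text \<open>Both sides concatenate three tuples. Component \<open>i\<close> lies in the first,
  second or third one, and the projections of the associator match the two descriptions in each
  range.\<close>

lemma pmult_assoc:
  "pmult (l + m) n \<cdot> (pmult l m \<otimes>\<^sub>a \<ii> (cobj (P n)))
    = pmult l (m + n) \<cdot> (\<ii> (cobj (P l)) \<otimes>\<^sub>a pmult m n) \<cdot> \<aa> (cobj (P l)) (cobj (P m)) (cobj (P n))"
  (is "?L = ?R")
proof (rule cpow_ext[of _ B "l + m + n"])
  let ?W = "ctens (ctens (P l) (P m)) (P n)"
  have 1: "chom ?W (ctens (P (l + m)) (P n)) (pmult l m \<otimes>\<^sub>a \<ii> (cobj (P n)))"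
    by (rule chom_tensor[OF chom_pmult chom_ide]) simp_all
  have 2: "chom (ctens (P l) (ctens (P m) (P n))) (ctens (P l) (P (m + n))) (\<ii> (cobj (P l)) \<otimes>\<^sub>a pmult m n)"
    by (rule chom_tensor[OF chom_ide chom_pmult]) simp_all
  have 3: "chom ?W (ctens (P l) (ctens (P m) (P n))) (\<aa> (cobj (P l)) (cobj (P m)) (cobj (P n)))"
    by (rule chom_assc) simp_all
  show "chom ?W (P (l + m + n)) ?L"
    by (rule chom_comp[OF 1 chom_pmult])
  show "chom ?W (P (l + m + n)) ?R"
    using chom_comp[OF chom_comp[OF 3 2] chom_pmult] by (simp add: add.assoc)
  fix i assume i: "i < l + m + n"
  have L: "p (l + m + n) i \<cdot> ?L = (if i < l + m then p (l + m) i \<cdot> cfst (P (l + m)) (P n) \<cdot> (pmult l m \<otimes>\<^sub>a \<ii> (cobj (P n)))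
      else p n (i - (l + m)) \<cdot> csnd (P (l + m)) (P n) \<cdot> (pmult l m \<otimes>\<^sub>a \<ii> (cobj (P n))))"
    using i by (subst proj_pmult_comp) simp_all
  also have "\<dots> = (if i < l + m then p (l + m) i \<cdot> pmult l m \<cdot> cfst (ctens (P l) (P m)) (P n)
      else p n (i - (l + m)) \<cdot> csnd (ctens (P l) (P m)) (P n))"
    using cfst_tensor[OF chom_pmult chom_ide[OF _ refl], of "P n" l m] csnd_tensor[OF chom_pmult chom_ide[OF _ refl], of "P n" l m] by simp
  finally have L: "p (l + m + n) i \<cdot> ?L = \<dots>" .
  let ?h = "(\<ii> (cobj (P l)) \<otimes>\<^sub>a pmult m n) \<cdot> \<aa> (cobj (P l)) (cobj (P m)) (cobj (P n))"
  have f: "cfst (P l) (P (m + n)) \<cdot> ?h = cfst (P l) (P m) \<cdot> cfst (ctens (P l) (P m)) (P n)"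
    using comp_cong[OF cfst_tensor[OF chom_ide[OF _ refl] chom_pmult], of "P l" "\<aa> (cobj (P l)) (cobj (P m)) (cobj (P n))" m n]
    by (simp add: assc_proj)
  have g: "csnd (P l) (P (m + n)) \<cdot> ?h = pmult m n \<cdot> cpair ?W (csnd (P l) (P m) \<cdot> cfst (ctens (P l) (P m)) (P n)) (csnd (ctens (P l) (P m)) (P n))" (is "_ = _ \<cdot> ?c")
    using comp_cong[OF csnd_tensor[OF chom_ide[OF _ refl] chom_pmult], of "P l" "\<aa> (cobj (P l)) (cobj (P m)) (cobj (P n))" m n]
    by (simp add: assc_proj assoc)
  have c1: "chom ?W (P m) (csnd (P l) (P m) \<cdot> cfst (ctens (P l) (P m)) (P n))"
    by (rule chom_comp[OF chom_cfst chom_csnd]) simp_all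
  have c2: "chom ?W (P n) (csnd (ctens (P l) (P m)) (P n))"
    by (rule chom_csnd) simp_all
  note c = cfst_cpair[OF c1 c2] csnd_cpair[OF c1 c2]
  note [simp] = chom_simps[OF chom_cpair[OF c1 c2]]
  have R: "p (l + (m + n)) i \<cdot> ?R = (if i < l then p l i \<cdot> cfst (P l) (P (m + n)) \<cdot> ?h
      else p (m + n) (i - l) \<cdot> csnd (P l) (P (m + n)) \<cdot> ?h)"
    using i by (subst proj_pmult_comp) simp_all
  show "p (l + m + n) i \<cdot> ?L = p (l + m + n) i \<cdot> ?R"
  proof (cases "i < l")
    case True
    then show ?thesis
      using R unfolding L f by (simp add: proj_pmult_comp add.assoc)
  next
    case False
    then show ?thesis
      using R i unfolding L f g by (auto simp: proj_pmult_comp add.assoc c less_diff_conv2)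
  qed
qed simp_all

text \<open>The power \<open>P 0\<close> is the unit comonoid itself, so concatenation with the
  empty tuple equals the unitor. This allows the identity as the unit constraint of
  \<open>hopf_functor\<close>.\<close>

lemma pmult_lunit: "pmult 0 n = \<ll> (cobj (P n))"
proof (rule cpow_ext[of "ctens cunit (P n)" B n])
  have "csnd cunit (P n) = \<ll> (cobj (P n))"
    by (simp add: csnd_def)
  then show "p n i \<cdot> pmult 0 n = p n i \<cdot> \<ll> (cobj (P n))" if "i < n" for i
    using that proj_pmult[of i 0 n] by simp
qed (use chom_pmult[of 0 n] in \<open>simp_all add: chom_lunit\<close>)

lemma pmult_runit: "pmult n 0 = \<rr> (cobj (P n))"
proof (rule cpow_ext[of "ctens (P n) cunit" B n])
  have f: "cfst (P n) cunit = \<rr> (cobj (P n))"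
    by (simp add: cfst_def)
  then show "p n i \<cdot> pmult n 0 = p n i \<cdot> \<rr> (cobj (P n))" if "i < n" for i
    using that proj_pmult[of i n 0] by simp
  show "chom (ctens (P n) cunit) (P n) (\<rr> (cobj (P n)))"
    unfolding f[symmetric] by simp
qed (use chom_pmult[of n 0] in simp_all)

text \<open>Each row of a swap matrix has a single 1, so its combination is one projection, taken
  from the other tensor factor.\<close>

lemma pmult_symm: "marr (swap_mat m n) \<cdot> pmult m n = pmult n m \<cdot> \<ss> (cobj (P m)) (cobj (P n))"
proof (rule cpow_ext[of "ctens (P m) (P n)" B "n + m"])
  let ?W = "ctens (P m) (P n)"
  have s: "chom ?W (ctens (P n) (P m)) (\<ss> (cobj (P m)) (cobj (P n)))"
    by (rule chom_symm) simp_all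
  show "chom ?W (P (n + m)) (marr (swap_mat m n) \<cdot> pmult m n)"
    by (rule chom_comp[OF chom_pmult chom_marr]) simp_all
  show "chom ?W (P (n + m)) (pmult n m \<cdot> \<ss> (cobj (P m)) (cobj (P n)))"
    by (rule chom_comp[OF s chom_pmult])
  fix i assume i: "i < n + m"
  let ?j = "if i < n then m + i else i - n"
  have "p (n + m) i \<cdot> marr (swap_mat m n) \<cdot> pmult m n = comb ?W (m + n) (\<lambda>j. swap_mat m n $$ (i, j)) (\<lambda>j. p (m + n) j \<cdot> pmult m n)"
    using proj_marr[of i "swap_mat m n" ?W "pmult m n"] chom_pmult[of m n] i by simp
  also have "\<dots> = p (m + n) ?j \<cdot> pmult m n"
    by (rule comb_delta) (use i in \<open>auto intro: chom_comp[OF chom_pmult chom_proj]\<close>)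
  also have "\<dots> = (if i < n then p n i \<cdot> csnd (P m) (P n) else p m (i - n) \<cdot> cfst (P m) (P n))"
    using i by (auto simp: proj_pmult)
  also have "\<dots> = p (n + m) i \<cdot> pmult n m \<cdot> \<ss> (cobj (P m)) (cobj (P n))"
    using i by (simp add: proj_pmult_comp cfst_symm csnd_symm)
  finally show "p (n + m) i \<cdot> marr (swap_mat m n) \<cdot> pmult m n = p (n + m) i \<cdot> pmult n m \<cdot> \<ss> (cobj (P m)) (cobj (P n))" .
qed simp_all

definition hopf_functor :: "(nat, int mat, 'o, 'a) smf" where
  "hopf_functor = \<lparr>on_obj = (\<lambda>n. cobj (P n)), on_arr = marr, ftr_mult = (\<lambda>(m, n). pmult m n), ftr_unit = \<ii> \<I>\<rparr>"

lemma strong_hopf_functor: "strong_symmetric_monoidal_functor MatZ C hopf_functor"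
proof unfold_locales
  show "is_functor MatZ C hopf_functor"
    using MatZ_category.category_axioms category_axioms
    by (auto simp: is_functor_def hopf_functor_def marr_one marr_mult)
next
  fix a b :: nat assume "a \<in> Obj MatZ" "b \<in> Obj MatZ"
  show "on_arr hopf_functor (symmetry MatZ a b) \<cdot> ftr_mult hopf_functor (a, b) =
      ftr_mult hopf_functor (b, a) \<cdot> \<ss> (on_obj hopf_functor a) (on_obj hopf_functor b)"
    by (simp add: hopf_functor_def pmult_symm)
next
  fix l m n :: nat
  have "marr (1\<^sub>m (l + m + n)) \<cdot> pmult (l + m) n \<cdot> (pmult l m \<otimes>\<^sub>a \<ii> (cobj (P n)))
    = (marr (1\<^sub>m (l + m + n)) \<cdot> pmult (l + m) n) \<cdot> (pmult l m \<otimes>\<^sub>a \<ii> (cobj (P n)))"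
    by (subst assoc) simp_all
  also have "\<dots> = pmult l (m + n) \<cdot> (\<ii> (cobj (P l)) \<otimes>\<^sub>a pmult m n) \<cdot> \<aa> (cobj (P l)) (cobj (P m)) (cobj (P n))"
    by (simp add: marr_one pmult_assoc)
  finally show "on_arr hopf_functor (associator MatZ l m n) \<cdot> ftr_mult hopf_functor (tensor_obj MatZ l m, n) \<cdot>
      (ftr_mult hopf_functor (l, m) \<otimes>\<^sub>a \<ii> (on_obj hopf_functor n)) =
      ftr_mult hopf_functor (l, tensor_obj MatZ m n) \<cdot> (\<ii> (on_obj hopf_functor l) \<otimes>\<^sub>a ftr_mult hopf_functor (m, n)) \<cdot>
      \<aa> (on_obj hopf_functor l) (on_obj hopf_functor m) (on_obj hopf_functor n)"
    by (simp add: hopf_functor_def)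
next
  fix f g :: "int mat" and a a' b b' assume "f \<in> homset MatZ a a'" "g \<in> homset MatZ b b'"
  then show "ftr_mult hopf_functor (a', b') \<cdot> (on_arr hopf_functor f \<otimes>\<^sub>a on_arr hopf_functor g)
     = on_arr hopf_functor (tensor_arr MatZ f g) \<cdot> ftr_mult hopf_functor (a, b)"
    using pmult_natural[of f g] by (auto simp: hopf_functor_def)
qed (auto simp: hopf_functor_def marr_one pmult_lunit pmult_runit iso_ide)

end

section \<open>Evaluation of algebras at 1\<close>

locale matz_algebra = symmetric_monoidal_category C
  for C :: "('o, 'a, 'x) smc_scheme" (structure) +
  fixes F :: "(nat, int mat, 'o, 'a) smf"
  assumes strong: "strong_symmetric_monoidal_functor MatZ C F"
begin

declare One_nat_def [simp del]

abbreviation K where "K \<equiv> on_arr F"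
abbreviation k where "k \<equiv> on_obj F"
abbreviation \<phi> where "\<phi> m n \<equiv> ftr_mult F (m, n)"
abbreviation \<phi>\<^sub>0 where "\<phi>\<^sub>0 \<equiv> ftr_unit F"

lemma functor_simps [simp]:
  "k n \<in> Obj C" "K M \<in> Arr C" "Dom C (K M) = k (dim_col M)" "Cod C (K M) = k (dim_row M)"
  "K (1\<^sub>m n) = \<ii> (k n)"
  "iso_arr C (\<phi> m n)" "Dom C (\<phi> m n) = k m \<otimes>\<^sub>o k n" "Cod C (\<phi> m n) = k (m + n)"
  "iso_arr C \<phi>\<^sub>0" "Dom C \<phi>\<^sub>0 = \<I>" "Cod C \<phi>\<^sub>0 = k 0"
  using strong
  by (simp_all add: strong_symmetric_monoidal_functor_def strong_symmetric_monoidal_functor_axioms_def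
      is_functor_def)

lemma K_mult: "dim_col M = dim_row N \<Longrightarrow> K M \<cdot> K N = K (M * N)"
  using strong_symmetric_monoidal_functor.is_functor[OF strong] by (simp add: is_functor_def)

lemma K_mult_comp:
  "dim_col M = dim_row N \<Longrightarrow> f \<in> Arr C \<Longrightarrow> Cod C f = k (dim_col N) \<Longrightarrow> K M \<cdot> K N \<cdot> f = K (M * N) \<cdot> f"
  by (rule comp_cong[OF K_mult]) simp_all

lemma mult_nat:
  "dim_row f = m \<Longrightarrow> dim_row g = n \<Longrightarrow> \<phi> m n \<cdot> (K f \<otimes>\<^sub>a K g) = K (dsum f g) \<cdot> \<phi> (dim_col f) (dim_col g)"
  using strong_symmetric_monoidal_functor.mult_natural[OF strong, of f "dim_col f" m g "dim_col g" n] by simp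

lemma mult_nat_left:
  "dim_row f = m \<Longrightarrow> \<phi> m n \<cdot> (K f \<otimes>\<^sub>a \<ii> (k n)) = K (dsum f (1\<^sub>m n)) \<cdot> \<phi> (dim_col f) n"
  using mult_nat[of f m "1\<^sub>m n" n] by simp

lemma mult_nat_right:
  "dim_row f = n \<Longrightarrow> \<phi> m n \<cdot> (\<ii> (k m) \<otimes>\<^sub>a K f) = K (dsum (1\<^sub>m m) f) \<cdot> \<phi> m (dim_col f)"
  using mult_nat[of "1\<^sub>m m" m f n] by simp

lemma mult_assc:
  "\<phi> (l + m) n \<cdot> (\<phi> l m \<otimes>\<^sub>a \<ii> (k n)) = \<phi> l (m + n) \<cdot> (\<ii> (k l) \<otimes>\<^sub>a \<phi> m n) \<cdot> \<aa> (k l) (k m) (k n)"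
  using strong_symmetric_monoidal_functor.preserves_associator[OF strong, of l m n]
  by (simp add: ich add.assoc)

lemma mult_lunit: "\<phi> 0 n \<cdot> (\<phi>\<^sub>0 \<otimes>\<^sub>a \<ii> (k n)) = \<ll> (k n)"
  using strong_symmetric_monoidal_functor.preserves_left_unitor[OF strong, of n] by simp

lemma mult_runit: "\<phi> n 0 \<cdot> (\<ii> (k n) \<otimes>\<^sub>a \<phi>\<^sub>0) = \<rr> (k n)"
  using strong_symmetric_monoidal_functor.preserves_right_unitor[OF strong, of n] by simp

lemma mult_symm: "\<phi> n m \<cdot> \<ss> (k m) (k n) = K (swap_mat m n) \<cdot> \<phi> m n"
  using strong_symmetric_monoidal_functor.preserves_symmetry[OF strong, of m n] by simp

lemma mult_unit_unit: "\<phi> 0 0 \<cdot> (\<phi>\<^sub>0 \<otimes>\<^sub>a \<phi>\<^sub>0) = \<phi>\<^sub>0 \<cdot> \<ll> \<I>"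
proof -
  have "\<phi> 0 0 \<cdot> (\<phi>\<^sub>0 \<otimes>\<^sub>a \<phi>\<^sub>0) = (\<phi> 0 0 \<cdot> (\<phi>\<^sub>0 \<otimes>\<^sub>a \<ii> (k 0))) \<cdot> (\<ii> \<I> \<otimes>\<^sub>a \<phi>\<^sub>0)"
    by (simp add: assoc ich)
  also have "\<dots> = \<phi>\<^sub>0 \<cdot> \<ll> \<I>"
    unfolding mult_lunit by (simp add: lunit_nat)
  finally show ?thesis .
qed

lemma inv_mult_nat:
  assumes "dim_col f = m" "dim_col g = n"
  shows "(K f \<otimes>\<^sub>a K g) \<cdot> inv_arr C (\<phi> m n) = inv_arr C (\<phi> (dim_row f) (dim_row g)) \<cdot> K (dsum f g)"
  (is "?f = ?g")
proof (rule iso_epi[of "\<phi> m n"])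
  have "inv_arr C (\<phi> (dim_row f) (dim_row g)) \<cdot> K (dsum f g) \<cdot> \<phi> m n
      = inv_arr C (\<phi> (dim_row f) (dim_row g)) \<cdot> \<phi> (dim_row f) (dim_row g) \<cdot> (K f \<otimes>\<^sub>a K g)"
    using assms by (simp only: mult_nat)
  then show "?f \<cdot> \<phi> m n = ?g \<cdot> \<phi> m n"
    using assms by (simp add: assoc)
qed (use assms in simp_all)

lemma inv_mult_nat_left:
  "dim_col f = m \<Longrightarrow> (K f \<otimes>\<^sub>a \<ii> (k n)) \<cdot> inv_arr C (\<phi> m n) = inv_arr C (\<phi> (dim_row f) n) \<cdot> K (dsum f (1\<^sub>m n))"
  using inv_mult_nat[of f m "1\<^sub>m n" n] by simp

lemma inv_mult_nat_right:
  "dim_col f = n \<Longrightarrow> (\<ii> (k m) \<otimes>\<^sub>a K f) \<cdot> inv_arr C (\<phi> m n) = inv_arr C (\<phi> m (dim_row f)) \<cdot> K (dsum (1\<^sub>m m) f)"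
  using inv_mult_nat[of "1\<^sub>m m" m f n] by simp

lemma mult_lswap:
  "\<phi> c (b + d) \<cdot> (\<ii> (k c) \<otimes>\<^sub>a \<phi> b d) \<cdot> \<cc> (k b) (k c) (k d)
    = K (dsum (swap_mat b c) (1\<^sub>m d)) \<cdot> \<phi> b (c + d) \<cdot> (\<ii> (k b) \<otimes>\<^sub>a \<phi> c d)"
proof -
  have "\<phi> c (b + d) \<cdot> (\<ii> (k c) \<otimes>\<^sub>a \<phi> b d) \<cdot> \<cc> (k b) (k c) (k d)
      = (\<phi> c (b + d) \<cdot> (\<ii> (k c) \<otimes>\<^sub>a \<phi> b d) \<cdot> \<aa> (k c) (k b) (k d)) \<cdot> (\<ss> (k b) (k c) \<otimes>\<^sub>a \<ii> (k d)) \<cdot> \<aa>\<aa> (k b) (k c) (k d)"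
    by (simp add: lswap_def assoc)
  also have "\<dots> = \<phi> (c + b) d \<cdot> ((\<phi> c b \<cdot> \<ss> (k b) (k c)) \<otimes>\<^sub>a \<ii> (k d)) \<cdot> \<aa>\<aa> (k b) (k c) (k d)"
    unfolding mult_assc[symmetric] by (simp add: assoc ich)
  also have "\<dots> = (\<phi> (c + b) d \<cdot> (K (swap_mat b c) \<otimes>\<^sub>a \<ii> (k d))) \<cdot> (\<phi> b c \<otimes>\<^sub>a \<ii> (k d)) \<cdot> \<aa>\<aa> (k b) (k c) (k d)"
    unfolding mult_symm by (simp add: assoc ich)
  also have "\<dots> = K (dsum (swap_mat b c) (1\<^sub>m d)) \<cdot> (\<phi> (b + c) d \<cdot> (\<phi> b c \<otimes>\<^sub>a \<ii> (k d))) \<cdot> \<aa>\<aa> (k b) (k c) (k d)"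
    by (subst mult_nat_left) (simp_all add: assoc add.assoc add.commute)
  also have "\<dots> = K (dsum (swap_mat b c) (1\<^sub>m d)) \<cdot> \<phi> b (c + d) \<cdot> (\<ii> (k b) \<otimes>\<^sub>a \<phi> c d)"
    unfolding mult_assc by (simp add: assoc)
  finally show ?thesis .
qed

lemma mult_mult:
  "\<phi> (a + b) (c + d) \<cdot> (\<phi> a b \<otimes>\<^sub>a \<phi> c d)
    = \<phi> a (b + (c + d)) \<cdot> (\<ii> (k a) \<otimes>\<^sub>a (\<phi> b (c + d) \<cdot> (\<ii> (k b) \<otimes>\<^sub>a \<phi> c d))) \<cdot> \<aa> (k a) (k b) (k c \<otimes>\<^sub>o k d)"
proof -
  have "\<phi> (a + b) (c + d) \<cdot> (\<phi> a b \<otimes>\<^sub>a \<phi> c d) = (\<phi> (a + b) (c + d) \<cdot> (\<phi> a b \<otimes>\<^sub>a \<ii> (k (c + d)))) \<cdot> ((\<ii> (k a) \<otimes>\<^sub>a \<ii> (k b)) \<otimes>\<^sub>a \<phi> c d)"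
    by (simp add: ich assoc)
  also have "\<dots> = \<phi> a (b + (c + d)) \<cdot> (\<ii> (k a) \<otimes>\<^sub>a \<phi> b (c + d)) \<cdot> (\<aa> (k a) (k b) (k (c + d)) \<cdot> ((\<ii> (k a) \<otimes>\<^sub>a \<ii> (k b)) \<otimes>\<^sub>a \<phi> c d))"
    unfolding mult_assc by (simp add: assoc add.assoc)
  also have "\<dots> = \<phi> a (b + (c + d)) \<cdot> (\<ii> (k a) \<otimes>\<^sub>a (\<phi> b (c + d) \<cdot> (\<ii> (k b) \<otimes>\<^sub>a \<phi> c d))) \<cdot> \<aa> (k a) (k b) (k c \<otimes>\<^sub>o k d)"
    by (subst assc_nat) (simp_all add: ich)
  finally show ?thesis .
qed

text \<open>Translates the middle swap of \<open>C\<close> into a permutation matrix. Through this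
  the bimonoid law for the value at 1 becomes an identity between integer matrices.\<close>

lemma mult_mswap:
  "\<phi> (a + c) (b + d) \<cdot> (\<phi> a c \<otimes>\<^sub>a \<phi> b d) \<cdot> \<mm> (k a) (k b) (k c) (k d)
    = K (dsum (1\<^sub>m a) (dsum (swap_mat b c) (1\<^sub>m d))) \<cdot> \<phi> (a + b) (c + d) \<cdot> (\<phi> a b \<otimes>\<^sub>a \<phi> c d)"
proof -
  have "\<phi> (a + c) (b + d) \<cdot> (\<phi> a c \<otimes>\<^sub>a \<phi> b d) \<cdot> \<mm> (k a) (k b) (k c) (k d)
      = (\<phi> (a + c) (b + d) \<cdot> (\<phi> a c \<otimes>\<^sub>a \<phi> b d)) \<cdot> \<mm> (k a) (k b) (k c) (k d)"
    by (simp add: assoc)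
  also have "\<dots> = \<phi> a (c + (b + d)) \<cdot> (\<ii> (k a) \<otimes>\<^sub>a (\<phi> c (b + d) \<cdot> (\<ii> (k c) \<otimes>\<^sub>a \<phi> b d) \<cdot> \<cc> (k b) (k c) (k d))) \<cdot> \<aa> (k a) (k b) (k c \<otimes>\<^sub>o k d)"
    unfolding mult_mult by (simp add: assoc mswap_assc ich)
  also have "\<dots> = (\<phi> a (c + (b + d)) \<cdot> (\<ii> (k a) \<otimes>\<^sub>a K (dsum (swap_mat b c) (1\<^sub>m d)))) \<cdot> (\<ii> (k a) \<otimes>\<^sub>a (\<phi> b (c + d) \<cdot> (\<ii> (k b) \<otimes>\<^sub>a \<phi> c d))) \<cdot> \<aa> (k a) (k b) (k c \<otimes>\<^sub>o k d)"
    unfolding mult_lswap by (simp add: ich assoc add.assoc)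
  also have "\<dots> = K (dsum (1\<^sub>m a) (dsum (swap_mat b c) (1\<^sub>m d))) \<cdot> \<phi> (a + b) (c + d) \<cdot> (\<phi> a b \<otimes>\<^sub>a \<phi> c d)"
    unfolding mult_mult by (subst mult_nat_right) (simp_all add: assoc add.assoc)
  finally show ?thesis .
qed

text \<open>The Hopf structure on the object 1 of \<open>MatZ\<close>, transported along
  \<open>F\<close>. Comultiplication and counit need the inverses of the structure maps, which is
  where strongness of \<open>F\<close> is used.\<close>

definition eval :: "('o, 'a) hopf_data" where
  "eval = \<lparr>hopf_obj = k 1, hopf_mult = K gen_add \<cdot> \<phi> 1 1, hopf_unit = K gen_zero \<cdot> \<phi>\<^sub>0,
     hopf_comult = inv_arr C (\<phi> 1 1) \<cdot> K gen_copy, hopf_counit = inv_arr C \<phi>\<^sub>0 \<cdot> K gen_del,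
     hopf_antipode = K gen_neg\<rparr>"

text \<open>Each axiom is brought into the form of one matrix under \<open>K\<close> between
  structure maps of \<open>F\<close>; the matrices on the two sides agree by
  \<open>gen_identities\<close>.\<close>

lemma hopf_eval: "bicommutative_hopf_monoid C eval"
proof -
  define A \<mu> \<eta> \<Delta> \<epsilon> S where defs: "A = k 1" "\<mu> = K gen_add \<cdot> \<phi> 1 1" "\<eta> = K gen_zero \<cdot> \<phi>\<^sub>0"
    "\<Delta> = inv_arr C (\<phi> 1 1) \<cdot> K gen_copy" "\<epsilon> = inv_arr C \<phi>\<^sub>0 \<cdot> K gen_del" "S = K gen_neg"
  have [simp]: "A \<in> Obj C" "\<mu> \<in> Arr C" "Dom C \<mu> = A \<otimes>\<^sub>o A" "Cod C \<mu> = A" "\<eta> \<in> Arr C" "Dom C \<eta> = \<I>" "Cod C \<eta> = A"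
    "\<Delta> \<in> Arr C" "Dom C \<Delta> = A" "Cod C \<Delta> = A \<otimes>\<^sub>o A" "\<epsilon> \<in> Arr C" "Dom C \<epsilon> = A" "Cod C \<epsilon> = \<I>"
    "S \<in> Arr C" "Dom C S = A" "Cod C S = A"
    by (simp_all add: defs)
  \<comment> \<open>These four rules push a matrix through multiplication or comultiplication,
    collecting everything in a single \<open>K\<close>.\<close>
  have mult_left: "\<mu> \<cdot> (K f \<otimes>\<^sub>a \<ii> A) = K (gen_add * dsum f (1\<^sub>m 1)) \<cdot> \<phi> (dim_col f) 1" if "dim_row f = 1" for f
    using that mult_nat_left[of f 1 1] by (simp add: defs assoc K_mult_comp)
  have mult_right: "\<mu> \<cdot> (\<ii> A \<otimes>\<^sub>a K f) = K (gen_add * dsum (1\<^sub>m 1) f) \<cdot> \<phi> 1 (dim_col f)" if "dim_row f = 1" for f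
    using that mult_nat_right[of f 1 1] by (simp add: defs assoc K_mult_comp)
  have comult_left: "(K f \<otimes>\<^sub>a \<ii> A) \<cdot> \<Delta> = inv_arr C (\<phi> (dim_row f) 1) \<cdot> K (dsum f (1\<^sub>m 1) * gen_copy)" if "dim_col f = 1" for f
    using that by (simp add: defs comp_cong2[OF inv_mult_nat_left] K_mult)
  have comult_right: "(\<ii> A \<otimes>\<^sub>a K f) \<cdot> \<Delta> = inv_arr C (\<phi> 1 (dim_row f)) \<cdot> K (dsum (1\<^sub>m 1) f * gen_copy)" if "dim_col f = 1" for f
    using that by (simp add: defs comp_cong2[OF inv_mult_nat_right] K_mult)

  have "\<mu> \<cdot> (\<mu> \<otimes>\<^sub>a \<ii> A) = (\<mu> \<cdot> (K gen_add \<otimes>\<^sub>a \<ii> A)) \<cdot> (\<phi> 1 1 \<otimes>\<^sub>a \<ii> (k 1))"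
    by (simp add: defs ich assoc)
  also have "\<dots> = K (gen_add * dsum gen_add (1\<^sub>m 1)) \<cdot> \<phi> (1 + 1) 1 \<cdot> (\<phi> 1 1 \<otimes>\<^sub>a \<ii> (k 1))"
    by (simp add: mult_left assoc)
  also have "\<dots> = (\<mu> \<cdot> (\<ii> A \<otimes>\<^sub>a K gen_add)) \<cdot> (\<ii> (k 1) \<otimes>\<^sub>a \<phi> 1 1) \<cdot> \<aa> (k 1) (k 1) (k 1)"
    unfolding mult_assc by (simp add: mult_right gen_identities assoc)
  also have "\<dots> = \<mu> \<cdot> (\<ii> A \<otimes>\<^sub>a \<mu>) \<cdot> \<aa> A A A"
    by (simp add: defs ich assoc)
  finally have m1: "\<mu> \<cdot> (\<mu> \<otimes>\<^sub>a \<ii> A) = \<mu> \<cdot> (\<ii> A \<otimes>\<^sub>a \<mu>) \<cdot> \<aa> A A A" .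
  have "\<mu> \<cdot> (\<eta> \<otimes>\<^sub>a \<ii> A) = (\<mu> \<cdot> (K gen_zero \<otimes>\<^sub>a \<ii> A)) \<cdot> (\<phi>\<^sub>0 \<otimes>\<^sub>a \<ii> (k 1))"
    by (simp add: defs ich assoc)
  also have "\<dots> = \<phi> 0 1 \<cdot> (\<phi>\<^sub>0 \<otimes>\<^sub>a \<ii> (k 1))"
    by (simp add: mult_left gen_identities)
  also have "\<dots> = \<ll> A"
    by (simp add: mult_lunit defs(1))
  finally have m2: "\<mu> \<cdot> (\<eta> \<otimes>\<^sub>a \<ii> A) = \<ll> A" .
  have "\<mu> \<cdot> (\<ii> A \<otimes>\<^sub>a \<eta>) = (\<mu> \<cdot> (\<ii> A \<otimes>\<^sub>a K gen_zero)) \<cdot> (\<ii> (k 1) \<otimes>\<^sub>a \<phi>\<^sub>0)"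
    by (simp add: defs ich assoc)
  also have "\<dots> = \<phi> 1 0 \<cdot> (\<ii> (k 1) \<otimes>\<^sub>a \<phi>\<^sub>0)"
    by (simp add: mult_right gen_identities)
  also have "\<dots> = \<rr> A"
    by (simp add: mult_runit defs(1))
  finally have m3: "\<mu> \<cdot> (\<ii> A \<otimes>\<^sub>a \<eta>) = \<rr> A" .
  have m4: "\<mu> \<cdot> \<ss> A A = \<mu>"
    using mult_symm[of 1 1] by (simp add: defs assoc K_mult_comp gen_identities)
  have monoid: "commutative_monoid C A \<mu> \<eta>"
    using m1 m2 m3 m4 by unfold_locales simp_all
  have d1: "\<aa> A A A \<cdot> (\<Delta> \<otimes>\<^sub>a \<ii> A) \<cdot> \<Delta> = (\<ii> A \<otimes>\<^sub>a \<Delta>) \<cdot> \<Delta>"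
    (is "?L = ?R")
  \<comment> \<open>The cancelled isomorphism goes from
    \<open>k 1 \<otimes> (k 1 \<otimes> k 1)\<close> to \<open>k\<close> of \<open>1 + 2\<close>, so
    that \<open>mult_assc\<close> can absorb the associator.\<close>
  proof (rule iso_mono[of "\<phi> 1 2 \<cdot> (\<ii> (k 1) \<otimes>\<^sub>a \<phi> 1 1)"])
    have "\<phi> 1 2 \<cdot> (\<ii> (k 1) \<otimes>\<^sub>a \<phi> 1 1) \<cdot> ?L
       = (\<phi> 1 (1 + 1) \<cdot> (\<ii> (k 1) \<otimes>\<^sub>a \<phi> 1 1) \<cdot> \<aa> (k 1) (k 1) (k 1)) \<cdot> (inv_arr C (\<phi> 1 1) \<otimes>\<^sub>a \<ii> A) \<cdot> (K gen_copy \<otimes>\<^sub>a \<ii> A) \<cdot> \<Delta>"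
      by (simp add: defs ich assoc)
    also have "\<dots> = \<phi> (1 + 1) 1 \<cdot> (K gen_copy \<otimes>\<^sub>a \<ii> A) \<cdot> \<Delta>"
      unfolding mult_assc[symmetric] by (simp add: defs ich assoc)
    also have "\<dots> = \<phi> 1 2 \<cdot> (\<ii> A \<otimes>\<^sub>a K gen_copy) \<cdot> \<Delta>"
      by (simp add: comult_left comult_right gen_identities)
    also have "\<dots> = \<phi> 1 2 \<cdot> (\<ii> (k 1) \<otimes>\<^sub>a \<phi> 1 1) \<cdot> ?R"
      by (simp add: defs ich assoc)
    finally show "(\<phi> 1 2 \<cdot> (\<ii> (k 1) \<otimes>\<^sub>a \<phi> 1 1)) \<cdot> ?L = (\<phi> 1 2 \<cdot> (\<ii> (k 1) \<otimes>\<^sub>a \<phi> 1 1)) \<cdot> ?R"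
      by (simp add: assoc defs(1))
  qed (simp_all add: iso_comp iso_ide defs(1))
  have "\<ll> A \<cdot> (\<epsilon> \<otimes>\<^sub>a \<ii> A) \<cdot> \<Delta> = \<ll> A \<cdot> (inv_arr C \<phi>\<^sub>0 \<otimes>\<^sub>a \<ii> A) \<cdot> (K gen_del \<otimes>\<^sub>a \<ii> A) \<cdot> \<Delta>"
    by (simp add: defs ich assoc)
  also have "\<dots> = \<ll> A \<cdot> (inv_arr C \<phi>\<^sub>0 \<otimes>\<^sub>a \<ii> A) \<cdot> inv_arr C (\<phi> 0 1)"
    by (simp add: comult_left gen_identities)
  also have "\<dots> = \<phi> 0 1 \<cdot> (\<phi>\<^sub>0 \<otimes>\<^sub>a \<ii> (k 1)) \<cdot> (inv_arr C \<phi>\<^sub>0 \<otimes>\<^sub>a \<ii> A) \<cdot> inv_arr C (\<phi> 0 1)"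
    by (simp add: assoc defs(1) flip: mult_lunit)
  also have "\<dots> = \<ii> A"
    by (simp add: ich defs(1))
  finally have d2: "\<ll> A \<cdot> (\<epsilon> \<otimes>\<^sub>a \<ii> A) \<cdot> \<Delta> = \<ii> A" .
  have d3: "\<ss> A A \<cdot> \<Delta> = \<Delta>"
  proof (rule iso_mono[of "\<phi> 1 1"])
    have "\<phi> 1 1 \<cdot> \<ss> A A \<cdot> \<Delta> = K (swap_mat 1 1) \<cdot> \<phi> 1 1 \<cdot> \<Delta>"
      by (simp add: defs comp_cong2[OF mult_symm])
    also have "\<dots> = \<phi> 1 1 \<cdot> \<Delta>"
      by (simp add: defs K_mult gen_identities)
    finally show "\<phi> 1 1 \<cdot> \<ss> A A \<cdot> \<Delta> = \<phi> 1 1 \<cdot> \<Delta>" .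
  qed (simp_all add: defs(1))
  have comonoid: "cocommutative_comonoid C A \<Delta> \<epsilon>"
    using d1 d2 d3 by (intro comonI) simp_all
  have compat: "bicommutative_bimonoid_axioms C A \<mu> \<eta> \<Delta> \<epsilon>"
  proof
    \<comment> \<open>Applying \<open>\<phi> 1 1\<close> lets \<open>mult_nat\<close>,
      \<open>mult_mswap\<close> and \<open>mult_nat\<close> again convert the right-hand side into a
      product of matrices from the left to the right.\<close>
    have "\<phi> 1 1 \<cdot> (\<mu> \<otimes>\<^sub>a \<mu>) \<cdot> middle_swap A \<cdot> (\<Delta> \<otimes>\<^sub>a \<Delta>)
      = (\<phi> 1 1 \<cdot> (K gen_add \<otimes>\<^sub>a K gen_add)) \<cdot> (\<phi> 1 1 \<otimes>\<^sub>a \<phi> 1 1) \<cdot> \<mm> A A A A \<cdot> (\<Delta> \<otimes>\<^sub>a \<Delta>)"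
      unfolding middle_swap_eq by (simp add: defs ich assoc)
    also have "\<dots> = K (dsum gen_add gen_add) \<cdot> (\<phi> (1 + 1) (1 + 1) \<cdot> (\<phi> 1 1 \<otimes>\<^sub>a \<phi> 1 1) \<cdot> \<mm> (k 1) (k 1) (k 1) (k 1)) \<cdot> (\<Delta> \<otimes>\<^sub>a \<Delta>)"
      by (subst mult_nat) (simp_all add: defs assoc)
    also have "\<dots> = K (dsum gen_add gen_add) \<cdot> K (dsum (1\<^sub>m 1) (dsum (swap_mat 1 1) (1\<^sub>m 1))) \<cdot> (\<phi> 2 2 \<cdot> (K gen_copy \<otimes>\<^sub>a K gen_copy))"
      unfolding mult_mswap by (simp add: defs ich assoc)
    also have "\<dots> = K (gen_copy * gen_add) \<cdot> \<phi> 1 1"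
      by (subst mult_nat) (simp_all add: gen_identities K_mult_comp mult_mat_assoc)
    also have "\<dots> = \<phi> 1 1 \<cdot> \<Delta> \<cdot> \<mu>"
      by (simp add: defs assoc K_mult_comp)
    finally have "\<phi> 1 1 \<cdot> \<Delta> \<cdot> \<mu> = \<phi> 1 1 \<cdot> (\<mu> \<otimes>\<^sub>a \<mu>) \<cdot> middle_swap A \<cdot> (\<Delta> \<otimes>\<^sub>a \<Delta>)" ..
    then show "\<Delta> \<cdot> \<mu> = (\<mu> \<otimes>\<^sub>a \<mu>) \<cdot> middle_swap A \<cdot> (\<Delta> \<otimes>\<^sub>a \<Delta>)"
      by (rule iso_mono[rotated]) (simp_all add: defs(1) middle_swap_eq)
    have "\<phi> 1 1 \<cdot> (\<eta> \<otimes>\<^sub>a \<eta>) \<cdot> inv_arr C (\<ll> \<I>) = (\<phi> 1 1 \<cdot> (K gen_zero \<otimes>\<^sub>a K gen_zero)) \<cdot> (\<phi>\<^sub>0 \<otimes>\<^sub>a \<phi>\<^sub>0) \<cdot> inv_arr C (\<ll> \<I>)"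
      by (simp add: defs ich assoc)
    also have "\<dots> = K (dsum gen_zero gen_zero) \<cdot> (\<phi> 0 0 \<cdot> (\<phi>\<^sub>0 \<otimes>\<^sub>a \<phi>\<^sub>0)) \<cdot> inv_arr C (\<ll> \<I>)"
      by (subst mult_nat) (simp_all add: assoc del: dsum_zero)
    also have "\<dots> = \<phi> 1 1 \<cdot> \<Delta> \<cdot> \<eta>"
      unfolding mult_unit_unit by (simp add: defs assoc K_mult_comp gen_identities del: dsum_zero)
    finally have "\<phi> 1 1 \<cdot> \<Delta> \<cdot> \<eta> = \<phi> 1 1 \<cdot> (\<eta> \<otimes>\<^sub>a \<eta>) \<cdot> inv_arr C (\<ll> \<I>)" ..
    then show "\<Delta> \<cdot> \<eta> = (\<eta> \<otimes>\<^sub>a \<eta>) \<cdot> inv_arr C (\<ll> \<I>)"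
      by (rule iso_mono[rotated]) (simp_all add: defs(1))
    have "\<phi>\<^sub>0 \<cdot> \<ll> \<I> \<cdot> (\<epsilon> \<otimes>\<^sub>a \<epsilon>) = (\<phi>\<^sub>0 \<cdot> \<ll> \<I>) \<cdot> (inv_arr C \<phi>\<^sub>0 \<otimes>\<^sub>a inv_arr C \<phi>\<^sub>0) \<cdot> (K gen_del \<otimes>\<^sub>a K gen_del)"
      by (simp add: defs ich assoc)
    also have "\<dots> = \<phi> 0 0 \<cdot> (K gen_del \<otimes>\<^sub>a K gen_del)"
      unfolding mult_unit_unit[symmetric] by (simp add: ich assoc)
    also have "\<dots> = \<phi>\<^sub>0 \<cdot> \<epsilon> \<cdot> \<mu>"
      by (subst mult_nat) (simp_all add: defs assoc K_mult_comp gen_identities del: dsum_zero)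
    finally have "\<phi>\<^sub>0 \<cdot> \<epsilon> \<cdot> \<mu> = \<phi>\<^sub>0 \<cdot> \<ll> \<I> \<cdot> (\<epsilon> \<otimes>\<^sub>a \<epsilon>)" ..
    then show "\<epsilon> \<cdot> \<mu> = \<ll> \<I> \<cdot> (\<epsilon> \<otimes>\<^sub>a \<epsilon>)"
      by (rule iso_mono[rotated]) (simp_all add: defs(1))
    show "\<epsilon> \<cdot> \<eta> = \<ii> \<I>"
      by (simp add: defs assoc K_mult_comp gen_identities)
  qed
  have "bicommutative_bimonoid C A \<mu> \<eta> \<Delta> \<epsilon>"
    by (rule bicommutative_bimonoid.intro[OF monoid comonoid compat])
  moreover have "\<mu> \<cdot> (S \<otimes>\<^sub>a \<ii> A) \<cdot> \<Delta> = \<eta> \<cdot> \<epsilon>"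
    using comult_left[of gen_neg] by (simp add: defs assoc K_mult K_mult_comp gen_identities)
  moreover have "\<mu> \<cdot> (\<ii> A \<otimes>\<^sub>a S) \<cdot> \<Delta> = \<eta> \<cdot> \<epsilon>"
    using comult_right[of gen_neg] by (simp add: defs assoc K_mult K_mult_comp gen_identities)
  ultimately have "bicommutative_hopf_monoid C \<lparr>hopf_obj = A, hopf_mult = \<mu>, hopf_unit = \<eta>, hopf_comult = \<Delta>,
      hopf_counit = \<epsilon>, hopf_antipode = S\<rparr>"
    by (simp add: bicommutative_hopf_monoid_def)
  then show ?thesis
    by (simp only: eval_def defs)
qed

end

section \<open>Monoidal transformations and Hopf monoid homomorphisms\<close>

context symmetric_monoidal_category
begin

text \<open>Every natural number is an object and every integer matrix an arrow of
  \<open>MatZ\<close>, so the quantifiers become unrestricted and extensionality holds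
  trivially.\<close>

lemma monoidal_nat_trans_iff:
  "monoidal_nat_trans MatZ C F G t \<longleftrightarrow>
    strong_symmetric_monoidal_functor MatZ C F \<and> strong_symmetric_monoidal_functor MatZ C G \<and>
    (\<forall>n. t n \<in> homset C (on_obj F n) (on_obj G n)) \<and>
    (\<forall>M. t (dim_row M) \<cdot> on_arr F M = on_arr G M \<cdot> t (dim_col M)) \<and>
    (\<forall>m n. t (m + n) \<cdot> ftr_mult F (m, n) = ftr_mult G (m, n) \<cdot> (t m \<otimes>\<^sub>a t n)) \<and>
    t 0 \<cdot> ftr_unit F = ftr_unit G"
  by (auto simp: monoidal_nat_trans_def monoidal_nat_trans_axioms_def nat_trans_def
      dest: strong_symmetric_monoidal_functor.is_functor)

end

locale matz_algebra_pair = matz_algebra C F + G: matz_algebra C G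
  for C :: "('o, 'a, 'x) smc_scheme" (structure) and F G
begin

context
  fixes t
  assumes mnt: "monoidal_nat_trans MatZ C F G t"
begin

lemma trans_simps [simp]: "t n \<in> Arr C" "Dom C (t n) = k n" "Cod C (t n) = G.k n"
  and trans_nat: "t (dim_row M) \<cdot> K M = G.K M \<cdot> t (dim_col M)"
  and trans_mult: "t (m + n) \<cdot> \<phi> m n = G.\<phi> m n \<cdot> (t m \<otimes>\<^sub>a t n)"
  and trans_unit: "t 0 \<cdot> \<phi>\<^sub>0 = G.\<phi>\<^sub>0"
  using mnt by (simp_all add: monoidal_nat_trans_iff)

lemma hopf_hom_eval: "hopf_monoid_hom C eval G.eval (t 1)"
proof -
  have nat: "t m \<cdot> K M = G.K M \<cdot> t n" if "dim_row M = m" "dim_col M = n" for M m n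
    using trans_nat[of M] that by simp
  have inv: "inv_arr C (G.\<phi> 1 1) \<cdot> t 2 = (t 1 \<otimes>\<^sub>a t 1) \<cdot> inv_arr C (\<phi> 1 1)"
  proof (rule iso_epi[of "\<phi> 1 1"])
    show "(inv_arr C (G.\<phi> 1 1) \<cdot> t 2) \<cdot> \<phi> 1 1 = ((t 1 \<otimes>\<^sub>a t 1) \<cdot> inv_arr C (\<phi> 1 1)) \<cdot> \<phi> 1 1"
      using trans_mult[of 1 1] by (simp add: assoc)
  qed simp_all
  have inv0: "inv_arr C G.\<phi>\<^sub>0 \<cdot> t 0 = inv_arr C \<phi>\<^sub>0"
  proof (rule iso_epi[of "\<phi>\<^sub>0"])
    show "(inv_arr C G.\<phi>\<^sub>0 \<cdot> t 0) \<cdot> \<phi>\<^sub>0 = inv_arr C \<phi>\<^sub>0 \<cdot> \<phi>\<^sub>0"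
      using trans_unit by (simp add: assoc)
  qed simp_all
  have "G.K gen_add \<cdot> G.\<phi> 1 1 \<cdot> (t 1 \<otimes>\<^sub>a t 1) = t 1 \<cdot> K gen_add \<cdot> \<phi> 1 1"
    using trans_mult[of 1 1] by (simp add: comp_cong2[OF nat[of gen_add 1 2]])
  moreover have "t 1 \<cdot> K gen_zero \<cdot> \<phi>\<^sub>0 = G.K gen_zero \<cdot> G.\<phi>\<^sub>0"
    using trans_unit by (simp add: comp_cong2[OF nat[of gen_zero 1 0]])
  moreover have "inv_arr C (G.\<phi> 1 1) \<cdot> G.K gen_copy \<cdot> t 1 = (t 1 \<otimes>\<^sub>a t 1) \<cdot> inv_arr C (\<phi> 1 1) \<cdot> K gen_copy"
    by (simp add: comp_cong2[OF inv, symmetric] nat[of gen_copy 2 1])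
  moreover have "inv_arr C G.\<phi>\<^sub>0 \<cdot> G.K gen_del \<cdot> t 1 = inv_arr C \<phi>\<^sub>0 \<cdot> K gen_del"
    by (simp add: comp_cong[OF inv0, symmetric] nat[of gen_del 0 1])
  moreover have "t 1 \<cdot> K gen_neg = G.K gen_neg \<cdot> t 1"
    by (rule nat) simp_all
  ultimately show ?thesis
    using hopf_eval G.hopf_eval by (simp add: hopf_monoid_hom_def eval_def G.eval_def assoc)
qed

lemma trans_Suc: "t (Suc n) = G.\<phi> 1 n \<cdot> (t 1 \<otimes>\<^sub>a t n) \<cdot> inv_arr C (\<phi> 1 n)"
proof (rule iso_epi[of "\<phi> 1 n"])
  show "t (Suc n) \<cdot> \<phi> 1 n = (G.\<phi> 1 n \<cdot> (t 1 \<otimes>\<^sub>a t n) \<cdot> inv_arr C (\<phi> 1 n)) \<cdot> \<phi> 1 n"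
    using trans_mult[of 1 n] by (simp add: assoc plus_1_eq_Suc)
qed (simp_all add: plus_1_eq_Suc)

lemma trans_0: "t 0 = G.\<phi>\<^sub>0 \<cdot> inv_arr C \<phi>\<^sub>0"
  by (rule iso_epi[of "\<phi>\<^sub>0"]) (simp_all add: trans_unit assoc)

end

text \<open>Compatibility with the structure maps at \<open>0\<close> and at \<open>(1, n)\<close>,
  solved for the next component (\<open>trans_0\<close>, \<open>trans_Suc\<close>). A monoidal
  transformation with component \<open>f\<close> at 1 can only be this one, which is why evaluation
  is faithful.\<close>

primrec extend :: "'a \<Rightarrow> nat \<Rightarrow> 'a" where
  "extend f 0 = G.\<phi>\<^sub>0 \<cdot> inv_arr C \<phi>\<^sub>0"
| "extend f (Suc n) = G.\<phi> 1 n \<cdot> (f \<otimes>\<^sub>a extend f n) \<cdot> inv_arr C (\<phi> 1 n)"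

lemma trans_eq_extend: "monoidal_nat_trans MatZ C F G t \<Longrightarrow> t n = extend (t 1) n"
  by (induction n) (simp_all add: trans_0 trans_Suc)

text \<open>Fullness of evaluation. Naturality passes to composites and, by monoidality, to block
  sums and swaps, so \<open>mat_induct\<close> leaves the five structure matrices; for these it is
  exactly the five equations of a Hopf monoid homomorphism.\<close>

lemma extend_mnt:
  assumes hom: "hopf_monoid_hom C eval G.eval f"
  shows "monoidal_nat_trans MatZ C F G (extend f)" and "extend f 1 = f"
proof -
  have f [simp]: "f \<in> Arr C" "Dom C f = k 1" "Cod C f = G.k 1"
    using hom by (simp_all add: hopf_monoid_hom_def eval_def G.eval_def)
  have t [simp]: "extend f n \<in> Arr C" "Dom C (extend f n) = k n" "Cod C (extend f n) = G.k n" for n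
    by (induction n) (simp_all add: plus_1_eq_Suc)
  have Suc: "extend f (Suc n) \<cdot> \<phi> 1 n = G.\<phi> 1 n \<cdot> (f \<otimes>\<^sub>a extend f n)" for n
    by (simp add: assoc plus_1_eq_Suc)
  \<comment> \<open>Not definitional, because the recursion starts at \<open>0\<close>:
    \<open>extend f 1\<close> is \<open>f \<otimes> extend f 0\<close> conjugated by structure maps.
    The arrow cancelled is the right unitor by \<open>mult_runit\<close>, whose naturality gives the
    equation.\<close>
  show 1: "extend f 1 = f"
  proof (rule iso_epi[of "\<phi> 1 0 \<cdot> (\<ii> (k 1) \<otimes>\<^sub>a \<phi>\<^sub>0)"])
    have "extend f 1 \<cdot> \<phi> 1 0 \<cdot> (\<ii> (k 1) \<otimes>\<^sub>a \<phi>\<^sub>0) = G.\<phi> 1 0 \<cdot> (f \<otimes>\<^sub>a G.\<phi>\<^sub>0)"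
      using comp_cong2[OF Suc[of 0], of "\<ii> (k 1) \<otimes>\<^sub>a \<phi>\<^sub>0"] by (simp add: ich assoc One_nat_def)
    also have "\<dots> = (G.\<phi> 1 0 \<cdot> (\<ii> (G.k 1) \<otimes>\<^sub>a G.\<phi>\<^sub>0)) \<cdot> (f \<otimes>\<^sub>a \<ii> \<I>)"
      by (simp add: ich assoc)
    also have "\<dots> = f \<cdot> \<phi> 1 0 \<cdot> (\<ii> (k 1) \<otimes>\<^sub>a \<phi>\<^sub>0)"
      unfolding G.mult_runit mult_runit by (simp add: runit_nat)
    finally show "extend f 1 \<cdot> \<phi> 1 0 \<cdot> (\<ii> (k 1) \<otimes>\<^sub>a \<phi>\<^sub>0) = f \<cdot> \<phi> 1 0 \<cdot> (\<ii> (k 1) \<otimes>\<^sub>a \<phi>\<^sub>0)" .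
  qed (simp_all add: mult_runit del: extend.simps)
  \<comment> \<open>The recursion peels factors off on the left, so the induction is on
    \<open>m\<close>. Precomposing with \<open>\<phi> 1 m\<close> and reassociating by
    \<open>mult_assc\<close> in both algebras reduces \<open>Suc m\<close> to the hypothesis for
    \<open>m\<close>.\<close>
  have mult: "extend f (m + n) \<cdot> \<phi> m n = G.\<phi> m n \<cdot> (extend f m \<otimes>\<^sub>a extend f n)" for m n
  proof (induction m)
    case 0
    show ?case (is "?f = ?g")
    proof (rule iso_epi[of "\<phi>\<^sub>0 \<otimes>\<^sub>a \<ii> (k n)"])
      have "?g \<cdot> (\<phi>\<^sub>0 \<otimes>\<^sub>a \<ii> (k n)) = (G.\<phi> 0 n \<cdot> (G.\<phi>\<^sub>0 \<otimes>\<^sub>a \<ii> (G.k n))) \<cdot> (\<ii> \<I> \<otimes>\<^sub>a extend f n)"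
        by (simp add: ich assoc)
      also have "\<dots> = ?f \<cdot> (\<phi>\<^sub>0 \<otimes>\<^sub>a \<ii> (k n))"
        unfolding G.mult_lunit by (simp add: lunit_nat assoc mult_lunit)
      finally show "?f \<cdot> (\<phi>\<^sub>0 \<otimes>\<^sub>a \<ii> (k n)) = ?g \<cdot> (\<phi>\<^sub>0 \<otimes>\<^sub>a \<ii> (k n))" ..
    qed (simp_all add: iso_ide)
  next
    case (Suc m)
    show ?case (is "?f = ?g")
    proof (rule iso_epi[of "\<phi> 1 m \<otimes>\<^sub>a \<ii> (k n)"])
      have "?g \<cdot> (\<phi> 1 m \<otimes>\<^sub>a \<ii> (k n))
          = G.\<phi> (Suc m) n \<cdot> ((extend f (Suc m) \<cdot> \<phi> 1 m) \<otimes>\<^sub>a extend f n)"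
        by (simp add: plus_1_eq_Suc ich assoc del: extend.simps)
      also have "\<dots> = (G.\<phi> (1 + m) n \<cdot> (G.\<phi> 1 m \<otimes>\<^sub>a \<ii> (G.k n))) \<cdot> ((f \<otimes>\<^sub>a extend f m) \<otimes>\<^sub>a extend f n)"
        unfolding \<open>extend f (Suc m) \<cdot> \<phi> 1 m = _\<close> by (simp add: plus_1_eq_Suc ich assoc)
      also have "\<dots> = G.\<phi> 1 (m + n) \<cdot> (\<ii> (G.k 1) \<otimes>\<^sub>a G.\<phi> m n) \<cdot> (\<aa> (G.k 1) (G.k m) (G.k n) \<cdot> ((f \<otimes>\<^sub>a extend f m) \<otimes>\<^sub>a extend f n))"
        unfolding G.mult_assc by (simp add: plus_1_eq_Suc assoc)
      also have "\<dots> = G.\<phi> 1 (m + n) \<cdot> (f \<otimes>\<^sub>a (G.\<phi> m n \<cdot> (extend f m \<otimes>\<^sub>a extend f n))) \<cdot> \<aa> (k 1) (k m) (k n)"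
        by (subst assc_nat) (simp_all add: plus_1_eq_Suc ich)
      also have "\<dots> = (G.\<phi> 1 (m + n) \<cdot> (f \<otimes>\<^sub>a extend f (m + n))) \<cdot> (\<ii> (k 1) \<otimes>\<^sub>a \<phi> m n) \<cdot> \<aa> (k 1) (k m) (k n)"
        unfolding Suc[symmetric] by (simp add: plus_1_eq_Suc ich assoc)
      also have "\<dots> = extend f (Suc (m + n)) \<cdot> \<phi> 1 (m + n) \<cdot> (\<ii> (k 1) \<otimes>\<^sub>a \<phi> m n) \<cdot> \<aa> (k 1) (k m) (k n)"
        unfolding \<open>\<And>n. extend f (Suc n) \<cdot> \<phi> 1 n = _\<close>[symmetric] by (simp add: plus_1_eq_Suc assoc del: extend.simps)
      also have "\<dots> = ?f \<cdot> (\<phi> 1 m \<otimes>\<^sub>a \<ii> (k n))"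
        unfolding mult_assc[symmetric] by (simp add: plus_1_eq_Suc assoc del: extend.simps)
      finally show "?f \<cdot> (\<phi> 1 m \<otimes>\<^sub>a \<ii> (k n)) = ?g \<cdot> (\<phi> 1 m \<otimes>\<^sub>a \<ii> (k n))" ..
    qed (simp_all add: plus_1_eq_Suc iso_ide del: extend.simps)
  qed
  have t2: "extend f 2 \<cdot> \<phi> 1 1 = G.\<phi> 1 1 \<cdot> (f \<otimes>\<^sub>a f)"
    using mult[of 1 1] by (simp add: 1 del: extend.simps)
  have nat: "extend f (dim_row M) \<cdot> K M = G.K M \<cdot> extend f (dim_col M)" for M
  proof (induction M rule: mat_induct)
    case (mult M N)
    have "extend f (dim_row N) \<cdot> K (N * M) = (extend f (dim_row N) \<cdot> K N) \<cdot> K M"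
      using mult(3) by (simp add: assoc K_mult)
    also have "\<dots> = G.K N \<cdot> extend f (dim_row M) \<cdot> K M"
      unfolding mult(2) using mult(3) by (simp add: assoc)
    also have "\<dots> = G.K (N * M) \<cdot> extend f (dim_col M)"
      unfolding mult(1) using mult(3) by (simp add: G.K_mult_comp)
    finally show ?case by simp
  next
    case (dsum M N)
    show ?case (is "?f = ?g")
    proof (rule iso_epi[of "\<phi> (dim_col M) (dim_col N)"])
      have "?f \<cdot> \<phi> (dim_col M) (dim_col N)
        = (extend f (dim_row M + dim_row N) \<cdot> \<phi> (dim_row M) (dim_row N)) \<cdot> (K M \<otimes>\<^sub>a K N)"
        by (simp add: assoc mult_nat)
      also have "\<dots> = (G.\<phi> (dim_row M) (dim_row N) \<cdot> (G.K M \<otimes>\<^sub>a G.K N)) \<cdot> (extend f (dim_col M) \<otimes>\<^sub>a extend f (dim_col N))"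
        unfolding mult by (simp add: ich assoc dsum)
      also have "\<dots> = ?g \<cdot> \<phi> (dim_col M) (dim_col N)"
        by (simp add: G.mult_nat assoc mult)
      finally show "?f \<cdot> \<phi> (dim_col M) (dim_col N) = ?g \<cdot> \<phi> (dim_col M) (dim_col N)" .
    qed simp_all
  next
    case (swap m n)
    show ?case (is "?f = ?g")
    proof (rule iso_epi[of "\<phi> m n"])
      have "?f \<cdot> \<phi> m n = (extend f (n + m) \<cdot> \<phi> n m) \<cdot> \<ss> (k m) (k n)"
        by (simp add: assoc mult_symm)
      also have "\<dots> = (G.\<phi> n m \<cdot> \<ss> (G.k m) (G.k n)) \<cdot> (extend f m \<otimes>\<^sub>a extend f n)"
        unfolding mult by (simp add: assoc symm_nat)
      also have "\<dots> = ?g \<cdot> \<phi> m n"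
        unfolding G.mult_symm by (simp add: assoc mult add.commute)
      finally show "?f \<cdot> \<phi> m n = ?g \<cdot> \<phi> m n" .
    qed (simp_all add: add.commute)
  next
    case add
    have "f \<cdot> K gen_add \<cdot> \<phi> 1 1 = G.K gen_add \<cdot> G.\<phi> 1 1 \<cdot> (f \<otimes>\<^sub>a f)"
      using hom by (simp add: hopf_monoid_hom_def eval_def G.eval_def assoc)
    then have "(f \<cdot> K gen_add) \<cdot> \<phi> 1 1 = (G.K gen_add \<cdot> extend f 2) \<cdot> \<phi> 1 1"
      by (simp add: assoc t2)
    then have "f \<cdot> K gen_add = G.K gen_add \<cdot> extend f 2"
      by (rule iso_epi[rotated]) simp_all
    then show ?case by (simp add: 1 del: extend.simps)
  next
    case zero
    have "f \<cdot> K gen_zero \<cdot> \<phi>\<^sub>0 = G.K gen_zero \<cdot> G.\<phi>\<^sub>0"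
      using hom by (simp add: hopf_monoid_hom_def eval_def G.eval_def)
    then have "(f \<cdot> K gen_zero) \<cdot> \<phi>\<^sub>0 = (G.K gen_zero \<cdot> extend f 0) \<cdot> \<phi>\<^sub>0"
      by (simp add: assoc)
    then have "f \<cdot> K gen_zero = G.K gen_zero \<cdot> extend f 0"
      by (rule iso_epi[rotated]) simp_all
    then show ?case by (simp add: 1)
  next
    case dup
    have "inv_arr C (G.\<phi> 1 1) \<cdot> G.K gen_copy \<cdot> f = (f \<otimes>\<^sub>a f) \<cdot> inv_arr C (\<phi> 1 1) \<cdot> K gen_copy"
      using hom by (simp add: hopf_monoid_hom_def eval_def G.eval_def assoc)
    then have "G.\<phi> 1 1 \<cdot> inv_arr C (G.\<phi> 1 1) \<cdot> G.K gen_copy \<cdot> f = (G.\<phi> 1 1 \<cdot> (f \<otimes>\<^sub>a f)) \<cdot> inv_arr C (\<phi> 1 1) \<cdot> K gen_copy"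
      by (simp add: assoc)
    then show ?case
      unfolding t2[symmetric] by (simp add: assoc 1 del: extend.simps)
  next
    case del
    have "inv_arr C G.\<phi>\<^sub>0 \<cdot> G.K gen_del \<cdot> f = inv_arr C \<phi>\<^sub>0 \<cdot> K gen_del"
      using hom by (simp add: hopf_monoid_hom_def eval_def G.eval_def assoc)
    then have "G.\<phi>\<^sub>0 \<cdot> inv_arr C G.\<phi>\<^sub>0 \<cdot> G.K gen_del \<cdot> f = G.\<phi>\<^sub>0 \<cdot> inv_arr C \<phi>\<^sub>0 \<cdot> K gen_del"
      by (simp only:)
    then show ?case
      by (simp add: assoc 1)
  next
    case neg
    have "f \<cdot> K gen_neg = G.K gen_neg \<cdot> f"
      using hom by (simp add: hopf_monoid_hom_def eval_def G.eval_def)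
    then show ?case by (simp add: 1 del: extend.simps)
  qed simp
  show "monoidal_nat_trans MatZ C F G (extend f)"
    unfolding monoidal_nat_trans_iff using strong G.strong nat mult
    by (simp del: extend.simps add: extend.simps(1) assoc)
qed

end

context symmetric_monoidal_category
begin

lemma hopf_hom_inverse:
  assumes hom: "hopf_monoid_hom C H H' f" and inv: "inverse_arrows C f g"
  shows "hopf_monoid_hom C H' H g"
proof -
  obtain A \<mu> \<eta> \<Delta> \<epsilon> S where H: "H = \<lparr>hopf_obj = A, hopf_mult = \<mu>, hopf_unit = \<eta>, hopf_comult = \<Delta>, hopf_counit = \<epsilon>, hopf_antipode = S\<rparr>"
    by (cases H) auto
  obtain A' \<mu>' \<eta>' \<Delta>' \<epsilon>' S' where H': "H' = \<lparr>hopf_obj = A', hopf_mult = \<mu>', hopf_unit = \<eta>', hopf_comult = \<Delta>', hopf_counit = \<epsilon>', hopf_antipode = S'\<rparr>"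
    by (cases H') auto
  have hopf: "bicommutative_hopf_monoid C H" "bicommutative_hopf_monoid C H'"
    using hom by (simp_all add: hopf_monoid_hom_def)
  interpret H: hopf_object C A \<mu> \<eta> \<Delta> \<epsilon> S
    using hopf(1) by (simp add: H bicommutative_hopf_monoid_def hopf_object_def hopf_object_axioms_def)
  interpret H': hopf_object C A' \<mu>' \<eta>' \<Delta>' \<epsilon>' S'
    using hopf(2) by (simp add: H' bicommutative_hopf_monoid_def hopf_object_def hopf_object_axioms_def)
  have f: "f \<in> Arr C" "Dom C f = A" "Cod C f = A'"
    and eqs: "\<mu>' \<cdot> (f \<otimes>\<^sub>a f) = f \<cdot> \<mu>" "f \<cdot> \<eta> = \<eta>'" "\<Delta>' \<cdot> f = (f \<otimes>\<^sub>a f) \<cdot> \<Delta>" "\<epsilon>' \<cdot> f = \<epsilon>" "f \<cdot> S = S' \<cdot> f"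
    using hom by (simp_all add: hopf_monoid_hom_def H H')
  have g: "g \<in> Arr C" "Dom C g = A'" "Cod C g = A" "g \<cdot> f = \<ii> A" "f \<cdot> g = \<ii> A'"
    using inv f by (simp_all add: inverse_arrows_def)
  note [simp] = f g
  have gf: "g \<cdot> f \<cdot> h = h" if "h \<in> Arr C" "Cod C h = A" for h
    using that by (simp add: comp_cong)
  have "g \<cdot> \<mu>' = g \<cdot> (\<mu>' \<cdot> (f \<otimes>\<^sub>a f)) \<cdot> (g \<otimes>\<^sub>a g)"
    by (simp add: ich assoc)
  also have "\<dots> = \<mu> \<cdot> (g \<otimes>\<^sub>a g)"
    unfolding eqs by (simp add: assoc gf)
  finally have 1: "\<mu> \<cdot> (g \<otimes>\<^sub>a g) = g \<cdot> \<mu>'" ..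
  have 2: "g \<cdot> \<eta>' = \<eta>"
    by (simp add: gf flip: eqs)
  have "\<Delta> \<cdot> g = (g \<otimes>\<^sub>a g) \<cdot> ((f \<otimes>\<^sub>a f) \<cdot> \<Delta>) \<cdot> g"
    by (simp add: ich assoc)
  also have "\<dots> = (g \<otimes>\<^sub>a g) \<cdot> \<Delta>'"
    unfolding eqs[symmetric] by (simp add: assoc)
  finally have 3: "\<Delta> \<cdot> g = (g \<otimes>\<^sub>a g) \<cdot> \<Delta>'" .
  have 4: "\<epsilon> \<cdot> g = \<epsilon>'"
    unfolding eqs(4)[symmetric] by (simp add: assoc)
  have "g \<cdot> S' = g \<cdot> (S' \<cdot> f) \<cdot> g"
    by (simp add: assoc)
  also have "\<dots> = S \<cdot> g"
    unfolding eqs[symmetric] by (simp add: assoc gf)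
  finally show ?thesis
    using 1 2 3 4 hopf by (simp add: hopf_monoid_hom_def H H')
qed

end

section \<open>Recovering a Hopf monoid from its algebra\<close>

context hopf_object
begin

lemma matz_algebra_hopf_functor: "matz_algebra C hopf_functor"
  using strong_hopf_functor symmetric_monoidal_category_axioms
  by (simp add: matz_algebra_def matz_algebra_axioms_def)

text \<open>The first power is \<open>A \<otimes> \<I>\<close>, and its single projection is the
  right unitor. Each structure matrix acts on components by the corresponding group operation, so
  the projection carries the evaluated structure to the given one.\<close>

lemma hopf_hom_runit:
  "hopf_monoid_hom C (matz_algebra.eval C hopf_functor)
     \<lparr>hopf_obj = A, hopf_mult = \<mu>, hopf_unit = \<eta>, hopf_comult = \<Delta>, hopf_counit = \<epsilon>, hopf_antipode = S\<rparr> (\<rr> A)"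
proof -
  interpret E: matz_algebra C hopf_functor by (rule matz_algebra_hopf_functor)
  have sel [simp]: "on_obj hopf_functor n = cobj (P n)" "on_arr hopf_functor = marr" "ftr_mult hopf_functor (m, n) = pmult m n"
    "ftr_unit hopf_functor = \<ii> \<I>" for m n
    by (simp_all add: hopf_functor_def)
  let ?r = "p 1 0"
  have r: "?r = \<rr> A"
    by (simp add: cfst_def One_nat_def)
  have P1: "P 1 = ctens B cunit"
    by (simp add: One_nat_def)
  have ch: "chom (P 1) B ?r"
    by (rule chom_proj) simp_all
  let ?W = "ctens (P 1) (P 1)"
  interpret W: comm_group "hom_group ?W" by (rule comm_group_hom_group) simp
  interpret V: comm_group "hom_group (P 1)" by (rule comm_group_hom_group) simp
  interpret U: comm_group "hom_group cunit" by (rule comm_group_hom_group) simp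
  have x: "chom ?W B (?r \<cdot> cfst (P 1) (P 1))" "chom ?W B (?r \<cdot> csnd (P 1) (P 1))"
    by (auto intro: chom_comp[OF chom_cfst ch] chom_comp[OF chom_csnd ch])
  \<comment> \<open>Both coefficients are 1, so the combination is the convolution of the two
    projections, and pairing them gives the identity of the product.\<close>
  have "?r \<cdot> marr gen_add \<cdot> pmult 1 1 = comb ?W 2 (\<lambda>j. gen_add $$ (0, j)) (\<lambda>j. p 2 j \<cdot> pmult 1 1)"
    using proj_marr[of 0 gen_add ?W "pmult 1 1"] chom_pmult[of 1 1] by simp
  also have "\<dots> = conv ?W (?r \<cdot> cfst (P 1) (P 1)) (?r \<cdot> csnd (P 1) (P 1))"
    using proj_pmult[of 0 1 1] proj_pmult[of 1 1 1] x by (subst W.int_comb_two) simp_all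
  also have "\<dots> = \<mu> \<cdot> (?r \<otimes>\<^sub>a ?r) \<cdot> cpair ?W (cfst (P 1) (P 1)) (csnd (P 1) (P 1))"
    by (simp add: conv_def tensor_cpair) (simp add: cpair_def)
  also have "\<dots> = \<mu> \<cdot> (?r \<otimes>\<^sub>a ?r)"
    by (simp add: cpair_proj)
  finally have 1: "\<mu> \<cdot> (?r \<otimes>\<^sub>a ?r) = ?r \<cdot> marr gen_add \<cdot> pmult 1 1" ..
  have 2: "?r \<cdot> marr gen_zero = \<eta>"
    using proj_marr_ide[of 0 gen_zero] by simp
  \<comment> \<open>The inverse of \<open>pmult\<close> in the evaluated comultiplication cancels
    once the copying matrix is recognised as the comultiplication of \<open>P 1\<close> followed by
    concatenation; both have the unique projection in each component.\<close>
  have dup: "marr gen_copy = pmult 1 1 \<cdot> comul (P 1)"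
  proof (rule cpow_ext[of "P 1" B 2])
    show "chom (P 1) (P 2) (marr gen_copy)"
      by (rule chom_marr) simp_all
    show "chom (P 1) (P 2) (pmult 1 1 \<cdot> comul (P 1))"
      using chom_comp[OF chom_comul_arrow chom_pmult[of 1 1]] by simp
    fix i :: nat assume i: "i < 2"
    have "p 2 i \<cdot> marr gen_copy = ?r"
      using proj_marr_ide[of i gen_copy] i ch by (simp add: V.int_comb_single)
    moreover have "cfst (P 1) (P 1) \<cdot> comul (P 1) = \<ii> (cobj (P 1))" "csnd (P 1) (P 1) \<cdot> comul (P 1) = \<ii> (cobj (P 1))"
      using cfst_cpair[OF chom_ide chom_ide, of "P 1"] csnd_cpair[OF chom_ide chom_ide, of "P 1"]
      by (simp_all add: cpair_def)
    then have "p 2 i \<cdot> pmult 1 1 \<cdot> comul (P 1) = ?r"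
      using i proj_pmult_comp[of i 1 1 "comul (P 1)"] by (auto simp: less_2_cases_iff)
    ultimately show "p 2 i \<cdot> marr gen_copy = p 2 i \<cdot> pmult 1 1 \<cdot> comul (P 1)"
      by simp
  qed simp
  have 3: "\<Delta> \<cdot> ?r = (?r \<otimes>\<^sub>a ?r) \<cdot> inv_arr C (pmult 1 1) \<cdot> marr gen_copy"
    using chom_comul[OF ch] by (simp add: dup)
  have "marr gen_del = coun (P 1)"
    by (simp add: marr_def)
  then have 4: "\<epsilon> \<cdot> ?r = marr gen_del"
    using chom_simps(6)[OF ch] by simp
  \<comment> \<open>The coefficient -1 is inversion in the convolution group, and
    \<open>conv_inverse\<close> identifies the inverse of \<open>?r\<close> with
    \<open>S \<cdot> ?r\<close>.\<close>
  have "?r \<cdot> marr gen_neg = ?r [^]\<^bsub>hom_group (P 1)\<^esub> (- 1 :: int)"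
    using proj_marr_ide[of 0 gen_neg] ch by (simp add: V.int_comb_single)
  also have "\<dots> = inv\<^bsub>hom_group (P 1)\<^esub> ?r"
    using ch V.int_pow_neg[of ?r 1] by simp
  also have "\<dots> = S \<cdot> ?r"
    using conv_inverse[OF ch] ch chom_comp[OF ch chom_antipode] by (intro V.inv_equality) simp_all
  finally have 5: "?r \<cdot> marr gen_neg = S \<cdot> ?r" .
  have H: "bicommutative_hopf_monoid C \<lparr>hopf_obj = A, hopf_mult = \<mu>, hopf_unit = \<eta>, hopf_comult = \<Delta>, hopf_counit = \<epsilon>, hopf_antipode = S\<rparr>"
    using bicommutative_bimonoid_axioms antipode_left antipode_right by (simp add: bicommutative_hopf_monoid_def)
  show ?thesis
    using 1 2 3 4 5 H E.hopf_eval unfolding hopf_monoid_hom_def r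
    by (simp add: E.eval_def P1)
qed

end

section \<open>The equivalence of categories\<close>

text \<open>A fully faithful, essentially surjective functor has a quasi-inverse by choice.
  Equations in \<open>A\<close> are verified after applying \<open>F\<close> and pulled back by
  faithfulness.\<close>

lemma equivalent_categoriesI:
  fixes A :: "('o, 'a, 'x) cat_scheme" and B :: "('p, 'b, 'y) cat_scheme" and F :: "('o, 'a, 'p, 'b) ftr"
  assumes F: "is_functor A B F"
    and faithful: "\<And>a a' f g. f \<in> homset A a a' \<Longrightarrow> g \<in> homset A a a' \<Longrightarrow> on_arr F f = on_arr F g \<Longrightarrow> f = g"
    and full: "\<And>a a' h. a \<in> Obj A \<Longrightarrow> a' \<in> Obj A \<Longrightarrow> h \<in> homset B (on_obj F a) (on_obj F a') \<Longrightarrow>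
      \<exists>f \<in> homset A a a'. on_arr F f = h"
    and surj: "\<And>b. b \<in> Obj B \<Longrightarrow> \<exists>a \<in> Obj A. \<exists>e \<in> homset B (on_obj F a) b. iso_arr B e"
  shows "equivalent_categories A B"
proof -
  interpret A: category A using F by (simp add: is_functor_def)
  interpret B: category B using F by (simp add: is_functor_def)
  have F_simps [simp]: "a \<in> Obj A \<Longrightarrow> on_obj F a \<in> Obj B"
    "f \<in> Arr A \<Longrightarrow> on_arr F f \<in> Arr B" "f \<in> Arr A \<Longrightarrow> Dom B (on_arr F f) = on_obj F (Dom A f)"
    "f \<in> Arr A \<Longrightarrow> Cod B (on_arr F f) = on_obj F (Cod A f)"
    "a \<in> Obj A \<Longrightarrow> on_arr F (ide A a) = ide B (on_obj F a)"
    "f \<in> Arr A \<Longrightarrow> g \<in> Arr A \<Longrightarrow> Cod A f = Dom A g \<Longrightarrow> on_arr F (g \<cdot>\<^bsub>A\<^esub> f) = on_arr F g \<cdot>\<^bsub>B\<^esub> on_arr F f" for a f g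
    using F by (simp_all add: is_functor_def)
  have "\<exists>ob e. \<forall>b \<in> Obj B. ob b \<in> Obj A \<and> e b \<in> homset B (on_obj F (ob b)) b \<and> iso_arr B (e b)"
    using surj by metis
  then obtain ob e where ob [simp]: "\<And>b. b \<in> Obj B \<Longrightarrow> ob b \<in> Obj A"
    and e [simp]: "\<And>b. b \<in> Obj B \<Longrightarrow> iso_arr B (e b)" "\<And>b. b \<in> Obj B \<Longrightarrow> Dom B (e b) = on_obj F (ob b)"
      "\<And>b. b \<in> Obj B \<Longrightarrow> Cod B (e b) = b"
    by auto
  \<comment> \<open>The endpoints are arguments of \<open>lift\<close>, because one arrow of
    \<open>B\<close> may have preimages between several pairs of objects.\<close>
  have "\<exists>lift. \<forall>a a' h. a \<in> Obj A \<longrightarrow> a' \<in> Obj A \<longrightarrow> h \<in> homset B (on_obj F a) (on_obj F a') \<longrightarrow>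
      lift a a' h \<in> homset A a a' \<and> on_arr F (lift a a' h) = h"
    using full by metis
  then obtain lift where lift: "\<And>a a' h. a \<in> Obj A \<Longrightarrow> a' \<in> Obj A \<Longrightarrow> h \<in> homset B (on_obj F a) (on_obj F a') \<Longrightarrow>
      lift a a' h \<in> homset A a a' \<and> on_arr F (lift a a' h) = h"
    by metis
  \<comment> \<open>Forced by naturality of \<open>e\<close>: the image under \<open>F\<close> of
    \<open>G h\<close> must be \<open>h\<close> conjugated by \<open>e\<close>.\<close>
  define conj where "conj h = inv_arr B (e (Cod B h)) \<cdot>\<^bsub>B\<^esub> h \<cdot>\<^bsub>B\<^esub> e (Dom B h)" for h
  define G :: "('p, 'b, 'o, 'a) ftr" where
    "G = \<lparr>on_obj = ob, on_arr = (\<lambda>h. lift (ob (Dom B h)) (ob (Cod B h)) (conj h))\<rparr>"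
  have G_obj [simp]: "on_obj G = ob"
    by (simp add: G_def)
  have conj: "conj h \<in> homset B (on_obj F (ob (Dom B h))) (on_obj F (ob (Cod B h)))" if "h \<in> Arr B" for h
    using that by (simp add: conj_def)
  have G [simp]: "on_arr G h \<in> Arr A" "Dom A (on_arr G h) = ob (Dom B h)" "Cod A (on_arr G h) = ob (Cod B h)"
    "on_arr F (on_arr G h) = conj h" if "h \<in> Arr B" for h
    using lift[OF _ _ conj[OF that]] that by (simp_all add: G_def)
  have GF: "is_functor B A G"
    unfolding is_functor_def
  proof (intro conjI ballI impI)
    fix b assume "b \<in> Obj B"
    then show "on_arr G (ide B b) = ide A (on_obj G b)"
      by (intro faithful[of _ "ob b" "ob b"]) (simp_all add: conj_def)
  next
    fix f g assume "f \<in> Arr B" "g \<in> Arr B" "Cod B f = Dom B g"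
    then show "on_arr G (g \<cdot>\<^bsub>B\<^esub> f) = on_arr G g \<cdot>\<^bsub>A\<^esub> on_arr G f"
      by (intro faithful[of _ "ob (Dom B f)" "ob (Cod B g)"]) (simp_all add: conj_def B.assoc)
  qed (simp_all add: A.category_axioms B.category_axioms)
  \<comment> \<open>The component at \<open>a\<close> lifts the inverse of \<open>e\<close> at
    \<open>F a\<close>. A lift of \<open>e\<close> itself will be its inverse, by
    faithfulness.\<close>
  define s where "s a = lift a (ob (on_obj F a)) (inv_arr B (e (on_obj F a)))" for a
  have s [simp]: "s a \<in> Arr A" "Dom A (s a) = a" "Cod A (s a) = ob (on_obj F a)"
    "on_arr F (s a) = inv_arr B (e (on_obj F a))" if "a \<in> Obj A" for a
    using lift[of a "ob (on_obj F a)" "inv_arr B (e (on_obj F a))"] that by (simp_all add: s_def)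
  have "iso_arr A (s a)" if a: "a \<in> Obj A" for a
  proof -
    obtain r where r: "r \<in> homset A (ob (on_obj F a)) a" "on_arr F r = e (on_obj F a)"
      using full[of "ob (on_obj F a)" a "e (on_obj F a)"] a by auto
    have "r \<cdot>\<^bsub>A\<^esub> s a = ide A a"
      by (rule faithful[of _ a a]) (use a r in simp_all)
    moreover have "s a \<cdot>\<^bsub>A\<^esub> r = ide A (ob (on_obj F a))"
      by (rule faithful[of _ "ob (on_obj F a)" "ob (on_obj F a)"]) (use a r in simp_all)
    ultimately have "inverse_arrows A (s a) r"
      using a r by (simp add: inverse_arrows_def)
    then show ?thesis
      unfolding iso_arr_def by blast
  qed
  moreover have "nat_trans A A id_ftr (comp_ftr G F) s"
    unfolding nat_trans_def
  proof (intro conjI ballI)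
    show "is_functor A A id_ftr"
      by (simp add: is_functor_def id_ftr_def A.category_axioms)
    show "is_functor A A (comp_ftr G F)"
      using GF by (simp add: is_functor_def comp_ftr_def A.category_axioms)
    fix f assume "f \<in> Arr A"
    then show "s (Cod A f) \<cdot>\<^bsub>A\<^esub> on_arr id_ftr f = on_arr (comp_ftr G F) f \<cdot>\<^bsub>A\<^esub> s (Dom A f)"
      by (intro faithful[of _ "Dom A f" "ob (on_obj F (Cod A f))"])
        (simp_all add: id_ftr_def comp_ftr_def conj_def B.assoc)
  qed (simp_all add: id_ftr_def comp_ftr_def)
  ultimately have 1: "nat_iso A A id_ftr (comp_ftr G F) s"
    by (simp add: nat_iso_def)
  have "nat_trans B B (comp_ftr F G) id_ftr e"
    unfolding nat_trans_def
  proof (intro conjI ballI)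
    show "is_functor B B id_ftr"
      by (simp add: is_functor_def id_ftr_def B.category_axioms)
    show "is_functor B B (comp_ftr F G)"
      using GF conj by (simp add: is_functor_def comp_ftr_def B.category_axioms)
    fix f assume "f \<in> Arr B"
    then show "e (Cod B f) \<cdot>\<^bsub>B\<^esub> on_arr (comp_ftr F G) f = on_arr id_ftr f \<cdot>\<^bsub>B\<^esub> e (Dom B f)"
      by (simp add: id_ftr_def comp_ftr_def conj_def)
  qed (simp_all add: id_ftr_def comp_ftr_def)
  then have 2: "nat_iso B B (comp_ftr F G) id_ftr e"
    by (simp add: nat_iso_def)
  show ?thesis
    unfolding equivalent_categories_def using F GF 1 2 by blast
qed

section \<open>Evaluation at 1 as an equivalence\<close>

context symmetric_monoidal_category
begin

lemma matz_algebraI: "strong_symmetric_monoidal_functor MatZ C F \<Longrightarrow> matz_algebra C F"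
  by (simp add: matz_algebra_def matz_algebra_axioms_def symmetric_monoidal_category_axioms)

lemma matz_algebra_pairI:
  "strong_symmetric_monoidal_functor MatZ C F \<Longrightarrow> strong_symmetric_monoidal_functor MatZ C G \<Longrightarrow> matz_algebra_pair C F G"
  by (simp add: matz_algebra_pair_def matz_algebraI)

lemma algebra_category_simps [simp]:
  "Obj (algebra_category MatZ C) = {F. strong_symmetric_monoidal_functor MatZ C F}"
  "(F, G, t) \<in> Arr (algebra_category MatZ C) \<longleftrightarrow> monoidal_nat_trans MatZ C F G t"
  "Dom (algebra_category MatZ C) (F, G, t) = F" "Cod (algebra_category MatZ C) (F, G, t) = G"
  "ide (algebra_category MatZ C) F = (F, F, \<lambda>n. \<ii> (on_obj F n))"
  "(G', H, u) \<cdot>\<^bsub>algebra_category MatZ C\<^esub> (F, G, t) = (F, H, \<lambda>n. u n \<cdot> t n)"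
  by (simp_all add: algebra_category_def restrict_UNIV)

lemma hopf_category_simps [simp]:
  "Obj (hopf_category C) = {H. bicommutative_hopf_monoid C H}"
  "(H, H', f) \<in> Arr (hopf_category C) \<longleftrightarrow> hopf_monoid_hom C H H' f"
  "Dom (hopf_category C) (H, H', f) = H" "Cod (hopf_category C) (H, H', f) = H'"
  "ide (hopf_category C) H = (H, H, \<ii> (hopf_obj H))"
  "(H', H'', g) \<cdot>\<^bsub>hopf_category C\<^esub> (K, K', f) = (K, H'', g \<cdot> f)"
  by (simp_all add: hopf_category_def)

lemma monoidal_nat_trans_ide:
  assumes "strong_symmetric_monoidal_functor MatZ C F"
  shows "monoidal_nat_trans MatZ C F F (\<lambda>n. \<ii> (on_obj F n))"
proof -
  interpret matz_algebra C F by (rule matz_algebraI[OF assms])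
  show ?thesis
    using assms by (simp add: monoidal_nat_trans_iff)
qed

lemma monoidal_nat_trans_comp:
  assumes t: "monoidal_nat_trans MatZ C F G t" and u: "monoidal_nat_trans MatZ C G H u"
  shows "monoidal_nat_trans MatZ C F H (\<lambda>n. u n \<cdot> t n)"
proof -
  have str: "strong_symmetric_monoidal_functor MatZ C F" "strong_symmetric_monoidal_functor MatZ C G" "strong_symmetric_monoidal_functor MatZ C H"
    using assms by (simp_all add: monoidal_nat_trans_iff)
  interpret FG: matz_algebra_pair C F G by (rule matz_algebra_pairI[OF str(1,2)])
  interpret GH: matz_algebra_pair C G H by (rule matz_algebra_pairI[OF str(2,3)])
  note [simp] = FG.trans_simps[OF t] GH.trans_simps[OF u]
  show ?thesis
    using str
    by (simp add: monoidal_nat_trans_iff assoc ich FG.trans_nat[OF t] FG.trans_mult[OF t] FG.trans_unit[OF t]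
        GH.trans_unit[OF u] comp_cong2[OF GH.trans_nat[OF u]] comp_cong2[OF GH.trans_mult[OF u]])
qed

lemma hopf_monoid_arrows:
  assumes "bicommutative_hopf_monoid C H"
  shows "hopf_obj H \<in> Obj C" "hopf_mult H \<in> homset C (hopf_obj H \<otimes>\<^sub>o hopf_obj H) (hopf_obj H)"
    "hopf_unit H \<in> homset C \<I> (hopf_obj H)" "hopf_comult H \<in> homset C (hopf_obj H) (hopf_obj H \<otimes>\<^sub>o hopf_obj H)"
    "hopf_counit H \<in> homset C (hopf_obj H) \<I>" "hopf_antipode H \<in> homset C (hopf_obj H) (hopf_obj H)"
  using assms
  by (simp_all add: bicommutative_hopf_monoid_def Let_def bicommutative_bimonoid_def
      commutative_monoid_def commutative_monoid_axioms_def
      cocommutative_comonoid_def cocommutative_comonoid_axioms_def)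

lemma hopf_hom_ide: "bicommutative_hopf_monoid C H \<Longrightarrow> hopf_monoid_hom C H H (\<ii> (hopf_obj H))"
  using hopf_monoid_arrows[of H] by (simp add: hopf_monoid_hom_def)

lemma hopf_hom_comp:
  assumes "hopf_monoid_hom C H H' f" "hopf_monoid_hom C H' H'' g"
  shows "hopf_monoid_hom C H H'' (g \<cdot> f)"
proof -
  have hopf: "bicommutative_hopf_monoid C H" "bicommutative_hopf_monoid C H'" "bicommutative_hopf_monoid C H''"
    using assms by (simp_all add: hopf_monoid_hom_def)
  note [simp] = hopf_monoid_arrows[OF hopf(1), unfolded homset_iff] hopf_monoid_arrows[OF hopf(2), unfolded homset_iff]
    hopf_monoid_arrows[OF hopf(3), unfolded homset_iff]
  have f [simp]: "f \<in> Arr C" "Dom C f = hopf_obj H" "Cod C f = hopf_obj H'"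
    and F: "hopf_mult H' \<cdot> (f \<otimes>\<^sub>a f) = f \<cdot> hopf_mult H" "f \<cdot> hopf_unit H = hopf_unit H'"
      "hopf_comult H' \<cdot> f = (f \<otimes>\<^sub>a f) \<cdot> hopf_comult H" "hopf_counit H' \<cdot> f = hopf_counit H"
      "f \<cdot> hopf_antipode H = hopf_antipode H' \<cdot> f"
    using assms(1) by (simp_all add: hopf_monoid_hom_def)
  have g [simp]: "g \<in> Arr C" "Dom C g = hopf_obj H'" "Cod C g = hopf_obj H''"
    and G: "hopf_mult H'' \<cdot> (g \<otimes>\<^sub>a g) = g \<cdot> hopf_mult H'" "g \<cdot> hopf_unit H' = hopf_unit H''"
      "hopf_comult H'' \<cdot> g = (g \<otimes>\<^sub>a g) \<cdot> hopf_comult H'" "hopf_counit H'' \<cdot> g = hopf_counit H'"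
      "g \<cdot> hopf_antipode H' = hopf_antipode H'' \<cdot> g"
    using assms(2) by (simp_all add: hopf_monoid_hom_def)
  have "hopf_mult H'' \<cdot> ((g \<cdot> f) \<otimes>\<^sub>a (g \<cdot> f)) = (hopf_mult H'' \<cdot> (g \<otimes>\<^sub>a g)) \<cdot> (f \<otimes>\<^sub>a f)"
    by (simp add: assoc ich)
  also have "\<dots> = (g \<cdot> f) \<cdot> hopf_mult H"
    unfolding G by (simp add: assoc F)
  finally have 1: "hopf_mult H'' \<cdot> ((g \<cdot> f) \<otimes>\<^sub>a (g \<cdot> f)) = (g \<cdot> f) \<cdot> hopf_mult H" .
  have 3: "hopf_comult H'' \<cdot> g \<cdot> f = ((g \<cdot> f) \<otimes>\<^sub>a (g \<cdot> f)) \<cdot> hopf_comult H"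
    by (simp add: comp_cong2[OF G(3)] F ich)
  have 5: "g \<cdot> f \<cdot> hopf_antipode H = hopf_antipode H'' \<cdot> g \<cdot> f"
    by (simp add: F comp_cong2[OF G(5)])
  show ?thesis
    using hopf 1 3 5 by (simp add: hopf_monoid_hom_def assoc F G comp_cong[OF G(4)])
qed

lemma category_algebra_category: "category (algebra_category MatZ C)"
proof
  fix f assume "f \<in> Arr (algebra_category MatZ C)"
  then show "Dom (algebra_category MatZ C) f \<in> Obj (algebra_category MatZ C)"
    and "Cod (algebra_category MatZ C) f \<in> Obj (algebra_category MatZ C)"
    by (cases f; auto simp: monoidal_nat_trans_iff)+
next
  fix F assume "F \<in> Obj (algebra_category MatZ C)"
  then show "ide (algebra_category MatZ C) F \<in> homset (algebra_category MatZ C) F F"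
    using monoidal_nat_trans_ide by simp
next
  fix F G H f g assume "f \<in> homset (algebra_category MatZ C) F G" "g \<in> homset (algebra_category MatZ C) G H"
  then show "g \<cdot>\<^bsub>algebra_category MatZ C\<^esub> f \<in> homset (algebra_category MatZ C) F H"
    by (cases f; cases g) (auto intro: monoidal_nat_trans_comp)
next
  fix F G f assume "f \<in> homset (algebra_category MatZ C) F G"
  then show "ide (algebra_category MatZ C) G \<cdot>\<^bsub>algebra_category MatZ C\<^esub> f = f"
    and "f \<cdot>\<^bsub>algebra_category MatZ C\<^esub> ide (algebra_category MatZ C) F = f"
    by (cases f; auto simp: monoidal_nat_trans_iff)+
next
  fix F G H L f g h assume "f \<in> homset (algebra_category MatZ C) F G" "g \<in> homset (algebra_category MatZ C) G H"
    "h \<in> homset (algebra_category MatZ C) H L"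
  then show "(h \<cdot>\<^bsub>algebra_category MatZ C\<^esub> g) \<cdot>\<^bsub>algebra_category MatZ C\<^esub> f
      = h \<cdot>\<^bsub>algebra_category MatZ C\<^esub> (g \<cdot>\<^bsub>algebra_category MatZ C\<^esub> f)"
    by (cases f; cases g; cases h) (auto simp: monoidal_nat_trans_iff assoc)
qed

lemma category_hopf_category: "category (hopf_category C)"
proof
  fix f assume "f \<in> Arr (hopf_category C)"
  then show "Dom (hopf_category C) f \<in> Obj (hopf_category C)"
    and "Cod (hopf_category C) f \<in> Obj (hopf_category C)"
    by (cases f; auto simp: hopf_monoid_hom_def)+
next
  fix H assume "H \<in> Obj (hopf_category C)"
  then show "ide (hopf_category C) H \<in> homset (hopf_category C) H H"
    using hopf_hom_ide by simp
next
  fix F G H f g assume "f \<in> homset (hopf_category C) F G" "g \<in> homset (hopf_category C) G H"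
  then show "g \<cdot>\<^bsub>hopf_category C\<^esub> f \<in> homset (hopf_category C) F H"
    by (cases f; cases g) (auto intro: hopf_hom_comp)
next
  fix F G f assume "f \<in> homset (hopf_category C) F G"
  then show "ide (hopf_category C) G \<cdot>\<^bsub>hopf_category C\<^esub> f = f"
    and "f \<cdot>\<^bsub>hopf_category C\<^esub> ide (hopf_category C) F = f"
    by (cases f; auto simp: hopf_monoid_hom_def)+
next
  fix F G H L f g h assume "f \<in> homset (hopf_category C) F G" "g \<in> homset (hopf_category C) G H"
    "h \<in> homset (hopf_category C) H L"
  then show "(h \<cdot>\<^bsub>hopf_category C\<^esub> g) \<cdot>\<^bsub>hopf_category C\<^esub> f = h \<cdot>\<^bsub>hopf_category C\<^esub> (g \<cdot>\<^bsub>hopf_category C\<^esub> f)"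
    by (cases f; cases g; cases h) (auto simp: hopf_monoid_hom_def assoc)
qed

definition eval_functor where
  "eval_functor = \<lparr>on_obj = matz_algebra.eval C,
     on_arr = (\<lambda>(F, G, t). (matz_algebra.eval C F, matz_algebra.eval C G, t (1 :: nat)))\<rparr>"

lemma is_functor_eval: "is_functor (algebra_category MatZ C) (hopf_category C) eval_functor"
proof -
  have hom: "hopf_monoid_hom C (matz_algebra.eval C F) (matz_algebra.eval C G) (t 1)"
    if "monoidal_nat_trans MatZ C F G t" for F G t
    using that by (intro matz_algebra_pair.hopf_hom_eval matz_algebra_pairI) (simp_all add: monoidal_nat_trans_iff)
  have obj: "hopf_obj (matz_algebra.eval C F) = on_obj F 1" if "strong_symmetric_monoidal_functor MatZ C F" for F
    using matz_algebra.eval_def[OF matz_algebraI[OF that]] by simp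
  show ?thesis
    using hom
    by (auto simp: is_functor_def eval_functor_def category_algebra_category category_hopf_category
        matz_algebra.hopf_eval matz_algebraI obj)
qed

lemma equivalent_algebra_hopf: "equivalent_categories (algebra_category MatZ C) (hopf_category C)"
proof (rule equivalent_categoriesI[OF is_functor_eval])
  fix F G f g
  assume "f \<in> homset (algebra_category MatZ C) F G" "g \<in> homset (algebra_category MatZ C) F G"
    and eq: "on_arr eval_functor f = on_arr eval_functor g"
  then obtain t u where f: "f = (F, G, t)" and g: "g = (F, G, u)"
    and t: "monoidal_nat_trans MatZ C F G t" and u: "monoidal_nat_trans MatZ C F G u"
    by (cases f; cases g) auto
  interpret matz_algebra_pair C F G
    using t by (intro matz_algebra_pairI) (simp_all add: monoidal_nat_trans_iff)
  have "t 1 = u 1"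
    using eq by (simp add: f g eval_functor_def)
  then have "t = u"
    using trans_eq_extend[OF t] trans_eq_extend[OF u] by (metis ext)
  then show "f = g"
    by (simp add: f g)
next
  fix F G h
  assume F: "F \<in> Obj (algebra_category MatZ C)" and G: "G \<in> Obj (algebra_category MatZ C)"
    and h: "h \<in> homset (hopf_category C) (on_obj eval_functor F) (on_obj eval_functor G)"
  interpret matz_algebra_pair C F G
    using F G by (intro matz_algebra_pairI) simp_all
  obtain f where f: "h = (eval, G.eval, f)" "hopf_monoid_hom C eval G.eval f"
    using h by (cases h) (auto simp: eval_functor_def)
  show "\<exists>t \<in> homset (algebra_category MatZ C) F G. on_arr eval_functor t = h"
    by (rule bexI[of _ "(F, G, extend f)"]) (use extend_mnt[OF f(2)] in \<open>simp_all add: f eval_functor_def del: extend.simps\<close>)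
next
  fix H assume "H \<in> Obj (hopf_category C)"
  then have H: "bicommutative_hopf_monoid C H" by simp
  interpret H: hopf_object C "hopf_obj H" "hopf_mult H" "hopf_unit H" "hopf_comult H" "hopf_counit H" "hopf_antipode H"
    using H by (simp add: bicommutative_hopf_monoid_def Let_def hopf_object_def hopf_object_axioms_def)
  \<comment> \<open>Essential surjectivity: \<open>?F\<close> evaluates at 1 to a Hopf monoid on
    \<open>hopf_obj H \<otimes> \<I>\<close>, and the right unitor is an isomorphism of Hopf monoids
    from it to \<open>H\<close>.\<close>
  let ?F = H.hopf_functor
  let ?r = "\<rr> (hopf_obj H)"
  have hom: "hopf_monoid_hom C (matz_algebra.eval C ?F) H ?r"
  proof -
    have "\<lparr>hopf_obj = hopf_obj H, hopf_mult = hopf_mult H, hopf_unit = hopf_unit H, hopf_comult = hopf_comult H,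
        hopf_counit = hopf_counit H, hopf_antipode = hopf_antipode H\<rparr> = H"
      by (cases H) simp
    then show ?thesis
      using H.hopf_hom_runit by (simp only:)
  qed
  have "hopf_monoid_hom C H (matz_algebra.eval C ?F) (inv_arr C ?r)"
    by (rule hopf_hom_inverse[OF hom]) (simp add: inverse_arrows_inv)
  moreover have "hopf_obj (matz_algebra.eval C ?F) = hopf_obj H \<otimes>\<^sub>o \<I>"
    using hom by (simp add: hopf_monoid_hom_def)
  ultimately have "inverse_arrows (hopf_category C) (matz_algebra.eval C ?F, H, ?r) (H, matz_algebra.eval C ?F, inv_arr C ?r)"
    using hom by (simp add: inverse_arrows_def)
  then have "iso_arr (hopf_category C) (matz_algebra.eval C ?F, H, ?r)"
    unfolding iso_arr_def by blast
  then show "\<exists>F \<in> Obj (algebra_category MatZ C). \<exists>e \<in> homset (hopf_category C) (on_obj eval_functor F) H. iso_arr (hopf_category C) e"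
    using hom by (intro bexI[of _ ?F] bexI[of _ "(matz_algebra.eval C ?F, H, ?r)"])
      (simp_all add: eval_functor_def H.strong_hopf_functor)
qed

end

theorem corollary9:
  fixes C :: "('o, 'a, 'x) smc_scheme"
  assumes "symmetric_monoidal_category C"
  shows "prop_category MatZ \<and>
    equivalent_categories (algebra_category MatZ C) (hopf_category C)"
  using prop_category_MatZ symmetric_monoidal_category.equivalent_algebra_hopf[OF assms] by blast

end
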